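(* Let $R$ be an integral domain in which $2$ is invertible, let $n\ge 1$ and $d\ge 0$ be integers, and let $g(x)=\sum_{0\le t\le d/2}a_{d-2t}x^{d-2t}\in R[x]$ with $a_d=1$. Let $\mathfrak{H}_n^g$ be the associated cyclotomic Sergeev algebra of level $d$ over $R$. Then: (i) if the level $d$ is odd, the superalgebra $\mathfrak{H}_n^g$ is symmetric; (ii) if the level $d$ is even, the superalgebra $\mathfrak{H}_n^g$ is supersymmetric.
   Context: **Cyclotomic Sergeev algebra.** The affine Sergeev algebra $\mathfrak{H}_n$ is the $R$-superalgebra generated by even generators $s_1,\ldots,s_{n-1},x_1,\ldots,x_n$ and odd generators $c_1,\ldots,c_n$ subject to: $s_i^2=1$, $s_is_j=s_js_i$ for $|i-j|>1$, $s_is_{i+1}s_i=s_{i+1}s_is_{i+1}$; $x_ix_j=x_jx_i$ for all $i,j$; $c_i^2=1$, $c_ic_j=-c_jc_i$ for $i\ne j$; $s_ix_i=x_{i+1}s_i-(1+c_ic_{i+1})$; $s_ix_j=x_js_i$ for $j\ne i,i+1$; $s_ic_i=c_{i+1}s_i$, $s_ic_{i+1}=c_is_i$, $s_ic_j=c_js_i$ for $j\neq i,i+1$; $x_ic_i=-c_ix_i$, $x_ic_j=c_jx_i$ for $i\ne j$. The cyclotomic Sergeev algebra is $\mathfrak{H}_n^g:=\mathfrak{H}_n/I_g$, where $I_g$ is the two-sided ideal generated by $g(x_1)$; its level is $d=\deg g$. **Symmetric and supersymmetric superalgebras.** Let $A=A_{\bar 0}\oplus A_{\bar 1}$ be an $R$-superalgebra,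 finitely generated projective as an $R$-module, where $R$ is an integral domain of characteristic different from $2$; let $|\cdot|$ denote parity. $A$ is *symmetric* if there is an $R$-linear map $t:A\to R$ with $t(A_{\bar 1})=0$, $t(xy)=t(yx)$ for all $x,y\in A$, and such that $\hat t:A\to \mathrm{Hom}_R(A,R)$, $a\mapsto t(-\cdot a)$ (that is, $\hat t(a)(x)=t(xa)$), is an isomorphism of $(A,A)$-superbimodules. $A$ is *supersymmetric* if there is an $R$-linear map $t:A\to R$ with $t(A_{\bar 1})=0$, $t(xy)=(-1)^{|x||y|}t(yx)$ for all homogeneous $x,y\in A$, and such that $\hat t:A\to \mathrm{Hom}_R(A,R)$, $a\mapsto t(-\cdot a)$, is an isomorphism of $(A,A)$-superbimodules. The $(A,A)$-bimodule structure on $\mathrm{Hom}_R(A,R)$ is the natural one: $(b\cdot f\cdot c)(x)=f(cxb)$ in the symmetric case, and with the sign rule $(b\cdot f\cdot c)(x)=(-1)^{|c|(|f|+|x|+|b|)}f(cxb)$ for homogeneous elements in the supersymmetric case. *)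

theory Defs
  imports
    "HOL-Library.Poly_Mapping"
    "HOL-Library.Z2"
    "HOL-Computational_Algebra.Polynomial"
    "HOL-Algebra.Algebraic_Closure_Type"
begin

section \<open>Superalgebras\<close>

text \<open>
  The base ring is a type \<open>'r\<close>, viewed as a HOL-Algebra ring through
  \<^const>\<open>ring_of_type_algebra\<close>; algebras over it are HOL-Algebra structures.  Parities live in
  the field \<open>bit\<close> with two elements, so that \<open>+\<close> and \<open>*\<close> on parities are the operations of
  \<open>Z/2Z\<close>, and \<open>koszul p\<close> is \<open>(-1)^p\<close>.
\<close>

record ('r, 'a) superalgebra = "('r, 'a) module" +
  grade :: "bit \<Rightarrow> 'a set"

definition koszul :: "bit \<Rightarrow> 'r::comm_ring_1" where
  "koszul p = (if p = 0 then 1 else - 1)"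

locale superalgebra =
  module "ring_of_type_algebra :: 'r::comm_ring_1 ring" A + ring A
  for A :: "('r::comm_ring_1, 'a, 'm) superalgebra_scheme" +
  assumes smult_mult_left:
      "x \<in> carrier A \<Longrightarrow> y \<in> carrier A \<Longrightarrow> (r \<odot>\<^bsub>A\<^esub> x) \<otimes>\<^bsub>A\<^esub> y = r \<odot>\<^bsub>A\<^esub> (x \<otimes>\<^bsub>A\<^esub> y)"
    and smult_mult_right:
      "x \<in> carrier A \<Longrightarrow> y \<in> carrier A \<Longrightarrow> x \<otimes>\<^bsub>A\<^esub> (r \<odot>\<^bsub>A\<^esub> y) = r \<odot>\<^bsub>A\<^esub> (x \<otimes>\<^bsub>A\<^esub> y)"
    and grade_submodule: "submodule (grade A p) (ring_of_type_algebra :: 'r ring) A"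
    and grade_span: "grade A 0 <+>\<^bsub>A\<^esub> grade A 1 = carrier A"
    and grade_disjoint: "grade A 0 \<inter> grade A 1 = {\<zero>\<^bsub>A\<^esub>}"
    and grade_mult: "x \<in> grade A p \<Longrightarrow> y \<in> grade A q \<Longrightarrow> x \<otimes>\<^bsub>A\<^esub> y \<in> grade A (p + q)"
    and grade_one: "\<one>\<^bsub>A\<^esub> \<in> grade A 0"

text \<open>
  The quotient by a two-sided ideal: the ring \<open>A Quot I\<close> of HOL-Algebra with the induced scalar
  multiplication and the images of the homogeneous parts.  It is a superalgebra when \<open>I\<close> is
  generated by homogeneous elements.
\<close>

definition quot_superalgebra ::
  "('r, 'a, 'm) superalgebra_scheme \<Rightarrow> 'a set \<Rightarrow> ('r, 'a set) superalgebra" where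
  "quot_superalgebra A I =
    \<lparr>carrier = carrier (A Quot I), monoid.mult = monoid.mult (A Quot I), one = monoid.one (A Quot I),
     ring.zero = ring.zero (A Quot I), add = ring.add (A Quot I),
     module.smult = (\<lambda>r K. \<Union>x\<in>K. I +>\<^bsub>A\<^esub> (r \<odot>\<^bsub>A\<^esub> x)),
     grade = (\<lambda>p. (\<lambda>x. I +>\<^bsub>A\<^esub> x) ` grade A p)\<rparr>"

definition poly_eval :: "('r::zero, 'a, 'm) module_scheme \<Rightarrow> 'r poly \<Rightarrow> 'a \<Rightarrow> 'a" where
  "poly_eval A g x = (\<Oplus>\<^bsub>A\<^esub>i\<in>{..Polynomial.degree g}. Polynomial.coeff g i \<odot>\<^bsub>A\<^esub> (x [^]\<^bsub>A\<^esub> i))"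


section \<open>Finitely generated projective modules\<close>

definition linear_maps ::
  "('r, 'a, 'm) module_scheme \<Rightarrow> ('r, 'b, 'n) module_scheme \<Rightarrow> ('a \<Rightarrow> 'b) set" where
  "linear_maps M N = {h \<in> carrier M \<rightarrow> carrier N.
     (\<forall>x\<in>carrier M. \<forall>y\<in>carrier M. h (x \<oplus>\<^bsub>M\<^esub> y) = h x \<oplus>\<^bsub>N\<^esub> h y) \<and>
     (\<forall>r. \<forall>x\<in>carrier M. h (r \<odot>\<^bsub>M\<^esub> x) = r \<odot>\<^bsub>N\<^esub> h x)}"

text \<open>The free module of rank \<open>m\<close>: sequences vanishing from index \<open>m\<close> on.\<close>

definition free_module :: "nat \<Rightarrow> ('r::comm_ring_1, nat \<Rightarrow> 'r) module" where
  "free_module m =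
    \<lparr>carrier = {v. \<forall>i\<ge>m. v i = 0}, monoid.mult = (\<lambda>v w i. v i * w i),
     one = (\<lambda>i. if i < m then 1 else 0), ring.zero = (\<lambda>i. 0), add = (\<lambda>v w i. v i + w i),
     module.smult = (\<lambda>r v i. r * v i)\<rparr>"

text \<open>Finitely generated projective: a direct summand of a free module of finite rank.\<close>

definition fg_projective :: "('r::comm_ring_1, 'a, 'm) module_scheme \<Rightarrow> bool" where
  "fg_projective M \<longleftrightarrow>
    (\<exists>m. \<exists>\<iota> \<in> linear_maps M (free_module m). \<exists>\<pi> \<in> linear_maps (free_module m) M.
       \<forall>x\<in>carrier M. \<pi> (\<iota> x) = x)"


section \<open>Symmetric and supersymmetric superalgebras\<close>

definition linear_form :: "('r::comm_ring_1, 'a, 'm) module_scheme \<Rightarrow> ('a \<Rightarrow> 'r) \<Rightarrow> bool" where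
  "linear_form A f \<longleftrightarrow>
     (\<forall>x\<in>carrier A. \<forall>y\<in>carrier A. f (x \<oplus>\<^bsub>A\<^esub> y) = f x + f y) \<and>
     (\<forall>r. \<forall>x\<in>carrier A. f (r \<odot>\<^bsub>A\<^esub> x) = r * f x)"

text \<open>
  \<open>dual A\<close> is \<open>Hom_R(A,R)\<close>; its elements are extensional, so that equal linear forms are equal
  as functions.  Since the base ring is purely even, a form has parity \<open>p\<close> iff it vanishes on the
  homogeneous part of the other parity.
\<close>

definition dual :: "('r::comm_ring_1, 'a, 'm) module_scheme \<Rightarrow> ('a \<Rightarrow> 'r) set" where
  "dual A = {f \<in> extensional (carrier A). linear_form A f}"

definition dual_grade ::
  "('r::comm_ring_1, 'a, 'm) superalgebra_scheme \<Rightarrow> bit \<Rightarrow> ('a \<Rightarrow> 'r) set" where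
  "dual_grade A p = {f \<in> dual A. \<forall>q. q \<noteq> p \<longrightarrow> (\<forall>x\<in>grade A q. f x = 0)}"

definition form_hat ::
  "('r, 'a, 'm) superalgebra_scheme \<Rightarrow> ('a \<Rightarrow> 'r) \<Rightarrow> 'a \<Rightarrow> ('a \<Rightarrow> 'r)" where
  "form_hat A t a = (\<lambda>x\<in>carrier A. t (x \<otimes>\<^bsub>A\<^esub> a))"

text \<open>Even isomorphisms of modules from \<open>A\<close> onto \<open>Hom_R(A,R)\<close>.\<close>

definition even_iso_dual ::
  "('r::comm_ring_1, 'a, 'm) superalgebra_scheme \<Rightarrow> ('a \<Rightarrow> ('a \<Rightarrow> 'r)) \<Rightarrow> bool" where
  "even_iso_dual A \<Phi> \<longleftrightarrow>
     bij_betw \<Phi> (carrier A) (dual A) \<and>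
     (\<forall>a\<in>carrier A. \<forall>b\<in>carrier A. \<forall>x\<in>carrier A. \<Phi> (a \<oplus>\<^bsub>A\<^esub> b) x = \<Phi> a x + \<Phi> b x) \<and>
     (\<forall>r. \<forall>a\<in>carrier A. \<forall>x\<in>carrier A. \<Phi> (r \<odot>\<^bsub>A\<^esub> a) x = r * \<Phi> a x) \<and>
     (\<forall>p. \<Phi> ` grade A p \<subseteq> dual_grade A p)"

text \<open>
  Compatibility \<open>\<Phi> (b a c) = b \<cdot> \<Phi> a \<cdot> c\<close> with the bimodule structures, evaluated at \<open>x\<close>:
  the action on \<open>Hom_R(A,R)\<close> is \<open>(b \<cdot> f \<cdot> c) x = f (c x b)\<close> in the first definition, and
  \<open>(b \<cdot> f \<cdot> c) x = (-1)^(|c| (|f| + |x| + |b|)) f (c x b)\<close> for homogeneous elements in the second,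
  where the parity of \<open>f = \<Phi> a\<close> is that of \<open>a\<close> because \<open>\<Phi>\<close> is even.
\<close>

definition superbimodule_iso_dual ::
  "('r::comm_ring_1, 'a, 'm) superalgebra_scheme \<Rightarrow> ('a \<Rightarrow> ('a \<Rightarrow> 'r)) \<Rightarrow> bool" where
  "superbimodule_iso_dual A \<Phi> \<longleftrightarrow>
     even_iso_dual A \<Phi> \<and>
     (\<forall>b\<in>carrier A. \<forall>a\<in>carrier A. \<forall>c\<in>carrier A. \<forall>x\<in>carrier A.
        \<Phi> (b \<otimes>\<^bsub>A\<^esub> a \<otimes>\<^bsub>A\<^esub> c) x = \<Phi> a (c \<otimes>\<^bsub>A\<^esub> x \<otimes>\<^bsub>A\<^esub> b))"

definition signed_superbimodule_iso_dual ::
  "('r::comm_ring_1, 'a, 'm) superalgebra_scheme \<Rightarrow> ('a \<Rightarrow> ('a \<Rightarrow> 'r)) \<Rightarrow> bool" where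
  "signed_superbimodule_iso_dual A \<Phi> \<longleftrightarrow>
     even_iso_dual A \<Phi> \<and>
     (\<forall>pb pa pc px. \<forall>b\<in>grade A pb. \<forall>a\<in>grade A pa. \<forall>c\<in>grade A pc. \<forall>x\<in>grade A px.
        \<Phi> (b \<otimes>\<^bsub>A\<^esub> a \<otimes>\<^bsub>A\<^esub> c) x =
          koszul (pc * (pa + px + pb)) * \<Phi> a (c \<otimes>\<^bsub>A\<^esub> x \<otimes>\<^bsub>A\<^esub> b))"

definition symmetric_superalgebra ::
  "('r::comm_ring_1, 'a, 'm) superalgebra_scheme \<Rightarrow> bool" where
  "symmetric_superalgebra A \<longleftrightarrow>
     superalgebra A \<and> fg_projective A \<and>
     (\<exists>t. linear_form A t \<and>
          (\<forall>x\<in>grade A 1. t x = 0) \<and>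
          (\<forall>x\<in>carrier A. \<forall>y\<in>carrier A. t (x \<otimes>\<^bsub>A\<^esub> y) = t (y \<otimes>\<^bsub>A\<^esub> x)) \<and>
          superbimodule_iso_dual A (form_hat A t))"

definition supersymmetric_superalgebra ::
  "('r::comm_ring_1, 'a, 'm) superalgebra_scheme \<Rightarrow> bool" where
  "supersymmetric_superalgebra A \<longleftrightarrow>
     superalgebra A \<and> fg_projective A \<and>
     (\<exists>t. linear_form A t \<and>
          (\<forall>x\<in>grade A 1. t x = 0) \<and>
          (\<forall>p q. \<forall>x\<in>grade A p. \<forall>y\<in>grade A q.
             t (x \<otimes>\<^bsub>A\<^esub> y) = koszul (p * q) * t (y \<otimes>\<^bsub>A\<^esub> x)) \<and>
          signed_superbimodule_iso_dual A (form_hat A t))"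


section \<open>Free superalgebras\<close>

text \<open>
  The free algebra on a set of generators is the monoid algebra of the free monoid of words:
  \<open>'g free_monoid \<Rightarrow>\<^sub>0 'r\<close> carries the convolution product of \<^theory>\<open>HOL-Library.Poly_Mapping\<close>
  once concatenation of words is the (additively written) monoid operation.
\<close>

datatype 'g free_monoid = Word (letters: "'g list")

instantiation free_monoid :: (type) monoid_add
begin

definition zero_free_monoid :: "'a free_monoid" where
  "0 = Word []"

definition plus_free_monoid :: "'a free_monoid \<Rightarrow> 'a free_monoid \<Rightarrow> 'a free_monoid" where
  "v + w = Word (letters v @ letters w)"

instance
  by standard (simp_all add: zero_free_monoid_def plus_free_monoid_def)

end

definition free_superalgebra ::
  "'g set \<Rightarrow> ('g \<Rightarrow> bit) \<Rightarrow> ('r::comm_ring_1, 'g free_monoid \<Rightarrow>\<^sub>0 'r) superalgebra" where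
  "free_superalgebra G par =
    \<lparr>carrier = {f. \<forall>w\<in>Poly_Mapping.keys f. set (letters w) \<subseteq> G},
     monoid.mult = (*), one = 1, ring.zero = 0, add = (+),
     module.smult = (\<lambda>r f. Poly_Mapping.single 0 r * f),
     grade = (\<lambda>p. {f. \<forall>w\<in>Poly_Mapping.keys f. set (letters w) \<subseteq> G \<and> sum_list (map par (letters w)) = p})\<rparr>"

definition generator :: "'g \<Rightarrow> 'g free_monoid \<Rightarrow>\<^sub>0 'r::comm_ring_1" where
  "generator u = Poly_Mapping.single (Word [u]) 1"


section \<open>Sergeev algebras\<close>

datatype sergeev_letter = S_letter nat | X_letter nat | C_letter nat

fun sergeev_parity :: "sergeev_letter \<Rightarrow> bit" where
  "sergeev_parity (S_letter i) = 0"
| "sergeev_parity (X_letter i) = 0"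
| "sergeev_parity (C_letter i) = 1"

definition sergeev_letters :: "nat \<Rightarrow> sergeev_letter set" where
  "sergeev_letters n = S_letter ` {1..<n} \<union> X_letter ` {1..n} \<union> C_letter ` {1..n}"

type_synonym 'r sergeev_free = "sergeev_letter free_monoid \<Rightarrow>\<^sub>0 'r"

abbreviation gs :: "nat \<Rightarrow> 'r::comm_ring_1 sergeev_free" where "gs i \<equiv> generator (S_letter i)"
abbreviation gx :: "nat \<Rightarrow> 'r::comm_ring_1 sergeev_free" where "gx i \<equiv> generator (X_letter i)"
abbreviation gc :: "nat \<Rightarrow> 'r::comm_ring_1 sergeev_free" where "gc i \<equiv> generator (C_letter i)"

inductive sergeev_rel ::
  "nat \<Rightarrow> 'r::comm_ring_1 sergeev_free \<Rightarrow> 'r sergeev_free \<Rightarrow> bool" for n :: nat where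
  "i \<in> {1..<n} \<Longrightarrow> sergeev_rel n (gs i * gs i) 1"
| "i \<in> {1..<n} \<Longrightarrow> j \<in> {1..<n} \<Longrightarrow> \<bar>int i - int j\<bar> > 1 \<Longrightarrow>
     sergeev_rel n (gs i * gs j) (gs j * gs i)"
| "i \<in> {1..<n} \<Longrightarrow> i + 1 \<in> {1..<n} \<Longrightarrow>
     sergeev_rel n (gs i * gs (i + 1) * gs i) (gs (i + 1) * gs i * gs (i + 1))"
| "i \<in> {1..n} \<Longrightarrow> j \<in> {1..n} \<Longrightarrow> sergeev_rel n (gx i * gx j) (gx j * gx i)"
| "i \<in> {1..n} \<Longrightarrow> sergeev_rel n (gc i * gc i) 1"
| "i \<in> {1..n} \<Longrightarrow> j \<in> {1..n} \<Longrightarrow> i \<noteq> j \<Longrightarrow> sergeev_rel n (gc i * gc j) (- (gc j * gc i))"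
| "i \<in> {1..<n} \<Longrightarrow>
     sergeev_rel n (gs i * gx i) (gx (i + 1) * gs i - (1 + gc i * gc (i + 1)))"
| "i \<in> {1..<n} \<Longrightarrow> j \<in> {1..n} \<Longrightarrow> j \<noteq> i \<Longrightarrow> j \<noteq> i + 1 \<Longrightarrow>
     sergeev_rel n (gs i * gx j) (gx j * gs i)"
| "i \<in> {1..<n} \<Longrightarrow> sergeev_rel n (gs i * gc i) (gc (i + 1) * gs i)"
| "i \<in> {1..<n} \<Longrightarrow> sergeev_rel n (gs i * gc (i + 1)) (gc i * gs i)"
| "i \<in> {1..<n} \<Longrightarrow> j \<in> {1..n} \<Longrightarrow> j \<noteq> i \<Longrightarrow> j \<noteq> i + 1 \<Longrightarrow>
     sergeev_rel n (gs i * gc j) (gc j * gs i)"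
| "i \<in> {1..n} \<Longrightarrow> sergeev_rel n (gx i * gc i) (- (gc i * gx i))"
| "i \<in> {1..n} \<Longrightarrow> j \<in> {1..n} \<Longrightarrow> i \<noteq> j \<Longrightarrow> sergeev_rel n (gx i * gc j) (gc j * gx i)"

definition sergeev_free_superalgebra ::
  "nat \<Rightarrow> ('r::comm_ring_1, 'r sergeev_free) superalgebra" where
  "sergeev_free_superalgebra n = free_superalgebra (sergeev_letters n) sergeev_parity"

definition sergeev_relation_ideal :: "nat \<Rightarrow> 'r::comm_ring_1 sergeev_free set" where
  "sergeev_relation_ideal n =
     genideal (sergeev_free_superalgebra n) {u - v | u v. sergeev_rel n u v}"

definition affine_sergeev :: "nat \<Rightarrow> ('r::comm_ring_1, 'r sergeev_free set) superalgebra" where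
  "affine_sergeev n = quot_superalgebra (sergeev_free_superalgebra n) (sergeev_relation_ideal n)"

text \<open>The image of \<open>x\<^sub>1\<close> in the affine Sergeev superalgebra, for \<open>n \<ge> 1\<close>.\<close>

definition affine_x1 :: "nat \<Rightarrow> 'r::comm_ring_1 sergeev_free set" where
  "affine_x1 n = sergeev_relation_ideal n +>\<^bsub>sergeev_free_superalgebra n\<^esub> gx 1"

definition cyclotomic_sergeev ::
  "nat \<Rightarrow> 'r::comm_ring_1 poly \<Rightarrow> ('r, 'r sergeev_free set set) superalgebra" where
  "cyclotomic_sergeev n g =
     quot_superalgebra (affine_sergeev n)
       (genideal (affine_sergeev n) {poly_eval (affine_sergeev n) g (affine_x1 n)})"

end

theory Submission
  imports Defs "HOL-Library.Function_Algebras"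
begin

text \<open>Modulo the relations, every element of the algebra is a combination of x_1^(a_1) ...
  x_n^(a_n) y with 0 <= a_i < d, where y runs over finitely many words in the s_i and c_i, one from
  each class up to sign. Let X = x_1^(d-1) ... x_n^(d-1), and let t read off the coefficient of X
  (with y = 1). It has to be shown that t exists, that it is a trace up to a sign, and that it
  induces a perfect pairing.

  Existence of t: a linear form with these values comes from a representation, built by induction on
  n. If H_n acts on W, then H_(n+1) acts on the coinduced module Hom(H_(n+1), W) over H_n. In
  coordinates, a vector f is the family of its values at s_n ... s_1 c_1^b x_1^a s_1 ... s_(j-1),
  and each row in a obeys the linear recurrence with characteristic polynomial g. That the relations
  of rank n+1 hold on such families is \<open>small_sergeev_step\<close>; the hard ones are x_1 x_2
  = x_2 x_1 (\<open>X'X2'\<close>) and g(x_1) = 0 (\<open>g_X'\<close>, by \<open>Theta\<close> and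
  \<open>shift_swap\<close>). A vector \<open>om\<close>, a functional \<open>ev\<close> and a
  filtration are carried through the induction (\<open>sergeev_rep_step\<close>), so that t(f) =
  ev(f om) vanishes on words with fewer than n(d-1) letters x and has the required values on X y. A
  parity operator, together with the invertibility of 2, makes t vanish on odd elements
  (\<open>ev_odd\<close>).

  Trace property: X commutes with s_i, and c_i X = (-1)^(d-1) X c_i (\<open>top_S\<close>,
  \<open>top_C\<close>); moreover t(X y) is a delta function on the group generated by the s_i and
  c_i, so it is invariant under conjugation (\<open>tau_cyc\<close>). This settles s_i and c_i. For
  x_1 the decisive point is the shape of g: there is no term of degree d-1, so x_1^d falls by two
  degrees (\<open>x1_pow\<close>), and x_1 X is below the top degree (\<open>tr_X1\<close>). The
  remaining x_i follow from x_(i+1) = s_i x_i s_i + s_i + c_i s_i c_i. Altogether t(w f) =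
  (-1)^((d-1)k) t(f w) for a word w with k letters c (\<open>trace_word\<close>): a trace for odd d,
  a supertrace for even d > 0.

  Perfect pairing: the elements X^A y and y^(-1) X^(top-A) have a triangular Gram matrix with
  diagonal entries 1 or -1, ordered by the degree of A (\<open>gram_off\<close>,
  \<open>gram_diag\<close>). Hence the spanning family is a basis, and t induces a bijection onto
  the dual (\<open>nondegenerate\<close>, \<open>triangular_solve\<close>, \<open>hat_bij\<close>).
  For d = 0 the algebra is zero.\<close>

section \<open>Modules over the base ring, linear operators and submodules\<close>

locale scaled =
  fixes scale :: "'r::comm_ring_1 \<Rightarrow> 'v::ab_group_add \<Rightarrow> 'v" (infixr \<open>\<cdot>\<close> 75)
  assumes scale_add_right: "r \<cdot> (u + v) = r \<cdot> u + r \<cdot> v"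
    and scale_add_left: "(r + q) \<cdot> v = r \<cdot> v + q \<cdot> v"
    and scale_scale: "r \<cdot> (q \<cdot> v) = (r * q) \<cdot> v"
    and scale_one [simp]: "1 \<cdot> v = v"
begin

definition lin :: "('v \<Rightarrow> 'v) \<Rightarrow> bool" where
  "lin f \<longleftrightarrow> (\<forall>u v. f (u + v) = f u + f v) \<and> (\<forall>r v. f (r \<cdot> v) = r \<cdot> f v)"

definition subsp :: "'v set \<Rightarrow> bool" where
  "subsp W \<longleftrightarrow> 0 \<in> W \<and> (\<forall>u\<in>W. \<forall>v\<in>W. u + v \<in> W) \<and> (\<forall>r. \<forall>v\<in>W. r \<cdot> v \<in> W)"

lemma scale_zero_right [simp]: "r \<cdot> 0 = 0"
  using scale_add_right[of r 0 0] by simp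

lemma scale_zero_left [simp]: "0 \<cdot> v = 0"
  using scale_add_left[of 0 0 v] by simp

lemma scale_minus_left [simp]: "(- r) \<cdot> v = - (r \<cdot> v)"
  using scale_add_left[of "- r" r v] by (simp add: eq_neg_iff_add_eq_0)

lemma scale_minus_right [simp]: "r \<cdot> (- v) = - (r \<cdot> v)"
  using scale_add_right[of r "- v" v] by (simp add: eq_neg_iff_add_eq_0)

lemma scale_diff_right: "r \<cdot> (u - v) = r \<cdot> u - r \<cdot> v"
  using scale_add_right[of r u "- v"] by simp

lemma scale_sum_right: "r \<cdot> (\<Sum>i\<in>I. f i) = (\<Sum>i\<in>I. r \<cdot> f i)"
  by (induction I rule: infinite_finite_induct) (auto simp: scale_add_right)

lemma scale_sum_left: "(\<Sum>i\<in>I. f i) \<cdot> v = (\<Sum>i\<in>I. f i \<cdot> v)"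
  by (induction I rule: infinite_finite_induct) (auto simp: scale_add_left)

lemma lin_add: "lin f \<Longrightarrow> f (u + v) = f u + f v"
  and lin_scale: "lin f \<Longrightarrow> f (r \<cdot> v) = r \<cdot> f v"
  by (auto simp: lin_def)

lemma lin_zero: "lin f \<Longrightarrow> f 0 = 0"
  using lin_add[of f 0 0] by simp

lemma lin_minus: "lin f \<Longrightarrow> f (- v) = - f v"
  using lin_add[of f "- v" v] lin_zero[of f] by (simp add: eq_neg_iff_add_eq_0)

lemma lin_diff: "lin f \<Longrightarrow> f (u - v) = f u - f v"
  using lin_add[of f u "- v"] lin_minus[of f v] by simp

lemma lin_sum: "lin f \<Longrightarrow> f (\<Sum>i\<in>I. h i) = (\<Sum>i\<in>I. f (h i))"
  by (induction I rule: infinite_finite_induct) (auto simp: lin_add lin_zero)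

lemmas lin_rules = lin_add lin_scale lin_zero lin_minus lin_diff lin_sum

lemma lin_id: "lin (\<lambda>v. v)" and lin_0: "lin (\<lambda>v. 0)" by (auto simp: lin_def)

lemma lin_comp: "lin f \<Longrightarrow> lin h \<Longrightarrow> lin (\<lambda>v. f (h v))" by (auto simp: lin_def)

lemma lin_funpow: "lin f \<Longrightarrow> lin (f ^^ k)"
  by (induction k) (auto simp: lin_def)

lemma subspD: assumes "subsp W" shows "0 \<in> W" "u \<in> W \<Longrightarrow> v \<in> W \<Longrightarrow> u + v \<in> W" "v \<in> W \<Longrightarrow> r \<cdot> v \<in> W"
    "v \<in> W \<Longrightarrow> - v \<in> W" "u \<in> W \<Longrightarrow> v \<in> W \<Longrightarrow> u - v \<in> W"
proof -
  note A = assms[unfolded subsp_def]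
  show "0 \<in> W" "u \<in> W \<Longrightarrow> v \<in> W \<Longrightarrow> u + v \<in> W" "v \<in> W \<Longrightarrow> r \<cdot> v \<in> W" using A by auto
  show neg: "v \<in> W \<Longrightarrow> - v \<in> W" for v using A scale_minus_left[of 1 v] by (metis scale_one)
  show "u \<in> W \<Longrightarrow> v \<in> W \<Longrightarrow> u - v \<in> W"
    using A neg[of v] by (metis add_uminus_conv_diff)
qed

lemma subsp_sum: "subsp W \<Longrightarrow> (\<And>i. i \<in> I \<Longrightarrow> h i \<in> W) \<Longrightarrow> (\<Sum>i\<in>I. h i) \<in> W"
  by (induction I rule: infinite_finite_induct) (auto simp: subspD)

end

section \<open>Modules of rank n described by x_1, c_1 and the s_i\<close>

text \<open>The other generators are words in these: c_2 = s_1 c_1 s_1 and x_2 = s_1 x_1 s_1 + s_1 +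
  c_1 s_1 c_1, and so on. In these terms \<open>cc2\<close>, \<open>xc2\<close> and
  \<open>xx2\<close> are the relations c_1 c_2 = - c_2 c_1, x_1 c_2 = c_2 x_1 and x_1 x_2 = x_2 x_1.
  A short list of relations keeps the induction step small. The operators are total on the type, and
  the relations are imposed on the submodule \<open>W\<close>.\<close>

locale small_sergeev = scaled scale
  for scale :: "'r::comm_ring_1 \<Rightarrow> 'v::ab_group_add \<Rightarrow> 'v" (infixr \<open>\<cdot>\<close> 75) +
  fixes g :: "'r poly" and n :: nat and W :: "'v set" and x c :: "'v \<Rightarrow> 'v" and s :: "nat \<Rightarrow> 'v \<Rightarrow> 'v"
  assumes g_par: "coeff g m \<noteq> 0 \<Longrightarrow> even m = even (degree g)"
    and W: "subsp W"
    and lin_x: "lin x" and lin_c: "lin c" and lin_s: "lin (s i)"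
    and xW: "n \<ge> 1 \<Longrightarrow> v \<in> W \<Longrightarrow> x v \<in> W"
    and cW: "n \<ge> 1 \<Longrightarrow> v \<in> W \<Longrightarrow> c v \<in> W"
    and sW: "1 \<le> i \<Longrightarrow> i < n \<Longrightarrow> v \<in> W \<Longrightarrow> s i v \<in> W"
    and ss: "1 \<le> i \<Longrightarrow> i < n \<Longrightarrow> v \<in> W \<Longrightarrow> s i (s i v) = v"
    and far: "1 \<le> i \<Longrightarrow> i + 1 < j \<Longrightarrow> j < n \<Longrightarrow> v \<in> W \<Longrightarrow> s j (s i v) = s i (s j v)"
    and braid: "1 \<le> i \<Longrightarrow> i + 1 < n \<Longrightarrow> v \<in> W \<Longrightarrow> s (Suc i) (s i (s (Suc i) v)) = s i (s (Suc i) (s i v))"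
    and cc: "n \<ge> 1 \<Longrightarrow> v \<in> W \<Longrightarrow> c (c v) = v"
    and xc: "n \<ge> 1 \<Longrightarrow> v \<in> W \<Longrightarrow> x (c v) = - c (x v)"
    and gx: "n \<ge> 1 \<Longrightarrow> v \<in> W \<Longrightarrow> (\<Sum>m\<le>degree g. coeff g m \<cdot> (x ^^ m) v) = 0"
    and sx: "2 \<le> i \<Longrightarrow> i < n \<Longrightarrow> v \<in> W \<Longrightarrow> s i (x v) = x (s i v)"
    and sc: "2 \<le> i \<Longrightarrow> i < n \<Longrightarrow> v \<in> W \<Longrightarrow> s i (c v) = c (s i v)"
    and cc2: "n \<ge> 2 \<Longrightarrow> v \<in> W \<Longrightarrow> c (s 1 (c (s 1 v))) = - s 1 (c (s 1 (c v)))"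
    and xc2: "n \<ge> 2 \<Longrightarrow> v \<in> W \<Longrightarrow> x (s 1 (c (s 1 v))) = s 1 (c (s 1 (x v)))"
    and xx2: "n \<ge> 2 \<Longrightarrow> v \<in> W \<Longrightarrow> x (s 1 (x (s 1 v)) + s 1 v + c (s 1 (c v))) =
        s 1 (x (s 1 (x v))) + s 1 (x v) + c (s 1 (c (x v)))"
begin

lemmas x_lin [simp] = lin_rules[OF lin_x]
lemmas c_lin [simp] = lin_rules[OF lin_c]
lemmas s_lin [simp] = lin_rules[OF lin_s]
lemmas xp_lin [simp] = lin_rules[OF lin_funpow[OF lin_x]]
lemmas W_rules [simp] = subspD[OF W]

lemma xpW [simp]: "n \<ge> 1 \<Longrightarrow> v \<in> W \<Longrightarrow> (x ^^ a) v \<in> W"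
  by (induction a) (auto simp: xW)

lemmas W_cl [simp] = xW cW sW

text \<open>The sign (-1)^a on vectors, written as a case split so that it passes through every
  additive operator.\<close>

definition se :: "nat \<Rightarrow> 'v \<Rightarrow> 'v" where "se a v = (if even a then v else - v)"

lemma se_simps [simp]: "se 0 v = v" "se (Suc a) v = - se a v" "se a (se a v) = v" "se a (- v) = - se a v" "se a 0 = 0"
  "se a (u + v) = se a u + se a v" "se a (u - v) = se a u - se a v" "se (a + b) v = se a (se b v)"
  "x (se a v) = se a (x v)" "c (se a v) = se a (c v)" "s i (se a v) = se a (s i v)" "(x ^^ b) (se a v) = se a ((x ^^ b) v)"
  "se a (r \<cdot> v) = r \<cdot> se a v" "v \<in> W \<Longrightarrow> se a v \<in> W"
  by (auto simp: se_def)

lemma xpc: "n \<ge> 1 \<Longrightarrow> v \<in> W \<Longrightarrow> (x ^^ a) (c v) = se a (c ((x ^^ a) v))"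
  by (induction a) (auto simp: xc)

lemma sxp: "2 \<le> i \<Longrightarrow> i < n \<Longrightarrow> v \<in> W \<Longrightarrow> s i ((x ^^ a) v) = (x ^^ a) (s i v)"
  by (induction a) (auto simp: sx)

section \<open>Operators on families indexed by powers of c_1 and x_1\<close>

text \<open>Read h b a as the value of a coinduced vector at z c_1^b x_1^a, where z = s_n ... s_1.
  To apply x_1 behind a further s_1, one writes s_1 x_1 = x_2 s_1 - (1 + c_1 c_2), moves x_2 left to
  z and uses s_1 x_2 = x_1 s_1 + (1 - c_1 c_2). The result is x_1 acting on the value, plus two
  corrections; \<open>Kop h\<close> is their sum, the value at s_n ... s_2 (1 - c_1 c_2) c_1^b x_1^a
  s_1 minus the value at z c_1^b x_1^a (1 + c_1 c_2).\<close>

definition Kop :: "(bool \<Rightarrow> nat \<Rightarrow> 'v) \<Rightarrow> bool \<Rightarrow> nat \<Rightarrow> 'v" where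
  "Kop h b a = (if b then c ((x ^^ a) (h False 0)) - h True a - se a (c (h False a)) + (x ^^ a) (h True 0)
     else (x ^^ a) (h False 0) - h False a + se a (c (h True a)) - c ((x ^^ a) (h True 0)))"

text \<open>In the same reading, \<open>Lc\<close>, \<open>Lx\<close> and \<open>Ct\<close> multiply
  the argument on the right by c_1, x_1 and c_2; the sign in \<open>Ct\<close> is the price of
  passing c_1^b, the one in \<open>Lc\<close> that of passing x_1^a. \<open>Yp\<close> and
  \<open>Sp\<close> act on the values. \<open>Zop\<close> is the half of \<open>Kop\<close> that
  stems from 1 - c_1 c_2.\<close>

definition Lc :: "(bool \<Rightarrow> nat \<Rightarrow> 'v) \<Rightarrow> bool \<Rightarrow> nat \<Rightarrow> 'v" where "Lc h b a = se a (h (\<not> b) a)"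
definition Lx :: "(bool \<Rightarrow> nat \<Rightarrow> 'v) \<Rightarrow> bool \<Rightarrow> nat \<Rightarrow> 'v" where "Lx h b a = h b (Suc a)"
definition Ct :: "(bool \<Rightarrow> nat \<Rightarrow> 'v) \<Rightarrow> bool \<Rightarrow> nat \<Rightarrow> 'v" where "Ct h b a = (if b then - c (h b a) else c (h b a))"
definition Yp :: "(bool \<Rightarrow> nat \<Rightarrow> 'v) \<Rightarrow> bool \<Rightarrow> nat \<Rightarrow> 'v" where "Yp h b a = x (h b a)"
definition Sp :: "nat \<Rightarrow> (bool \<Rightarrow> nat \<Rightarrow> 'v) \<Rightarrow> bool \<Rightarrow> nat \<Rightarrow> 'v" where "Sp i h b a = s i (h b a)"
definition Zop :: "(bool \<Rightarrow> nat \<Rightarrow> 'v) \<Rightarrow> bool \<Rightarrow> nat \<Rightarrow> 'v" where "Zop h b a = Kop h b a + h b a + Lc (Ct h) b a"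
definition pl :: "(bool \<Rightarrow> nat \<Rightarrow> 'v) \<Rightarrow> (bool \<Rightarrow> nat \<Rightarrow> 'v) \<Rightarrow> bool \<Rightarrow> nat \<Rightarrow> 'v" (infixl "\<boxplus>" 65) where "pl h k b a = h b a + k b a"
definition mi :: "(bool \<Rightarrow> nat \<Rightarrow> 'v) \<Rightarrow> bool \<Rightarrow> nat \<Rightarrow> 'v" where "mi h b a = - h b a"

definition MW :: "(bool \<Rightarrow> nat \<Rightarrow> 'v) set" where "MW = {h. \<forall>b a. h b a \<in> W}"

lemma MW_D [simp]: "h \<in> MW \<Longrightarrow> h b a \<in> W" by (auto simp: MW_def)

lemmas op_defs = Kop_def Lc_def Lx_def Ct_def Yp_def Sp_def Zop_def pl_def mi_def

lemma pl_simps [simp]: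
  "pl h k b a = h b a + k b a"
  "Lc (pl h k) = pl (Lc h) (Lc k)" "Lx (pl h k) = pl (Lx h) (Lx k)" "Ct (pl h k) = pl (Ct h) (Ct k)"
  "Yp (pl h k) = pl (Yp h) (Yp k)" "Sp i (pl h k) = pl (Sp i h) (Sp i k)" "Kop (pl h k) = pl (Kop h) (Kop k)"
  "Zop (pl h k) = pl (Zop h) (Zop k)"
  "Lc (mi h) = mi (Lc h)" "Lx (mi h) = mi (Lx h)" "Ct (mi h) = mi (Ct h)"
  "Yp (mi h) = mi (Yp h)" "Sp i (mi h) = mi (Sp i h)" "Kop (mi h) = mi (Kop h)"
  "Zop (mi h) = mi (Zop h)" "mi (mi h) = h"
  by (auto simp: op_defs fun_eq_iff)

lemma MW_cl [simp]:
  assumes "h \<in> MW"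
  shows "n \<ge> 1 \<Longrightarrow> Kop h \<in> MW" "Lc h \<in> MW" "Lx h \<in> MW" "n \<ge> 1 \<Longrightarrow> Ct h \<in> MW" "n \<ge> 1 \<Longrightarrow> Yp h \<in> MW"
    "1 \<le> i \<Longrightarrow> i < n \<Longrightarrow> Sp i h \<in> MW" "n \<ge> 1 \<Longrightarrow> Zop h \<in> MW" "k \<in> MW \<Longrightarrow> pl h k \<in> MW" "mi h \<in> MW"
proof -
  have 1: "h b a \<in> W" for b a using assms by simp
  show K: "n \<ge> 1 \<Longrightarrow> Kop h \<in> MW" unfolding MW_def Kop_def using 1 by simp
  show "Lc h \<in> MW" "Lx h \<in> MW" "mi h \<in> MW" unfolding MW_def Lc_def Lx_def mi_def using 1 by simp_all
  show C: "n \<ge> 1 \<Longrightarrow> Ct h \<in> MW" unfolding MW_def Ct_def using 1 by simp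
  show "n \<ge> 1 \<Longrightarrow> Yp h \<in> MW" unfolding MW_def Yp_def using 1 by simp
  show "1 \<le> i \<Longrightarrow> i < n \<Longrightarrow> Sp i h \<in> MW" unfolding MW_def Sp_def using 1 by simp
  show "n \<ge> 1 \<Longrightarrow> Zop h \<in> MW" unfolding MW_def Zop_def Lc_def using 1 K C by simp
  show "k \<in> MW \<Longrightarrow> pl h k \<in> MW" unfolding MW_def pl_def using 1 by simp
qed

context assumes n1: "n \<ge> 1"
begin

lemma M1: "h \<in> MW \<Longrightarrow> Kop (Lc h) = mi (Ct (Kop h))"
  using n1 by (auto simp: fun_eq_iff op_defs cc algebra_simps)

lemma M2: "h \<in> MW \<Longrightarrow> Kop (Ct h) = Lc (Kop h)"
  using n1 by (auto simp: fun_eq_iff op_defs cc xpc algebra_simps)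

lemma M4: "h \<in> MW \<Longrightarrow> Lx (Zop h) = Zop (Yp h)"
  using n1 by (auto simp: fun_eq_iff op_defs cc xpc xc algebra_simps funpow_swap1)

text \<open>At a = 0 the four terms cancel in pairs. This makes evaluation at 1 equivariant and
  simplifies compositions of \<open>Kop\<close> with itself.\<close>

lemma K0: "h \<in> MW \<Longrightarrow> Kop h b 0 = 0"
  using n1 by (auto simp: op_defs cc algebra_simps)

text \<open>After cancellation \<open>Zop\<close> depends only on the values at a = 0, and these
  vanish for \<open>Kop h\<close>.\<close>

lemma M5: "h \<in> MW \<Longrightarrow> Zop (Kop h) = (\<lambda>b a. 0)"
  using n1 by (auto simp: fun_eq_iff op_defs cc xpc xc algebra_simps)

lemma M6: "h \<in> MW \<Longrightarrow> Kop (Zop h) = (\<lambda>b a. 0)"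
  using n1 by (auto simp: fun_eq_iff op_defs cc xpc xc algebra_simps)

text \<open>What x_1 x_2 = x_2 x_1 amounts to on the second slice, once \<open>M6\<close> has
  removed the mixed term; \<open>M4\<close> plays the same part on the first slice.\<close>

lemma M7: "h \<in> MW \<Longrightarrow> Yp (pl h (Ct (Lc h))) \<boxplus> Kop (Yp h) = Lx (Kop h) \<boxplus> Lx h \<boxplus> Ct (Lc (Lx h))"
  using n1 by (auto simp: fun_eq_iff op_defs cc xpc xc algebra_simps funpow_swap1)

lemma M10: "h \<in> MW \<Longrightarrow> 2 \<le> i \<Longrightarrow> i < n \<Longrightarrow> Kop (Sp i h) = Sp i (Kop h)"
  using n1 by (auto simp: fun_eq_iff op_defs sxp sc algebra_simps)

end


text \<open>These are x_2 and c_2; the defining formula is s_1 x_1 = x_2 s_1 - (1 + c_1 c_2) solved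
  for x_2.\<close>

definition x2 :: "'v \<Rightarrow> 'v" where "x2 v = s 1 (x (s 1 v)) + s 1 v + c (s 1 (c v))"
definition c2 :: "'v \<Rightarrow> 'v" where "c2 v = s 1 (c (s 1 v))"

lemma lin_x2: "lin x2" and lin_c2: "lin c2"
  by (auto simp: lin_def x2_def c2_def scale_add_right)

lemmas x2_lin [simp] = lin_rules[OF lin_x2]
lemmas c2_lin [simp] = lin_rules[OF lin_c2]

context assumes n2: "n \<ge> 2"
begin

lemma x2W [simp]: "v \<in> W \<Longrightarrow> x2 v \<in> W" and c2W [simp]: "v \<in> W \<Longrightarrow> c2 v \<in> W"
  using n2 by (auto simp: x2_def c2_def)

lemma ss1: "v \<in> W \<Longrightarrow> s (Suc 0) (s (Suc 0) v) = v" using ss[of 1 v] n2 by simp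

lemma x2x: "v \<in> W \<Longrightarrow> x2 (x v) = x (x2 v)" using xx2[OF n2] by (simp add: x2_def)
lemma c2x: "v \<in> W \<Longrightarrow> c2 (x v) = x (c2 v)" using xc2[OF n2] by (simp add: c2_def)
lemma c2c: "v \<in> W \<Longrightarrow> c2 (c v) = - c (c2 v)" using cc2[OF n2] by (simp add: c2_def)
lemma x2xp: "v \<in> W \<Longrightarrow> x2 ((x ^^ a) v) = (x ^^ a) (x2 v)" using n2 by (induction a) (auto simp: x2x)
lemma c2xp: "v \<in> W \<Longrightarrow> c2 ((x ^^ a) v) = (x ^^ a) (c2 v)" using n2 by (induction a) (auto simp: c2x)

text \<open>The relation x_1 c_2 = c_2 x_1, conjugated by s_1, carries c_1 through s_1 x_1 s_1,
  while the remaining terms s_1 and c_1 s_1 c_1 are interchanged.\<close>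

lemma x2c: assumes v: "v \<in> W" shows "x2 (c v) = c (x2 v)"
proof -
  have *: "x (s 1 (c v)) = s 1 (c (s 1 (x (s 1 v))))"
    using xc2[OF n2, of "s 1 v"] v n2 by (simp add: ss1)
  have "s 1 (x (s 1 (c v))) = c (s 1 (x (s 1 v)))"
    unfolding * using v n2 by (simp add: ss1)
  then show ?thesis using v n2 by (simp add: x2_def cc)
qed

lemma x2s: "v \<in> W \<Longrightarrow> x2 (s 1 v) = s 1 (x v) + v + c (c2 v)"
  using n2 by (simp add: x2_def c2_def ss1)

lemma xs1: assumes "v \<in> W" shows "x (s 1 v) = s 1 (x2 v) - v + c (c2 v)"
proof -
  have "s 1 (x2 v) = x (s 1 v) + v + s 1 (c (s 1 (c v)))"
    using assms n2 by (simp add: x2_def ss1)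
  moreover have "s 1 (c (s 1 (c v))) = - c (c2 v)" using c2c[OF assms] by (simp add: c2_def)
  ultimately show ?thesis by simp
qed

lemma se_x2: "x2 (se a v) = se a (x2 v)" and se_c2: "c2 (se a v) = se a (c2 v)"
  by (auto simp: se_def)

definition Y2 :: "(bool \<Rightarrow> nat \<Rightarrow> 'v) \<Rightarrow> bool \<Rightarrow> nat \<Rightarrow> 'v" where "Y2 h b a = x2 (h b a)"
definition C2 :: "(bool \<Rightarrow> nat \<Rightarrow> 'v) \<Rightarrow> bool \<Rightarrow> nat \<Rightarrow> 'v" where "C2 h b a = (if b then - c2 (h b a) else c2 (h b a))"

lemma MW_cl2 [simp]: "h \<in> MW \<Longrightarrow> Y2 h \<in> MW" "h \<in> MW \<Longrightarrow> C2 h \<in> MW"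
  by (simp_all add: MW_def Y2_def C2_def del: MW_D)

lemma pl2_simps [simp]: "Y2 (pl h k) = pl (Y2 h) (Y2 k)" "C2 (pl h k) = pl (C2 h) (C2 k)"
  "Y2 (mi h) = mi (Y2 h)" "C2 (mi h) = mi (C2 h)"
  by (auto simp: fun_eq_iff op_defs Y2_def C2_def)

lemma C2_eq: "C2 h = Sp 1 (Ct (Sp 1 h))" by (auto simp: fun_eq_iff op_defs C2_def c2_def)

lemma Y2_eq: "h \<in> MW \<Longrightarrow> Y2 h = Sp 1 (Yp (Sp 1 h)) \<boxplus> Sp 1 h \<boxplus> Ct (Sp 1 (Ct h))"
  by (auto simp: fun_eq_iff op_defs Y2_def x2_def)

text \<open>\<open>Kop\<close> is composed of x_1, c_1 and signs, and c_2 commutes with x_1 and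
  anticommutes with c_1; the sign in \<open>C2\<close> absorbs the anticommutation. In
  \<open>M3'\<close> the operator x_2 commutes with both.\<close>

lemma M3: "h \<in> MW \<Longrightarrow> Kop (C2 h) = C2 (Kop h)"
  using n2 by (auto simp: fun_eq_iff op_defs C2_def c2c c2xp se_c2 algebra_simps)

lemma M3': "h \<in> MW \<Longrightarrow> Kop (Y2 h) = Y2 (Kop h)"
  using n2 by (auto simp: fun_eq_iff op_defs Y2_def x2c x2xp se_x2 algebra_simps)

lemma SY: "h \<in> MW \<Longrightarrow> Sp 1 (Yp h) \<boxplus> h \<boxplus> Ct (C2 h) = Y2 (Sp 1 h)"
  by (auto simp: fun_eq_iff op_defs Y2_def C2_def x2s algebra_simps simp del: One_nat_def)

lemma YS: "h \<in> MW \<Longrightarrow> Yp (Sp 1 h) = Sp 1 (Y2 h) \<boxplus> mi h \<boxplus> Ct (C2 h)"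
  by (auto simp: fun_eq_iff op_defs Y2_def C2_def xs1 algebra_simps simp del: One_nat_def)

lemma SCC: "h \<in> MW \<Longrightarrow> Sp 1 (C2 h) = Ct (Sp 1 h)"
  using n2 by (auto simp: fun_eq_iff op_defs C2_def c2_def ss1)

text \<open>On a family vanishing at a = 0 the \<open>Zop\<close> half of \<open>Kop\<close>
  disappears, and what remains is minus (1 + right multiplication by c_1 c_2), which is computed
  slot by slot.\<close>

lemma Kkill: assumes "h \<in> MW" "\<And>b. h b 0 = 0"
  shows "Kop (Sp 1 h) = (\<lambda>b a. - Sp 1 h b a + (if b then - se a (c (Sp 1 h False a)) else se a (c (Sp 1 h True a))))"
  using assms by (auto simp: fun_eq_iff op_defs)

text \<open>By \<open>K0\<close> the inner family \<open>Kop h\<close> vanishes at a = 0, so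
  \<open>Kkill\<close> evaluates the outer \<open>Kop\<close>; conjugation by s_1 then turns c_1
  into c_2.\<close>

lemma SKSK: assumes "h \<in> MW"
  shows "Sp 1 (Kop (Sp 1 (Kop h))) = mi (Kop h) \<boxplus> mi (Lc (C2 (Kop h)))"
proof -
  have "Sp 1 (Kop (Sp 1 k)) = mi k \<boxplus> mi (Lc (C2 k))" if k: "k \<in> MW" "\<And>b. k b 0 = 0" for k
    unfolding Kkill[OF k] using k n2
    by (auto simp: fun_eq_iff op_defs C2_def c2_def ss1)
  from this[of "Kop h"] show ?thesis using assms n2 by (simp add: K0)
qed

text \<open>Apply \<open>Kop\<close> to x_2 s_1 = s_1 x_1 + 1 + c_1 c_2. Since \<open>Kop\<close>
  commutes with x_2, the two surplus terms are exactly those computed in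
  \<open>SKSK\<close>.\<close>

lemma M8: assumes h: "h \<in> MW"
  shows "Kop (Sp 1 (Yp h)) = Y2 (Kop (Sp 1 h)) \<boxplus> Sp 1 (Kop (Sp 1 (Kop h)))"
proof -
  have m: "Kop h \<in> MW" "Sp 1 h \<in> MW" "C2 h \<in> MW" using h n2 by auto
  have "Kop (Sp 1 (Yp h)) \<boxplus> Kop h \<boxplus> Kop (Ct (C2 h)) = Y2 (Kop (Sp 1 h))"
    using arg_cong[OF SY[OF h], of Kop] M3'[OF m(2)] by simp
  moreover have "Kop (Ct (C2 h)) = Lc (C2 (Kop h))" using M2 M3 h m n2 by simp
  ultimately show ?thesis unfolding SKSK[OF h] by (auto simp: fun_eq_iff pl_def mi_def algebra_simps)
qed

text \<open>The companion of \<open>M8\<close>: here x_1 is moved to the right through s_1 by x_1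
  s_1 = s_1 x_2 - 1 + c_1 c_2. The two identities yield x_1 x_2 = x_2 x_1 on the slices from the
  third on.\<close>

lemma M9: assumes h: "h \<in> MW"
  shows "Yp (Sp 1 (Kop (Sp 1 h))) \<boxplus> Kop (Sp 1 (Zop h)) = Sp 1 (Kop (Sp 1 (Yp h)))"
proof -
  let ?k = "Kop (Sp 1 h)"
  have n1: "n \<ge> 1" using n2 by simp
  have m: "?k \<in> MW" "Sp 1 h \<in> MW" "Kop h \<in> MW" "Ct h \<in> MW" "C2 (Sp 1 h) \<in> MW" using h n2 by auto
  have 1: "Yp (Sp 1 ?k) = Sp 1 (Y2 ?k) \<boxplus> mi ?k \<boxplus> Ct (C2 ?k)" by (rule YS[OF m(1)])
  have 2: "Sp 1 (Y2 ?k) \<boxplus> Kop (Sp 1 (Kop h)) = Sp 1 (Kop (Sp 1 (Yp h)))"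
  proof -
    have "Kop (Sp 1 (Kop h)) \<in> MW" using h n2 by auto
    then have "Sp 1 (Sp 1 (Kop (Sp 1 (Kop h)))) = Kop (Sp 1 (Kop h))" by (auto simp: fun_eq_iff Sp_def ss1)
    then show ?thesis unfolding M8[OF h] by simp
  qed
  have "Zop h = Kop h \<boxplus> h \<boxplus> Lc (Ct h)" by (simp add: fun_eq_iff Zop_def)
  then have 3: "Kop (Sp 1 (Zop h)) = Kop (Sp 1 (Kop h)) \<boxplus> ?k \<boxplus> Kop (Sp 1 (Lc (Ct h)))" by simp
  have "Kop (Sp 1 (Lc (Ct h))) = Kop (Lc (Sp 1 (Ct h)))"
    by (rule arg_cong[of _ _ Kop]) (auto simp: fun_eq_iff Lc_def Sp_def)
  also have "\<dots> = mi (Ct (Kop (Sp 1 (Ct h))))" using m n2 by (intro M1) auto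
  also have "Sp 1 (Ct h) = C2 (Sp 1 h)" using h n2 by (auto simp: fun_eq_iff op_defs C2_def c2_def ss1)
  also have "Kop \<dots> = C2 ?k" by (rule M3[OF m(2)])
  finally have 4: "Kop (Sp 1 (Lc (Ct h))) = mi (Ct (C2 ?k))" .
  show ?thesis unfolding 1 3 4 2[symmetric] by (auto simp: fun_eq_iff pl_def mi_def algebra_simps)
qed

end

section \<open>Linear recurrences with characteristic polynomial g\<close>

definition rec_seq :: "(nat \<Rightarrow> 'v) \<Rightarrow> bool" where
  "rec_seq y \<longleftrightarrow> (\<forall>a. (\<Sum>m\<le>degree g. coeff g m \<cdot> y (a + m)) = 0)"

text \<open>The trace of g(x_1) = 0 on coinduced vectors: the value at z c_1^b x_1^a g(x_1) has to
  be zero for all a and b.\<close>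

definition MR :: "(bool \<Rightarrow> nat \<Rightarrow> 'v) set" where "MR = {h \<in> MW. \<forall>b. rec_seq (h b)}"

lemma MR_MW [simp]: "h \<in> MR \<Longrightarrow> h \<in> MW" by (simp add: MR_def)

text \<open>Let S be the shift of sequences. The divided difference D = sum over m of g_m times the
  sum of f^p S^(m-1-p) over p < m satisfies (f - S) D = g(f) - g(S). Both g(f) and g(S) vanish here,
  so f^e D and S^e D agree at \<open>y\<close>.\<close>

lemma shift_swap:
  assumes f: "lin f" and fW: "\<And>v. v \<in> W \<Longrightarrow> f v \<in> W"
    and f0: "\<And>v. v \<in> W \<Longrightarrow> (\<Sum>m\<le>degree g. coeff g m \<cdot> (f ^^ m) v) = 0"
    and y: "rec_seq y" "\<And>a. y a \<in> W"
  shows "(\<Sum>m\<le>degree g. coeff g m \<cdot> (\<Sum>p<m. (f ^^ (p + e)) (y (m - 1 - p)))) =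
         (\<Sum>m\<le>degree g. coeff g m \<cdot> (\<Sum>p<m. (f ^^ p) (y (m - 1 - p + e))))"
proof -
  define S where "S e k = (\<Sum>m\<le>degree g. coeff g m \<cdot> (\<Sum>p<m. (f ^^ (p + e)) (y (m - 1 - p + k))))" for e k
  have fpW: "v \<in> W \<Longrightarrow> (f ^^ p) v \<in> W" for p v by (induction p) (auto simp: fW)
  have step: "S (Suc e) k = S e (Suc k)" for e k
  proof -
    \<comment> \<open>Both sides are the sum over p < m + 1 of f^(p+e) y(m - p + k), with the first
      or the last term split off.\<close>
    have eq: "(\<Sum>p<m. (f ^^ (p + Suc e)) (y (m - 1 - p + k))) + (f ^^ e) (y (m + k)) =
        (\<Sum>p<m. (f ^^ (p + e)) (y (m - 1 - p + Suc k))) + (f ^^ (m + e)) (y k)" for m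
    proof -
      have "(\<Sum>p<Suc m. (f ^^ (p + e)) (y (m - p + k))) =
          (f ^^ e) (y (m + k)) + (\<Sum>p<m. (f ^^ (p + Suc e)) (y (m - 1 - p + k)))"
        unfolding sum.lessThan_Suc_shift by (simp add: algebra_simps)
      moreover have "(\<Sum>p<Suc m. (f ^^ (p + e)) (y (m - p + k))) =
          (\<Sum>p<m. (f ^^ (p + e)) (y (m - 1 - p + Suc k))) + (f ^^ (m + e)) (y k)"
      proof -
        have "y (m - p + k) = y (m - 1 - p + Suc k)" if "p < m" for p
          using that by (intro arg_cong[of _ _ y]) simp
        then show ?thesis by simp
      qed
      ultimately show ?thesis by (simp add: add.commute)
    qed
    have "S (Suc e) k + (\<Sum>m\<le>degree g. coeff g m \<cdot> (f ^^ e) (y (m + k))) =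
        S e (Suc k) + (\<Sum>m\<le>degree g. coeff g m \<cdot> (f ^^ (m + e)) (y k))"
      unfolding S_def sum.distrib[symmetric] scale_add_right[symmetric] eq ..
    moreover have "(\<Sum>m\<le>degree g. coeff g m \<cdot> (f ^^ e) (y (m + k))) = (f ^^ e) (\<Sum>m\<le>degree g. coeff g m \<cdot> (y (k + m)))"
      using f by (simp add: lin_rules[OF lin_funpow] add.commute)
    moreover have "\<dots> = 0" using y(1) f by (simp add: rec_seq_def lin_rules[OF lin_funpow])
    moreover have "(\<Sum>m\<le>degree g. coeff g m \<cdot> (f ^^ (m + e)) (y k)) = 0"
      using f0[of "(f ^^ e) (y k)"] y(2) by (simp add: funpow_add fpW)
    ultimately show ?thesis by simp
  qed
  have "S e 0 = S 0 e" for e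
  proof -
    have "S (e - k) k = S e 0" if "k \<le> e" for k
      using that
    proof (induction k)
      case (Suc k)
      then have "Suc (e - Suc k) = e - k" by simp
      then show ?case using step[of "e - Suc k" k] Suc by simp
    qed simp
    from this[of e] show ?thesis by simp
  qed
  from this[of e] show ?thesis by (simp add: S_def)
qed

text \<open>All exponents of g have the parity of its degree, so (-1)^m is constant on the support
  of g. Hence solutions stay solutions after multiplication by (-1)^a, and g(-x) is g(x) up to
  sign.\<close>

lemma se_coeff: "coeff g m \<cdot> se (a + m) v = coeff g m \<cdot> se (a + degree g) v"
  using g_par[of m] by (cases "coeff g m = 0") (auto simp: se_def)

lemma rec_seq_lin: "lin f \<Longrightarrow> rec_seq y \<Longrightarrow> rec_seq (\<lambda>a. f (y a))"
proof -
  assume f: "lin f" and y: "rec_seq y"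
  have "(\<Sum>m\<le>degree g. coeff g m \<cdot> f (y (a + m))) = f (\<Sum>m\<le>degree g. coeff g m \<cdot> y (a + m))" for a
    using f by (simp add: lin_sum lin_scale)
  with y show ?thesis by (simp add: rec_seq_def lin_zero[OF f])
qed

lemma rec_seq_se: assumes "rec_seq y" shows "rec_seq (\<lambda>a. se a (y a))"
  unfolding rec_seq_def
proof
  fix a
  have "(\<Sum>m\<le>degree g. coeff g m \<cdot> se (a + m) (y (a + m))) = se (a + degree g) (\<Sum>m\<le>degree g. coeff g m \<cdot> y (a + m))"
    unfolding se_coeff by (auto simp: se_def sum_negf)
  then show "(\<Sum>m\<le>degree g. coeff g m \<cdot> se (a + m) (y (a + m))) = 0"
    using assms by (simp add: rec_seq_def)
qed

lemma rec_seq_add: "rec_seq y \<Longrightarrow> rec_seq z \<Longrightarrow> rec_seq (\<lambda>a. y a + z a)"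
  by (simp add: rec_seq_def scale_add_right sum.distrib)

lemma rec_seq_minus: "rec_seq y \<Longrightarrow> rec_seq (\<lambda>a. - y a)"
  by (simp add: rec_seq_def sum_negf)

lemma rec_seq_x: "n \<ge> 1 \<Longrightarrow> v \<in> W \<Longrightarrow> rec_seq (\<lambda>a. (x ^^ a) v)"
  unfolding rec_seq_def
proof
  fix a assume "n \<ge> 1" "v \<in> W"
  then show "(\<Sum>m\<le>degree g. coeff g m \<cdot> (x ^^ (a + m)) v) = 0"
    using gx[of "(x ^^ a) v"] by (simp add: funpow_add funpow_swap1 add.commute[of a])
qed

lemma MR_cl [simp]:
  assumes h: "h \<in> MR"
  shows "n \<ge> 1 \<Longrightarrow> Kop h \<in> MR" "Lc h \<in> MR" "Lx h \<in> MR" "n \<ge> 1 \<Longrightarrow> Ct h \<in> MR" "n \<ge> 1 \<Longrightarrow> Yp h \<in> MR"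
    "1 \<le> i \<Longrightarrow> i < n \<Longrightarrow> Sp i h \<in> MR" "k \<in> MR \<Longrightarrow> pl h k \<in> MR"
proof -
  have m: "h \<in> MW" and r: "rec_seq (h b)" for b using h by (auto simp: MR_def simp del: MR_MW)
  have W: "h b a \<in> W" for b a using m by simp
  have rec: "rec_seq (\<lambda>a. h b a)" for b using r[of b] by simp
  note R = rec_seq_lin[OF lin_c] rec_seq_lin[OF lin_x] rec_seq_lin[OF lin_s] rec_seq_add rec_seq_minus rec_seq_se rec
  show "n \<ge> 1 \<Longrightarrow> Kop h \<in> MR"
  proof -
    assume n: "n \<ge> 1"
    have "rec_seq (\<lambda>a. c ((x ^^ a) (h False 0)) + - h True a + - se a (c (h False a)) + (x ^^ a) (h True 0))"
      by (intro R rec_seq_x n W)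
    moreover have "rec_seq (\<lambda>a. (x ^^ a) (h False 0) + - h False a + se a (c (h True a)) + - c ((x ^^ a) (h True 0)))"
      by (intro R rec_seq_x n W)
    ultimately have "rec_seq (Kop h b)" for b
      by (cases b) (simp_all add: Kop_def[abs_def] fun_eq_iff)
    then show ?thesis using m n by (simp add: MR_def del: MR_MW)
  qed
  have "rec_seq (Lc h b)" for b unfolding Lc_def[abs_def] by (intro R)
  then show "Lc h \<in> MR" using m by (simp add: MR_def del: MR_MW)
  have "rec_seq (Lx h b)" for b unfolding Lx_def[abs_def]
    using r[of b] unfolding rec_seq_def add_Suc[symmetric] by blast
  then show "Lx h \<in> MR" using m by (simp add: MR_def del: MR_MW)
  have "rec_seq (Ct h b)" for b unfolding Ct_def[abs_def] by (cases b) (auto intro!: R)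
  then show "n \<ge> 1 \<Longrightarrow> Ct h \<in> MR" using m by (simp add: MR_def del: MR_MW)
  have "rec_seq (Yp h b)" for b unfolding Yp_def[abs_def] by (intro R)
  then show "n \<ge> 1 \<Longrightarrow> Yp h \<in> MR" using m by (simp add: MR_def del: MR_MW)
  have "rec_seq (Sp i h b)" for b unfolding Sp_def[abs_def] by (intro R)
  then show "1 \<le> i \<Longrightarrow> i < n \<Longrightarrow> Sp i h \<in> MR" using m by (simp add: MR_def del: MR_MW)
  show "k \<in> MR \<Longrightarrow> pl h k \<in> MR"
  proof -
    assume k: "k \<in> MR"
    then have "rec_seq (\<lambda>a. h b a + k b a)" for b using r by (auto simp: MR_def simp del: MR_MW intro!: rec_seq_add)
    then have "rec_seq (pl h k b)" for b by (simp add: pl_def[abs_def])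
    then show ?thesis using m k by (simp add: MR_def del: MR_MW)
  qed
qed

text \<open>This sum is the total correction that g(x_1) produces on a slice j >= 2. By the shape of
  \<open>Kop\<close> it splits into a part in powers of x and a part in powers of -x with c in
  front; each is a difference of the two sides of \<open>shift_swap\<close> and therefore
  zero.\<close>

lemma Theta:
  assumes n: "n \<ge> 1" and h: "h \<in> MR"
  shows "(\<Sum>m\<le>degree g. coeff g m \<cdot> (\<Sum>p<m. (x ^^ p) (Kop (\<lambda>b a. h b (a + (m - 1 - p))) b a))) = 0"
proof -
  \<comment> \<open>The operator -x appears when c is pulled to the front of a power of x; it is
    also annihilated by g because g has only exponents of one parity.\<close>
  define f where "f v = - x v" for v
  have lf: "lin f" by (auto simp: lin_def f_def)
  have fp: "(f ^^ p) v = se p ((x ^^ p) v)" for p v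
    by (induction p) (auto simp: f_def)
  have m: "h \<in> MW" and r: "rec_seq (h b)" for b using h by (auto simp: MR_def simp del: MR_MW)
  have W: "h b a \<in> W" for b a using m by simp
  have f0: "(\<Sum>m\<le>degree g. coeff g m \<cdot> (f ^^ m) v) = 0" if "v \<in> W" for v
  proof -
    have "(\<Sum>m\<le>degree g. coeff g m \<cdot> (f ^^ m) v) = (\<Sum>m\<le>degree g. coeff g m \<cdot> se (0 + m) ((x ^^ m) v))"
      by (simp add: fp)
    also have "\<dots> = se (0 + degree g) (\<Sum>m\<le>degree g. coeff g m \<cdot> ((x ^^ m) v))"
      unfolding se_coeff by (auto simp: se_def sum_negf)
    finally show ?thesis using gx[OF n that] by simp
  qed
  have A: "(\<Sum>m\<le>degree g. coeff g m \<cdot> (\<Sum>p<m. (x ^^ (p + a)) (h b (m - 1 - p)))) =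
         (\<Sum>m\<le>degree g. coeff g m \<cdot> (\<Sum>p<m. (x ^^ p) (h b (m - 1 - p + a))))" for b
    by (rule shift_swap[OF lin_x _ gx]) (insert n, auto simp: W r)
  have B: "(\<Sum>m\<le>degree g. coeff g m \<cdot> (\<Sum>p<m. (f ^^ (p + a)) (h b (m - 1 - p)))) =
         (\<Sum>m\<le>degree g. coeff g m \<cdot> (\<Sum>p<m. (f ^^ p) (h b (m - 1 - p + a))))" for b
    by (rule shift_swap[OF lf _ f0]) (insert n, auto simp: W r f_def)
  define SA where "SA b = (\<lambda>m. \<Sum>p<m. (x ^^ (p + a)) (h b (m - 1 - p)) - (x ^^ p) (h b (m - 1 - p + a)))" for b
  define SB where "SB b = (\<lambda>m. \<Sum>p<m. (f ^^ (p + a)) (h b (m - 1 - p)) - (f ^^ p) (h b (m - 1 - p + a)))" for b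
  have A0: "(\<Sum>m\<le>degree g. coeff g m \<cdot> SA b m) = 0" for b
    using A[of b] by (simp add: SA_def sum_subtractf scale_diff_right)
  have B0: "(\<Sum>m\<le>degree g. coeff g m \<cdot> SB b m) = 0" for b
    using B[of b] by (simp add: SB_def sum_subtractf scale_diff_right)
  have K: "(\<Sum>p<m. (x ^^ p) (Kop (\<lambda>b a. h b (a + (m - 1 - p))) b a)) =
      SA b m + (if b then c (se a (SB False m)) else - c (se a (SB True m)))" for m
  proof -
    have sea: "se a (\<Sum>p<m. F p) = (\<Sum>p<m. se a (F p))" for F by (auto simp: se_def sum_negf)
    have pp: "(x ^^ p) ((x ^^ q) v) = (x ^^ (p + q)) v" for p q v by (simp add: funpow_add)
    have pt: "(x ^^ p) (Kop (\<lambda>b a. h b (a + q)) b a) =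
        ((x ^^ (p + a)) (h b q) - (x ^^ p) (h b (q + a))) +
        (if b then c (se a ((f ^^ (p + a)) (h False q) - (f ^^ p) (h False (q + a))))
         else - c (se a ((f ^^ (p + a)) (h True q) - (f ^^ p) (h True (q + a)))))" for p q
      unfolding Kop_def fp using n
      by (cases b) (simp_all add: xpc W pp add.commute[of q], auto simp: se_def)
    show ?thesis
      unfolding SA_def SB_def sea c_lin pt
      by (cases b) (simp_all only: sum.distrib[symmetric] sum_negf[symmetric] if_True if_False)
  qed
  have C: "(\<Sum>m\<le>degree g. coeff g m \<cdot> c (se a (SB b m))) = c (se a (\<Sum>m\<le>degree g. coeff g m \<cdot> SB b m))" for b
    by (auto simp: se_def sum_negf)
  show ?thesis unfolding K using A0[of b] B0 C
    by (cases b) (simp_all add: scale_add_right scale_diff_right sum.distrib sum_subtractf)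
qed

end

section \<open>The coinduced module of rank n + 1\<close>

text \<open>The linear bijection between 'v and families of elements of 'v allows the coinduced
  module to live in the same type as \<open>W\<close>. Without it the type would grow with n and the
  induction on n could not be formulated.\<close>

locale sergeev_step = small_sergeev scale g n W x c s
  for scale :: "'r::comm_ring_1 \<Rightarrow> 'v::ab_group_add \<Rightarrow> 'v" (infixr \<open>\<cdot>\<close> 75) and g n W x c s +
  fixes slice :: "'v \<Rightarrow> nat \<Rightarrow> bool \<Rightarrow> nat \<Rightarrow> 'v" and build :: "(nat \<Rightarrow> bool \<Rightarrow> nat \<Rightarrow> 'v) \<Rightarrow> 'v"
  assumes slice_build [simp]: "slice (build F) = F" and build_slice: "build (slice f) = f"
    and slice_add [simp]: "slice (f + h) j b a = slice f j b a + slice h j b a"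
    and slice_scale [simp]: "slice (r \<cdot> f) j b a = r \<cdot> slice f j b a"
begin

lemma slice_eqI: "(\<And>j. slice f j = slice h j) \<Longrightarrow> f = h"
  by (metis build_slice ext)

lemma slice_zero [simp]: "slice 0 j b a = 0"
  using slice_add[of 0 0 j b a] by simp

lemma slice_minus [simp]: "slice (- f) j b a = - slice f j b a"
  using slice_add[of "- f" f j b a] by (simp add: eq_neg_iff_add_eq_0)

lemma slice_sum [simp]: "slice (\<Sum>i\<in>I. F i) j b a = (\<Sum>i\<in>I. slice (F i) j b a)"
  by (induction I rule: infinite_finite_induct) auto

text \<open>The product s_lo s_(lo+1) ... s_(lo+k-1) applied to the values.\<close>

primrec qq :: "nat \<Rightarrow> nat \<Rightarrow> (bool \<Rightarrow> nat \<Rightarrow> 'v) \<Rightarrow> bool \<Rightarrow> nat \<Rightarrow> 'v" where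
  "qq lo 0 h = h"
| "qq lo (Suc k) h = Sp lo (qq (Suc lo) k h)"

lemma qq_tail: "qq lo (Suc k) h = qq lo k (Sp (lo + k) h)"
  by (induction k arbitrary: lo) auto

lemma qq_MR [simp]: "1 \<le> lo \<Longrightarrow> lo + k \<le> n \<Longrightarrow> h \<in> MR \<Longrightarrow> qq lo k h \<in> MR"
  by (induction k arbitrary: lo) auto

lemma qq_MW [simp]: "1 \<le> lo \<Longrightarrow> lo + k \<le> n \<Longrightarrow> h \<in> MW \<Longrightarrow> qq lo k h \<in> MW"
  by (induction k arbitrary: lo) auto

lemma qq_simps [simp]:
  "qq lo k (Lx h) = Lx (qq lo k h)" "qq lo k (Lc h) = Lc (qq lo k h)"
  "qq lo k (pl h h') = pl (qq lo k h) (qq lo k h')" "qq lo k (mi h) = mi (qq lo k h)"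
  by (induction k arbitrary: lo) (auto simp: Lx_def Lc_def Sp_def mi_def fun_eq_iff)

lemma qq_comm:
  assumes "2 \<le> lo" "lo + k \<le> n" "h \<in> MW"
  shows "qq lo k (Kop h) = Kop (qq lo k h)" "qq lo k (Yp h) = Yp (qq lo k h)" "qq lo k (Ct h) = Ct (qq lo k h)"
    "qq lo k (Zop h) = Zop (qq lo k h)"
proof -
  have YS: "Yp (Sp i k) = Sp i (Yp k)" "Ct (Sp i k) = Sp i (Ct k)" if "2 \<le> i" "i < n" "k \<in> MW" for i k
    using that by (auto simp: fun_eq_iff Yp_def Ct_def Sp_def sx sc)
  have "qq lo k (Kop h) = Kop (qq lo k h) \<and> qq lo k (Yp h) = Yp (qq lo k h) \<and> qq lo k (Ct h) = Ct (qq lo k h)"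
    if "2 \<le> lo" "lo + k \<le> n" for lo
    using that
  proof (induction k arbitrary: lo)
    case (Suc k)
    have q: "qq (Suc lo) k h \<in> MW" using Suc.prems assms(3) by (intro qq_MW) auto
    from Suc show ?case by (simp add: YS q M10)
  qed auto
  note A = this[OF assms(1,2)]
  then show "qq lo k (Kop h) = Kop (qq lo k h)" "qq lo k (Yp h) = Yp (qq lo k h)" "qq lo k (Ct h) = Ct (qq lo k h)" by auto
  have "Zop k = Kop k \<boxplus> k \<boxplus> Lc (Ct k)" for k by (simp add: fun_eq_iff Zop_def)
  then show "qq lo k (Zop h) = Zop (qq lo k h)" using A by simp
qed

lemma Sp_far: "1 \<le> i \<Longrightarrow> i + 1 < j \<Longrightarrow> j < n \<Longrightarrow> h \<in> MW \<Longrightarrow> Sp j (Sp i h) = Sp i (Sp j h)"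
  by (auto simp: fun_eq_iff Sp_def far)

lemma Sp_ss: "1 \<le> i \<Longrightarrow> i < n \<Longrightarrow> h \<in> MW \<Longrightarrow> Sp i (Sp i h) = h"
  by (auto simp: fun_eq_iff Sp_def ss)

lemma Sp_braid: "1 \<le> i \<Longrightarrow> i + 1 < n \<Longrightarrow> h \<in> MW \<Longrightarrow> Sp (Suc i) (Sp i (Sp (Suc i) h)) = Sp i (Sp (Suc i) (Sp i h))"
  by (auto simp: fun_eq_iff Sp_def braid)

lemma qq_far: "1 \<le> lo \<Longrightarrow> lo + k < i \<Longrightarrow> i < n \<Longrightarrow> h \<in> MW \<Longrightarrow> qq lo k (Sp i h) = Sp i (qq lo k h)"
proof (induction k arbitrary: lo)
  case (Suc k)
  have "qq (Suc lo) k h \<in> MW" using Suc.prems by (intro qq_MW) auto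
  then show ?case using Suc Sp_far[of lo i] by simp
qed auto

lemma qq_far': "1 \<le> i \<Longrightarrow> i + 1 < lo \<Longrightarrow> lo + k \<le> n \<Longrightarrow> h \<in> MW \<Longrightarrow> qq lo k (Sp i h) = Sp i (qq lo k h)"
proof (induction k arbitrary: lo)
  case (Suc k)
  have "qq (Suc lo) k h \<in> MW" using Suc.prems by (intro qq_MW) auto
  then show ?case using Suc Sp_far[of i lo] by simp
qed auto

text \<open>The usual conjugation s_i (s_lo ... s_m) = (s_lo ... s_m) s_(i-1) for lo < i <= m,
  reduced by far commutations to a single braid relation.\<close>

lemma qq_braid:
  assumes "1 \<le> lo" "lo + k \<le> n" "lo < i" "i < lo + k" "h \<in> MW"
  shows "qq lo k (Sp (i - 1) h) = Sp i (qq lo k h)"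
  using assms
proof (induction k arbitrary: lo)
  case (Suc k)
  show ?case
  proof (cases "i = Suc lo")
    case True
    then obtain k' where k: "k = Suc k'" using Suc.prems by (cases k) auto
    have m: "qq (Suc (Suc lo)) k' h \<in> MW" using Suc.prems k by (intro qq_MW) auto
    have "qq lo (Suc k) (Sp (i - 1) h) = Sp lo (Sp (Suc lo) (Sp lo (qq (Suc (Suc lo)) k' h)))"
      using True k Suc.prems by (simp add: qq_far')
    also have "\<dots> = Sp (Suc lo) (Sp lo (Sp (Suc lo) (qq (Suc (Suc lo)) k' h)))"
      using Sp_braid[of lo, OF _ _ m] Suc.prems k by simp
    finally show ?thesis using True k by simp
  next
    case False
    have m: "qq (Suc lo) k h \<in> MW" using Suc.prems by (intro qq_MW) auto
    have "qq lo (Suc k) (Sp (i - 1) h) = Sp lo (Sp i (qq (Suc lo) k h))"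
      using Suc False by simp
    also have "\<dots> = Sp i (Sp lo (qq (Suc lo) k h))"
      using Sp_far[of lo i, OF _ _ _ m] Suc.prems False by simp
    finally show ?thesis by simp
  qed
qed auto

definition zz :: "bool \<Rightarrow> nat \<Rightarrow> 'v" where "zz b a = 0"

lemma zz_simps [simp]: "Lx zz = zz" "Lc zz = zz" "Ct zz = zz" "Yp zz = zz" "Sp i zz = zz" "Kop zz = zz" "pl zz h = h" "pl h zz = h"
  "mi zz = zz" "zz \<in> MR"
  by (auto simp: zz_def fun_eq_iff op_defs MR_def MW_def rec_seq_def simp del: MW_D)

text \<open>Slice j of f lists the values at z c_1^b x_1^a s_1 ... s_(j-1), z = s_n ... s_1, and a
  generator acts by multiplying the argument on the right; \<open>X'\<close>, \<open>C'\<close>,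
  \<open>S'\<close> are the results rewritten in these coordinates. On slice 1, x_1 and c_1 meet
  their own kind directly. On slice j >= 2, x_1 passes to the left as described at
  \<open>Kop\<close>; the tail s_2 ... s_(j-1) left in the correction becomes s_1 ... s_(j-2) once
  it is moved left through z. The vectors in \<open>W'\<close> satisfy the recurrence in every row,
  and have zero slices outside 1, ..., n + 1.\<close>

definition X' :: "'v \<Rightarrow> 'v" where
  "X' f = build (\<lambda>j. if j = 1 then Lx (slice f 1)
     else if 2 \<le> j \<and> j \<le> Suc n then pl (Yp (slice f j)) (Kop (qq 1 (j - 2) (slice f 1))) else zz)"
definition C' :: "'v \<Rightarrow> 'v" where
  "C' f = build (\<lambda>j. if j = 1 then Lc (slice f 1) else Ct (slice f j))"
definition S' :: "nat \<Rightarrow> 'v \<Rightarrow> 'v" where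
  "S' i f = build (\<lambda>j. if j = i then slice f (Suc i) else if j = Suc i then slice f i
     else if j < i then Sp (i - 1) (slice f j) else Sp i (slice f j))"
definition W' :: "'v set" where
  "W' = {f. \<forall>j. slice f j \<in> MR \<and> (j = 0 \<or> Suc n < j \<longrightarrow> slice f j = zz)}"

lemma slice_X': "slice (X' f) j = (if j = 1 then Lx (slice f 1)
     else if 2 \<le> j \<and> j \<le> Suc n then pl (Yp (slice f j)) (Kop (qq 1 (j - 2) (slice f 1))) else zz)"
  and slice_C': "slice (C' f) j = (if j = 1 then Lc (slice f 1) else Ct (slice f j))"
  and slice_S': "slice (S' i f) j = (if j = i then slice f (Suc i) else if j = Suc i then slice f i
     else if j < i then Sp (i - 1) (slice f j) else Sp i (slice f j))"
  by (simp_all add: X'_def C'_def S'_def)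

lemma slice_pl: "slice (f + h) j = pl (slice f j) (slice h j)" and slice_mi: "slice (- f) j = mi (slice f j)"
  by (auto simp: fun_eq_iff mi_def)

lemma op_scale:
  "qq lo k (\<lambda>b a. r \<cdot> h b a) = (\<lambda>b a. r \<cdot> qq lo k h b a)" "Kop (\<lambda>b a. r \<cdot> h b a) = (\<lambda>b a. r \<cdot> Kop h b a)"
  by (induction k arbitrary: lo) (auto simp: fun_eq_iff op_defs scale_add_right scale_diff_right)

lemma slice_sc: "slice (r \<cdot> f) j = (\<lambda>b a. r \<cdot> slice f j b a)"
  by (auto simp: fun_eq_iff)

lemma lin_X': "lin X'" and lin_C': "lin C'" and lin_S': "lin (S' i)"
proof -
  have p: "slice (u + v) = (\<lambda>j. pl (slice u j) (slice v j))" for u v by (rule ext) (rule slice_pl)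
  have z: "pl zz zz = zz" "(\<lambda>b a. r \<cdot> zz b a) = zz" for r by (auto simp: fun_eq_iff zz_def)
  show "lin X'" "lin C'" "lin (S' i)"
    unfolding lin_def
    by (intro conjI allI; rule slice_eqI; unfold slice_pl slice_X' slice_C' slice_S' slice_sc;
        auto simp: op_scale fun_eq_iff pl_def Yp_def Lx_def Lc_def Ct_def Sp_def zz_def scale_add_right algebra_simps)+
qed

lemma W'D: "f \<in> W' \<Longrightarrow> slice f j \<in> MR" "f \<in> W' \<Longrightarrow> j = 0 \<or> Suc n < j \<Longrightarrow> slice f j = zz"
  by (auto simp: W'_def)

lemma subsp_W': "subsp W'"
proof -
  have sc: "(\<lambda>b a. r \<cdot> h b a) \<in> MR" if "h \<in> MR" for r h
  proof -
    have l: "lin (\<lambda>v. r \<cdot> v)" by (auto simp: lin_def scale_add_right scale_scale mult.commute)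
    show ?thesis using that rec_seq_lin[OF l] by (simp add: MR_def MW_def del: MW_D MR_MW)
  qed
  have "slice 0 j = zz" for j by (auto simp: fun_eq_iff zz_def)
  moreover have "(\<lambda>b a. r \<cdot> zz b a) = zz" for r by (auto simp: fun_eq_iff zz_def)
  ultimately show ?thesis
    by (auto simp: subsp_def W'_def slice_pl slice_sc sc)
qed

lemma W'_X: assumes f: "f \<in> W'" shows "X' f \<in> W'"
  using W'D[OF f] by (auto simp: W'_def slice_X')

lemma W'_C: assumes f: "f \<in> W'" shows "C' f \<in> W'"
proof -
  have "slice (C' f) j \<in> MR" for j
    using W'D(1)[OF f] W'D(2)[OF f, of j] by (cases "j = 1"; cases "n = 0"; cases "j = 0") (auto simp: slice_C')
  then show ?thesis using W'D(2)[OF f] by (auto simp: W'_def slice_C')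
qed

lemma W'_S: assumes f: "f \<in> W'" and i: "1 \<le> i" "i < Suc n" shows "S' i f \<in> W'"
proof -
  have "slice (S' i f) j \<in> MR" for j
  proof -
    consider "j = i" | "j = Suc i" | "j = 0" | "0 < j" "j < i" | "Suc i < j" "j \<le> Suc n" | "Suc n < j" by linarith
    then show ?thesis using W'D(1)[OF f] W'D(2)[OF f, of j] i by cases (auto simp: slice_S')
  qed
  then show ?thesis using W'D(2)[OF f] i by (auto simp: W'_def slice_S')
qed

lemma S'S': assumes f: "f \<in> W'" and i: "1 \<le> i" "i < Suc n" shows "S' i (S' i f) = f"
proof (rule slice_eqI)
  fix j
  have m: "slice f j \<in> MW" using W'D(1)[OF f] by simp
  consider "j = i" | "j = Suc i" | "j = 0" | "0 < j" "j < i" | "Suc i < j" "j \<le> Suc n" | "Suc n < j" by linarith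
  then show "slice (S' i (S' i f)) j = slice f j"
    using W'D(2)[OF f, of j] i m by cases (auto simp: slice_S' Sp_ss)
qed

lemma S'_far: assumes f: "f \<in> W'" and i: "1 \<le> i" "i + 1 < k" "k < Suc n" shows "S' k (S' i f) = S' i (S' k f)"
proof (rule slice_eqI)
  fix j
  have m: "slice f j \<in> MW" for j using W'D(1)[OF f] by simp
  consider "j = 0 \<or> Suc n < j" | "0 < j" "j < i" | "j = i" | "j = Suc i" | "Suc i < j" "j < k" | "j = k" | "j = Suc k" | "Suc k < j" "j \<le> Suc n" by linarith
  then show "slice (S' k (S' i f)) j = slice (S' i (S' k f)) j"
    using W'D(2)[OF f, of j] i m[of j] Sp_far[of "i - 1" "k - 1"] Sp_far[of i k] Sp_far[of i "k - 1"]
    by cases (auto simp: slice_S')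
qed

lemma S'_braid: assumes f: "f \<in> W'" and i: "1 \<le> i" "i + 1 < Suc n"
  shows "S' (Suc i) (S' i (S' (Suc i) f)) = S' i (S' (Suc i) (S' i f))"
proof (rule slice_eqI)
  fix j
  have m: "slice f j \<in> MW" for j using W'D(1)[OF f] by simp
  consider "j = 0 \<or> Suc n < j" | "0 < j" "j < i" | "j = i" | "j = Suc i" | "j = Suc (Suc i)" | "Suc (Suc i) < j" "j \<le> Suc n" by linarith
  then show "slice (S' (Suc i) (S' i (S' (Suc i) f))) j = slice (S' i (S' (Suc i) (S' i f))) j"
    using W'D(2)[OF f, of j] i m[of j] Sp_braid[of "i - 1"] Sp_braid[of i]
    by cases (auto simp: slice_S')
qed

lemma C'C': assumes f: "f \<in> W'" shows "C' (C' f) = f"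
proof (rule slice_eqI)
  fix j
  have m: "slice f j \<in> MW" for j using W'D(1)[OF f] by simp
  consider "j = 1" | "j = 0 \<or> Suc n < j" | "2 \<le> j" "j \<le> Suc n" by linarith
  then show "slice (C' (C' f)) j = slice f j"
    using W'D(2)[OF f, of j] m[of j] by cases (auto simp: slice_C' fun_eq_iff Lc_def Ct_def cc zz_def)
qed

text \<open>On slices j >= 2 the sign comes from x_1 c_1 = - c_1 x_1 on the values for the main term
  and from \<open>M1\<close> for the correction; on slice 1 it comes from the factor (-1)^a, since
  x_1 raises a by one.\<close>

lemma X'C': assumes f: "f \<in> W'" shows "X' (C' f) = - C' (X' f)"
proof (rule slice_eqI)
  fix j
  have m: "slice f j \<in> MW" for j using W'D(1)[OF f] by simp
  consider "j = 1" | "j = 0 \<or> Suc n < j" | "2 \<le> j" "j \<le> Suc n" by linarith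
  then show "slice (X' (C' f)) j = slice (- C' (X' f)) j"
  proof cases
    case 1 then show ?thesis by (auto simp: slice_C' slice_X' slice_mi fun_eq_iff Lx_def Lc_def mi_def)
  next
    case 2 then show ?thesis by (auto simp: slice_C' slice_X' slice_mi)
  next
    case 3
    have q: "qq 1 (j - 2) (slice f 1) \<in> MW" using m 3 by (intro qq_MW) auto
    have "Yp (Ct h) = mi (Ct (Yp h))" if "h \<in> MW" for h
      using that 3 by (auto simp: fun_eq_iff Yp_def Ct_def mi_def xc)
    then show ?thesis using 3 m q M1[OF _ q] by (simp add: slice_C' slice_X' slice_mi fun_eq_iff mi_def)
  qed
qed

lemma S'C'_comm: assumes f: "f \<in> W'" and i: "2 \<le> i" "i < Suc n" shows "S' i (C' f) = C' (S' i f)"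
proof (rule slice_eqI)
  fix j
  have m: "slice f j \<in> MW" for j using W'D(1)[OF f] by simp
  have SC: "Sp i (Ct h) = Ct (Sp i h)" if "h \<in> MW" "2 \<le> i" "i < n" for i h
    using that by (auto simp: fun_eq_iff Ct_def Sp_def sc)
  have SL: "Sp i (Lc h) = Lc (Sp i h)" for i h by (auto simp: fun_eq_iff Sp_def Lc_def)
  consider "j = 0 \<or> Suc n < j" | "j = 1" | "2 \<le> j" "j < i" | "j = i" | "j = Suc i" | "Suc i < j" "j \<le> Suc n" by linarith
  then show "slice (S' i (C' f)) j = slice (C' (S' i f)) j"
    using W'D(2)[OF f, of j] i m[of j] SC[of "slice f j" "i - 1"] SC[of "slice f j" i]
    by cases (auto simp: slice_S' slice_C' SL)
qed

text \<open>The prefix s_1 ... s_(j-2) of the correction has to match on both sides. For j < i the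
  letter s_(i-1) lies beyond the prefix and commutes with it; for j = i and j = i + 1 the prefixes
  differ by s_(i-1), which is appended or cancelled; for j > i + 1 the letter is inside, and
  \<open>qq_braid\<close> turns s_(i-1) into s_i.\<close>

lemma S'X'_comm: assumes f: "f \<in> W'" and i: "2 \<le> i" "i < Suc n" shows "S' i (X' f) = X' (S' i f)"
proof (rule slice_eqI)
  fix j
  have m: "slice f j \<in> MW" for j using W'D(1)[OF f] by simp
  have n1: "n \<ge> 1" using i by simp
  have i1: "Suc (i - 2) = i - 1" "1 + (i - 2) = i - 1" using i by auto
  have SY: "Sp i (Yp h) = Yp (Sp i h)" if "h \<in> MW" "2 \<le> i" "i < n" for i h
    using that by (auto simp: fun_eq_iff Yp_def Sp_def sx)
  have SL: "Sp i (Lx h) = Lx (Sp i h)" for i h by (auto simp: fun_eq_iff Sp_def Lx_def)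
  let ?f = "slice f 1"
  have f1: "slice (S' i f) (Suc 0) = Sp (i - 1) ?f" using i by (simp add: slice_S')
  have q: "qq 1 k ?f \<in> MW" if "k < n" for k using m that by (intro qq_MW) auto
  consider "j = 0 \<or> Suc n < j" | "j = 1" | "2 \<le> j" "j < i" | "j = i" | "j = Suc i" | "Suc i < j" "j \<le> Suc n" by linarith
  then show "slice (S' i (X' f)) j = slice (X' (S' i f)) j"
  proof cases
    case 1 then show ?thesis using W'D(2)[OF f, of j] i by (auto simp: slice_S' slice_X')
  next
    case 2 then show ?thesis using i by (auto simp: slice_S' slice_X' SL)
  next
    case 3
    have "qq 1 (j - 2) (Sp (i - 1) ?f) = Sp (i - 1) (qq 1 (j - 2) ?f)" using 3 i m by (intro qq_far) auto
    moreover have "Kop (Sp (i - 1) (qq 1 (j - 2) ?f)) = Sp (i - 1) (Kop (qq 1 (j - 2) ?f))"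
      using 3 i q by (intro M10 n1) auto
    ultimately show ?thesis using 3 i m SY[of _ "i - 1"] f1 by (simp add: slice_S' slice_X')
  next
    case 4
    have "qq 1 (i - 1) ?f = qq 1 (i - 2) (Sp (i - 1) ?f)"
      using qq_tail[of 1 "i - 2" ?f] i1 by simp
    then show ?thesis using 4 i f1 by (simp add: slice_S' slice_X')
  next
    case 5
    have "qq 1 (i - 1) (Sp (i - 1) ?f) = qq 1 (i - 2) (Sp (i - 1) (Sp (i - 1) ?f))"
      using qq_tail[of 1 "i - 2" "Sp (i - 1) ?f"] i1 by simp
    then show ?thesis using 5 i f1 m Sp_ss[of "i - 1" ?f] by (simp add: slice_S' slice_X')
  next
    case 6
    have "qq 1 (j - 2) (Sp (i - 1) ?f) = Sp i (qq 1 (j - 2) ?f)" using 6 i m by (intro qq_braid) auto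
    moreover have "Kop (Sp i (qq 1 (j - 2) ?f)) = Sp i (Kop (qq 1 (j - 2) ?f))"
      using 6 i q by (intro M10 n1) auto
    ultimately show ?thesis using 6 i m SY[of _ i] f1 by (simp add: slice_S' slice_X')
  qed
qed

text \<open>Compared with c_1, the operator c_2 exchanges the roles of the slices 1 and 2.\<close>

lemma C2'_slices:
  assumes f: "f \<in> W'" and n: "1 \<le> n"
  shows "slice (S' (Suc 0) (C' (S' (Suc 0) f))) j = (if j = 1 then Ct (slice f 1) else if j = 2 then Lc (slice f 2)
    else if j = 0 then zz else Sp 1 (Ct (Sp 1 (slice f j))))"
  using W'D(2)[OF f, of 0] by (auto simp: slice_S' slice_C' numeral_2_eq_2)

lemma C'C2': assumes f: "f \<in> W'" and n: "1 \<le> n" shows "C' (S' 1 (C' (S' 1 f))) = - S' 1 (C' (S' 1 (C' f)))"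
proof (rule slice_eqI)
  fix j
  have m: "slice f j \<in> MW" for j using W'D(1)[OF f] by simp
  have Cf: "C' f \<in> W'" by (rule W'_C[OF f])
  consider "j = 0 \<or> Suc n < j" | "j = 1" | "j = 2" | "3 \<le> j" "j \<le> Suc n" by linarith
  then show "slice (C' (S' 1 (C' (S' 1 f)))) j = slice (- S' 1 (C' (S' 1 (C' f)))) j"
  proof cases
    case 4
    then have "n \<ge> 2" by simp
    have "Ct (C2 (slice f j)) = mi (C2 (Ct (slice f j)))"
      using \<open>n \<ge> 2\<close> m by (auto simp: fun_eq_iff Ct_def C2_def mi_def c2c)
    then show ?thesis using 4 by (simp add: slice_C'[of "S' (Suc 0) (C' (S' (Suc 0) f))"] slice_mi C2'_slices[OF f n] C2'_slices[OF Cf n] slice_C'[of f] C2_eq[OF \<open>n \<ge> 2\<close>])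
  qed (use m cc W'D(2)[OF f, of j] n in \<open>auto simp: slice_C' slice_mi C2'_slices[OF f n] C2'_slices[OF Cf n] fun_eq_iff Ct_def Lc_def mi_def zz_def Sp_def\<close>)
qed

text \<open>The main terms commute because x_1 and c_2 do. The correction is settled by
  \<open>M2\<close> on slice 2 and, from slice 3 on, by \<open>M3\<close> after the first letter s_1
  of the prefix is peeled off.\<close>

lemma X'C2': assumes f: "f \<in> W'" and n: "1 \<le> n" shows "X' (S' 1 (C' (S' 1 f))) = S' 1 (C' (S' 1 (X' f)))"
proof (rule slice_eqI)
  fix j
  have m: "slice f j \<in> MW" for j using W'D(1)[OF f] by simp
  have Xf: "X' f \<in> W'" by (rule W'_X[OF f])
  consider "j = 0 \<or> Suc n < j" | "j = 1" | "j = 2" | "3 \<le> j" "j \<le> Suc n" by linarith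
  then show "slice (X' (S' 1 (C' (S' 1 f)))) j = slice (S' 1 (C' (S' 1 (X' f)))) j"
  proof cases
    case 1 then show ?thesis using W'D(2)[OF f, of j]
      by (auto simp: slice_X' C2'_slices[OF f n] C2'_slices[OF Xf n])
  next
    case 2 then show ?thesis
      by (auto simp: slice_X' C2'_slices[OF f n] C2'_slices[OF Xf n] fun_eq_iff Lx_def Ct_def)
  next
    case 3 then show ?thesis using n m M2[OF n, of "slice f 1"]
      by (auto simp: slice_X' C2'_slices[OF f n] C2'_slices[OF Xf n] fun_eq_iff Yp_def Lc_def)
  next
    case 4
    then have n2: "n \<ge> 2" by simp
    define k where "k = j - 3"
    have k: "j - 2 = Suc k" "k + 2 \<le> n" using 4 by (auto simp: k_def)
    let ?r = "qq 2 k (slice f 1)"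
    have r: "?r \<in> MW" using m k by (intro qq_MW) auto
    have q: "qq 1 (j - 2) h = Sp 1 (qq 2 k h)" for h unfolding k(1) qq.simps Suc_1 ..
    have SC: "Sp 1 (Ct ?r) = C2 (Sp 1 ?r)" using r n2 by (auto simp: fun_eq_iff C2_def Ct_def Sp_def c2_def ss1)
    have "qq 2 k (Ct (slice f 1)) = Ct ?r" using k(2) m by (simp add: qq_comm)
    then have A: "Kop (qq 1 (j - 2) (Ct (slice f 1))) = C2 (Kop (qq 1 (j - 2) (slice f 1)))"
      unfolding q using M3[OF n2, of "Sp 1 ?r"] SC r n2 by simp
    have B: "Yp (C2 h) = C2 (Yp h)" if "h \<in> MW" for h
      using that n2 by (auto simp: fun_eq_iff C2_def Yp_def c2x)
    show ?thesis using 4 A B[OF m[of j]] n2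
      by (simp add: slice_X' C2'_slices[OF f n] C2'_slices[OF Xf n] C2_eq[OF n2, unfolded One_nat_def, symmetric])
  qed
qed

definition X2' :: "'v \<Rightarrow> 'v" where "X2' f = S' 1 (X' (S' 1 f)) + S' 1 f + C' (S' 1 (C' f))"

text \<open>On slice 1 only the \<open>Zop\<close> half of the correction occurs, because s_1 x_2 =
  x_1 s_1 + 1 - c_1 c_2 is used once; on slice 2 the power of x_1 is raised and 1 + c_1 c_2 is split
  off.\<close>

lemma X2'_slices:
  assumes f: "f \<in> W'" and n: "1 \<le> n"
  shows "slice (X2' f) 1 = pl (Yp (slice f 1)) (Zop (slice f 2))"
    "slice (X2' f) 2 = pl (Lx (slice f 2)) (pl (slice f 1) (Ct (Lc (slice f 1))))"
    "3 \<le> j \<Longrightarrow> j \<le> Suc n \<Longrightarrow> slice (X2' f) j = pl (Y2 (slice f j)) (Sp 1 (Kop (qq 1 (j - 2) (slice f 2))))"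
    "j = 0 \<or> Suc n < j \<Longrightarrow> slice (X2' f) j = zz"
proof -
  have m: "slice f j \<in> MW" for j using W'D(1)[OF f] by simp
  show "slice (X2' f) 1 = pl (Yp (slice f 1)) (Zop (slice f 2))"
    using n by (auto simp: X2'_def slice_pl slice_S' slice_X' slice_C' fun_eq_iff Zop_def numeral_2_eq_2)
  show "slice (X2' f) 2 = pl (Lx (slice f 2)) (pl (slice f 1) (Ct (Lc (slice f 1))))"
    using n by (auto simp: X2'_def slice_pl slice_S' slice_X' slice_C' fun_eq_iff numeral_2_eq_2)
  show "slice (X2' f) j = pl (Y2 (slice f j)) (Sp 1 (Kop (qq 1 (j - 2) (slice f 2))))" if "3 \<le> j" "j \<le> Suc n"
  proof -
    have "n \<ge> 2" using that by simp
    from Y2_eq[OF this m[of j]] that show ?thesis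
      by (auto simp: X2'_def slice_pl slice_S' slice_X' slice_C' fun_eq_iff numeral_2_eq_2)
  qed
  show "slice (X2' f) j = zz" if "j = 0 \<or> Suc n < j"
    using that n W'D(2)[OF f, of j] by (auto simp: X2'_def slice_pl slice_S' slice_X' slice_C')
qed

lemma W'_X2: "f \<in> W' \<Longrightarrow> 1 \<le> n \<Longrightarrow> X2' f \<in> W'"
  unfolding X2'_def by (intro subspD[OF subsp_W'] W'_S W'_X W'_C) auto

text \<open>The main terms commute slice by slice. The corrections cancel by \<open>M4\<close> and
  \<open>M5\<close> on slice 1, by \<open>M6\<close> and \<open>M7\<close> on slice 2, and by
  \<open>M8\<close> and \<open>M9\<close> on the others, where s_1 is peeled off the prefix and the
  rest s_2 s_3 ... commutes with all operators involved.\<close>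

lemma X'X2': assumes f: "f \<in> W'" and n: "1 \<le> n" shows "X' (X2' f) = X2' (X' f)"
proof (rule slice_eqI)
  fix j
  have m: "slice f j \<in> MW" for j using W'D(1)[OF f] by simp
  note X2f = W'_X2[OF f n] and Xf = W'_X[OF f]
  note Z = M5[OF n m[of 1]] M6[OF n m[of 2]]
  consider "j = 0 \<or> Suc n < j" | "j = 1" | "j = 2" | "3 \<le> j" "j \<le> Suc n" by linarith
  then show "slice (X' (X2' f)) j = slice (X2' (X' f)) j"
  proof cases
    case 1 then show ?thesis using X2'_slices(4)[OF Xf n, of j] by (auto simp: slice_X')
  next
    case 2
    have "Yp (Lx h) = Lx (Yp h)" for h by (auto simp: fun_eq_iff Yp_def Lx_def)
    then show ?thesis using Z(1) M4[OF n m[of 2]] n 2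
      by (simp add: slice_X' X2'_slices(1)[OF Xf n, simplified] X2'_slices(1)[OF f n, simplified] fun_eq_iff)
  next
    case 3
    have "Yp (Lx h) = Lx (Yp h)" for h by (auto simp: fun_eq_iff Yp_def Lx_def)
    then show ?thesis using Z(2) M7[OF n m[of 1]] n 3
      by (simp add: slice_X' X2'_slices(2)[OF Xf n, simplified] X2'_slices(1,2)[OF f n, simplified] fun_eq_iff algebra_simps)
  next
    case 4
    then have n2: "n \<ge> 2" by simp
    define k where "k = j - 3"
    have k: "j - 2 = Suc k" "k + 2 \<le> n" using 4 by (auto simp: k_def)
    let ?r1 = "qq 2 k (slice f 1)" and ?r2 = "qq 2 k (slice f 2)"
    have r: "?r1 \<in> MW" "?r2 \<in> MW" using m k by (auto intro!: qq_MW)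
    have q: "qq (Suc 0) (j - 2) h = Sp (Suc 0) (qq 2 k h)" for h
      using qq.simps(2)[of 1 k h] unfolding k(1) One_nat_def Suc_1[unfolded One_nat_def] .
    have YY: "Yp (Y2 h) = Y2 (Yp h)" if "h \<in> MW" for h
      using that n2 by (auto simp: fun_eq_iff Yp_def Y2_def x2x)
    have c: "qq 2 k (Yp (slice f i)) = Yp (qq 2 k (slice f i))" "qq 2 k (Kop (slice f i)) = Kop (qq 2 k (slice f i))"
      "qq 2 k (Zop (slice f i)) = Zop (qq 2 k (slice f i))" for i using k m by (auto simp: qq_comm)
    have L: "slice (X' (X2' f)) j = Yp (Y2 (slice f j) \<boxplus> Sp 1 (Kop (Sp 1 ?r2))) \<boxplus>
        Kop (Sp 1 (Yp ?r1 \<boxplus> Zop ?r2))"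
      using 4 by (simp add: slice_X' X2'_slices(3)[OF f n] X2'_slices(1)[OF f n, simplified] q c)
    have R: "slice (X2' (X' f)) j = Y2 (Yp (slice f j) \<boxplus> Kop (Sp 1 ?r1)) \<boxplus> Sp 1 (Kop (Sp 1 (Yp ?r2 \<boxplus> Kop ?r1)))"
      using 4 n by (simp add: slice_X' X2'_slices(3)[OF Xf n] q c)
    show ?thesis unfolding L R using M8[OF n2 r(1)] M9[OF n2 r(2)] YY[OF m[of j]] n2
      by (simp add: fun_eq_iff algebra_simps)
  qed
qed

text \<open>\<open>X'\<close> is block triangular: slice 1 is shifted on its own and feeds every
  other slice. Iteration gives a sum over the step at which the correction enters, after which p
  further factors x act on it.\<close>

lemma X'_pow: assumes f: "f \<in> W'"
  shows "slice ((X' ^^ m) f) 1 b a = slice f 1 b (a + m)"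
    "2 \<le> j \<Longrightarrow> j \<le> Suc n \<Longrightarrow> slice ((X' ^^ m) f) j b a = (x ^^ m) (slice f j b a) +
      (\<Sum>p<m. (x ^^ p) (Kop (\<lambda>b a. qq 1 (j - 2) (slice f 1) b (a + (m - 1 - p))) b a))"
proof -
  show 1: "slice ((X' ^^ m) f) 1 b a = slice f 1 b (a + m)" for m b a
    by (induction m arbitrary: a) (auto simp: slice_X' Lx_def)
  have shift: "qq lo k (\<lambda>b a. h b (a + m)) = (\<lambda>b a. qq lo k h b (a + m))" for lo k m and h :: "bool \<Rightarrow> nat \<Rightarrow> 'v"
    by (induction k arbitrary: lo) (auto simp: Sp_def fun_eq_iff)
  have 2: "slice ((X' ^^ m) f) 1 = (\<lambda>b a. slice f 1 b (a + m))" for m by (rule ext)+ (rule 1)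
  show "slice ((X' ^^ m) f) j b a = (x ^^ m) (slice f j b a) +
      (\<Sum>p<m. (x ^^ p) (Kop (\<lambda>b a. qq 1 (j - 2) (slice f 1) b (a + (m - 1 - p))) b a))" if j: "2 \<le> j" "j \<le> Suc n"
  proof (induction m)
    case (Suc m)
    have "slice ((X' ^^ Suc m) f) j b a = x (slice ((X' ^^ m) f) j b a) + Kop (qq 1 (j - 2) (slice ((X' ^^ m) f) 1)) b a"
      using j by (simp add: slice_X' Yp_def)
    also have "\<dots> = (x ^^ Suc m) (slice f j b a) + (\<Sum>p<m. (x ^^ Suc p) (Kop (\<lambda>b a. qq 1 (j - 2) (slice f 1) b (a + (m - 1 - p))) b a))
        + Kop (\<lambda>b a. qq 1 (j - 2) (slice f 1) b (a + m)) b a"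
      unfolding Suc 2 shift by simp
    finally show ?case unfolding sum.lessThan_Suc_shift by simp
  qed simp
qed

text \<open>On slice 1 this is the recurrence; on a later slice the main term is g(x) acting on the
  value, and the accumulated corrections are the sum treated in \<open>Theta\<close>.\<close>

lemma g_X': assumes f: "f \<in> W'" shows "(\<Sum>m\<le>degree g. coeff g m \<cdot> (X' ^^ m) f) = 0"
proof (rule slice_eqI, intro ext)
  fix j b a
  have W'p: "(X' ^^ m) f \<in> W'" for m by (induction m) (auto simp: f W'_X)
  have m: "slice f j \<in> MR" for j using W'D(1)[OF f] .
  have W: "slice f j b a \<in> W" for j b a using m[of j] by simp
  consider "j = 0 \<or> Suc n < j" | "j = 1" | "2 \<le> j" "j \<le> Suc n" by linarith
  then show "slice (\<Sum>m\<le>degree g. coeff g m \<cdot> (X' ^^ m) f) j b a = slice 0 j b a"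
  proof cases
    case 1 then show ?thesis using W'D(2)[OF W'p, of j] by (simp add: zz_def)
  next
    case 2 then show ?thesis using m[of 1] X'_pow(1)[OF f] by (simp add: MR_def rec_seq_def del: MR_MW)
  next
    case 3
    have n: "n \<ge> 1" using 3 by simp
    have q: "qq 1 (j - 2) (slice f 1) \<in> MR" using m 3 by (intro qq_MR) auto
    show ?thesis using Theta[OF n q, of b a] gx[OF n W[of j b a]]
      by (simp add: X'_pow(2)[OF f 3] scale_add_right sum.distrib)
  qed
qed

theorem small_sergeev_step: "small_sergeev scale g (Suc n) W' X' C' S'"
proof unfold_locales
  show "coeff g m \<noteq> 0 \<Longrightarrow> even m = even (degree g)" for m by (rule g_par)
  show "subsp W'" by (rule subsp_W')
  show "lin X'" "lin C'" "\<And>i. lin (S' i)" by (rule lin_X' lin_C' lin_S')+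
  show "v \<in> W' \<Longrightarrow> X' (S' 1 (X' (S' 1 v)) + S' 1 v + C' (S' 1 (C' v))) =
         S' 1 (X' (S' 1 (X' v))) + S' 1 (X' v) + C' (S' 1 (C' (X' v)))" if "2 \<le> Suc n" for v
    using X'X2'[of v] that by (simp add: X2'_def)
qed (auto intro: W'_X W'_C W'_S S'S' S'_far S'_braid C'C' X'C' S'C'_comm S'X'_comm g_X' C'C2' X'C2' simp del: One_nat_def)

end

section \<open>All generators and relations of rank n recovered from x_1, c_1 and the s_i\<close>

context small_sergeev
begin

text \<open>The recursion c_(i+1) = s_i c_i s_i, and for \<open>xs\<close> the relation s_i x_i =
  x_(i+1) s_i - (1 + c_i c_(i+1)) solved for x_(i+1). Index 0 is given the value at 1 by the
  catch-all clause.\<close>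

fun cs :: "nat \<Rightarrow> 'v \<Rightarrow> 'v" where
  "cs (Suc (Suc i)) v = s (Suc i) (cs (Suc i) (s (Suc i) v))"
| "cs _ v = c v"

fun xs :: "nat \<Rightarrow> 'v \<Rightarrow> 'v" where
  "xs (Suc (Suc i)) v = s (Suc i) (xs (Suc i) (s (Suc i) v)) + s (Suc i) v + cs (Suc i) (s (Suc i) (cs (Suc i) v))"
| "xs _ v = x v"

lemma cs_Suc: "1 \<le> i \<Longrightarrow> cs (Suc i) v = s i (cs i (s i v))"
  and xs_Suc: "1 \<le> i \<Longrightarrow> xs (Suc i) v = s i (xs i (s i v)) + s i v + cs i (s i (cs i v))"
  by (cases i; simp)+

lemma cs_1: "cs (Suc 0) v = c v" and xs_1: "xs (Suc 0) v = x v" by simp_all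

declare cs.simps [simp del] xs.simps [simp del]

lemma lin_cs: "lin (cs i)"
proof (induction i)
  case (Suc i) then show ?case by (cases i) (auto simp: lin_def cs.simps scale_add_right algebra_simps)
qed (auto simp: lin_def cs.simps scale_add_right)

lemmas cs_lin [simp] = lin_rules[OF lin_cs]

lemma lin_xs: "lin (xs i)"
proof (induction i)
  case (Suc i) then show ?case by (cases i) (auto simp: lin_def xs.simps scale_add_right algebra_simps)
qed (auto simp: lin_def xs.simps scale_add_right)

lemmas xs_lin [simp] = lin_rules[OF lin_xs]

lemma csW [simp]: "1 \<le> i \<Longrightarrow> i \<le> n \<Longrightarrow> v \<in> W \<Longrightarrow> cs i v \<in> W"
proof (induction i arbitrary: v rule: nat_induct_at_least)
  case (Suc i) then show ?case by (simp add: cs_Suc)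
qed (simp add: cs_1)

lemma xsW [simp]: "1 \<le> i \<Longrightarrow> i \<le> n \<Longrightarrow> v \<in> W \<Longrightarrow> xs i v \<in> W"
proof (induction i arbitrary: v rule: nat_induct_at_least)
  case (Suc i) then show ?case by (simp add: xs_Suc)
qed (simp add: xs_1)

lemma s_far: "1 \<le> i \<Longrightarrow> 1 \<le> j \<Longrightarrow> i + 1 < j \<or> j + 1 < i \<Longrightarrow> i < n \<Longrightarrow> j < n \<Longrightarrow> v \<in> W \<Longrightarrow> s i (s j v) = s j (s i v)"
  using far[of i j v] far[of j i v] by auto

lemma s_cs: "1 \<le> i \<Longrightarrow> i < n \<Longrightarrow> v \<in> W \<Longrightarrow> s i (cs i v) = cs (Suc i) (s i v)"
  and s_cs': "1 \<le> i \<Longrightarrow> i < n \<Longrightarrow> v \<in> W \<Longrightarrow> s i (cs (Suc i) v) = cs i (s i v)"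
  by (simp_all add: cs_Suc ss)

lemma s_xs: "1 \<le> i \<Longrightarrow> i < n \<Longrightarrow> v \<in> W \<Longrightarrow> s i (xs i v) = xs (Suc i) (s i v) - v - cs i (cs (Suc i) v)"
  by (simp add: xs_Suc cs_Suc ss)

text \<open>Expanding c_j = s_(j-1) c_(j-1) s_(j-1), the letter s_i passes everything except when j
  = i + 2; there the braid relation turns s_i s_(i+1) s_i into s_(i+1) s_i s_(i+1), and the new
  outer letter commutes with c_i.\<close>

lemma s_cs_far:
  "1 \<le> j \<Longrightarrow> j \<le> n \<Longrightarrow> 1 \<le> i \<Longrightarrow> i < n \<Longrightarrow> j < i \<or> i + 1 < j \<Longrightarrow> v \<in> W \<Longrightarrow> s i (cs j v) = cs j (s i v)"
proof (induction j arbitrary: i v rule: less_induct)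
  case (less j)
  consider "j = 1" | k where "j = Suc k" "1 \<le> k" "k + 1 < i \<or> i + 1 < k" | "j = Suc (Suc i)"
    using less.prems by (cases j) (force simp: not_less)+
  then show ?case
  proof cases
    case 1 then show ?thesis using less.prems by (simp add: cs_1 sc)
  next
    case 2 then show ?thesis using less s_far[of i k] by (auto simp: cs_Suc)
  next
    case 3
    have uc: "s (Suc i) (cs i w) = cs i (s (Suc i) w)" if "w \<in> W" for w
      using less.IH[of i "Suc i"] less.prems that 3 by simp
    have b: "s i (s (Suc i) (s i (cs i w))) = s (Suc i) (s i (cs i (s (Suc i) w)))" if "w \<in> W" for w
      using braid[of i "cs i w"] that less.prems 3 by (simp add: uc)
    show ?thesis using less.prems 3 by (simp add: cs_Suc ss b braid)
  qed
qed

text \<open>As for \<open>s_cs_far\<close>. In the case j = i + 2 the braid relation is applied to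
  each of the summands into which x_(i+2) expands.\<close>

lemma s_xs_far:
  "1 \<le> j \<Longrightarrow> j \<le> n \<Longrightarrow> 1 \<le> i \<Longrightarrow> i < n \<Longrightarrow> j < i \<or> i + 1 < j \<Longrightarrow> v \<in> W \<Longrightarrow> s i (xs j v) = xs j (s i v)"
proof (induction j arbitrary: i v rule: less_induct)
  case (less j)
  consider "j = 1" | k where "j = Suc k" "1 \<le> k" "k + 1 < i \<or> i + 1 < k" | "j = Suc (Suc i)"
    using less.prems by (cases j) (force simp: not_less)+
  then show ?case
  proof cases
    case 1 then show ?thesis using less.prems by (simp add: xs_1 sx)
  next
    case 2 then show ?thesis using less s_far[of i k] s_cs_far[of k i] by (auto simp: xs_Suc)
  next
    case 3
    let ?t = "s i" and ?u = "s (Suc i)" and ?x = "xs i" and ?c = "cs i"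
    have uc: "?u (?c w) = ?c (?u w)" if "w \<in> W" for w
      using s_cs_far[of i "Suc i"] less.prems that 3 by simp
    have ux: "?u (?x w) = ?x (?u w)" if "w \<in> W" for w
      using less.IH[of i "Suc i"] less.prems that 3 by simp
    have b: "?u (?t (?u w)) = ?t (?u (?t w))" if "w \<in> W" for w
      using braid that less.prems 3 by simp
    have B: "?t (?u (?t (?c w))) = ?u (?t (?c (?u w)))" "?t (?u (?t (?x w))) = ?u (?t (?x (?u w)))" if "w \<in> W" for w
      using b[of "?c w"] b[of "?x w"] that less.prems 3 by (simp_all add: uc ux)
    show ?thesis using less.prems 3 by (simp add: xs_Suc cs_Suc ss uc ux b B algebra_simps)
  qed
qed

lemma cs_cs: "1 \<le> i \<Longrightarrow> i \<le> n \<Longrightarrow> v \<in> W \<Longrightarrow> cs i (cs i v) = v"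
proof (induction i arbitrary: v rule: nat_induct_at_least)
  case (Suc i) then show ?case by (simp add: cs_Suc ss)
qed (simp add: cs_1 cc)

text \<open>The relation for a pair i < j follows from the one for (1, 2): first j is raised with i
  = 1, then i is raised below a fixed j, each time by conjugation with a letter s that commutes with
  the other factor. The mixed relations and x_i x_j = x_j x_i are obtained along the same
  path.\<close>

lemma cs_anti1: "2 \<le> j \<Longrightarrow> j \<le> n \<Longrightarrow> v \<in> W \<Longrightarrow> cs 1 (cs j v) = - cs j (cs 1 v)"
proof (induction j arbitrary: v rule: nat_induct_at_least)
  case base then show ?case using cc2[of v] by (simp add: cs_1 cs_Suc numeral_2_eq_2)
next
  case (Suc j)
  have "cs 1 (s j w) = s j (cs 1 w)" if "w \<in> W" for w using s_cs_far[of 1 j w] Suc that by simp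
  with Suc show ?case by (simp add: cs_Suc flip: One_nat_def)
qed

lemma cs_anti_less: "1 \<le> i \<Longrightarrow> i < j \<Longrightarrow> j \<le> n \<Longrightarrow> v \<in> W \<Longrightarrow> cs i (cs j v) = - cs j (cs i v)"
proof (induction i arbitrary: v rule: nat_induct_at_least)
  case base then show ?case using cs_anti1[of j v] by simp
next
  case (Suc i)
  have "s i (cs j w) = cs j (s i w)" if "w \<in> W" for w using s_cs_far[of j i w] Suc that by simp
  with Suc show ?case by (simp add: cs_Suc)
qed

lemma cs_anti: "1 \<le> i \<Longrightarrow> i \<le> n \<Longrightarrow> 1 \<le> j \<Longrightarrow> j \<le> n \<Longrightarrow> i \<noteq> j \<Longrightarrow> v \<in> W \<Longrightarrow> cs i (cs j v) = - cs j (cs i v)"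
  using cs_anti_less[of i j v] cs_anti_less[of j i v] by (cases i j rule: linorder_cases) auto

lemma xs_cs: "1 \<le> i \<Longrightarrow> i \<le> n \<Longrightarrow> v \<in> W \<Longrightarrow> xs i (cs i v) = - cs i (xs i v)"
proof (induction i arbitrary: v rule: nat_induct_at_least)
  case base then show ?case by (simp add: cs_1 xs_1 xc)
next
  case (Suc i)
  have a: "cs i (s i (cs i (s i w))) = - s i (cs i (s i (cs i w)))" if "w \<in> W" for w
    using cs_anti[of i "Suc i" w] Suc that by (simp add: cs_Suc)
  have a': "s i (cs i (s i (cs i w))) = - cs i (s i (cs i (s i w)))" if "w \<in> W" for w
    using a[OF that] by simp
  from Suc show ?case by (simp add: cs_Suc xs_Suc ss a' cs_cs)
qed

lemma xs_cs_1: "2 \<le> j \<Longrightarrow> j \<le> n \<Longrightarrow> v \<in> W \<Longrightarrow> xs 1 (cs j v) = cs j (xs 1 v)"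
proof (induction j arbitrary: v rule: nat_induct_at_least)
  case base then show ?case using xc2[of v] by (simp add: cs_1 xs_1 cs_Suc numeral_2_eq_2)
next
  case (Suc j)
  have "xs 1 (s j w) = s j (xs 1 w)" if "w \<in> W" for w using s_xs_far[of 1 j w] Suc that by simp
  with Suc show ?case by (simp add: cs_Suc flip: One_nat_def)
qed

text \<open>Induction on i. The delicate case is x_(i+1) c_i, which is reduced by conjugation with
  s_i to x_i c_(i+1), covered by the induction hypothesis because j is kept general.\<close>

lemma xs_cs_ne: "1 \<le> i \<Longrightarrow> i \<le> n \<Longrightarrow> 1 \<le> j \<Longrightarrow> j \<le> n \<Longrightarrow> i \<noteq> j \<Longrightarrow> v \<in> W \<Longrightarrow> xs i (cs j v) = cs j (xs i v)"
proof (induction i arbitrary: v j rule: nat_induct_at_least)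
  case base then show ?case using xs_cs_1[of j v] by simp
next
  case (Suc i)
  show ?case
  proof (cases "j = i")
    case True
    have *: "xs i (s i (cs i w)) = s i (cs i (s i (xs i (s i w))))" if "w \<in> W" for w
      using Suc.IH[of "Suc i" "s i w"] Suc.prems Suc.hyps that by (simp add: cs_Suc ss)
    show ?thesis using True Suc by (simp add: xs_Suc * ss cs_cs algebra_simps)
  next
    case False
    then have "j < i \<or> i + 1 < j" using Suc.prems by linarith
    then have "s i (cs j w) = cs j (s i w)" "cs i (cs j w) = - cs j (cs i w)" if "w \<in> W" for w
      using s_cs_far[of j i w] cs_anti[of i j w] Suc that False by auto
    with Suc False show ?thesis by (simp add: xs_Suc)
  qed
qed

lemma xs_xs_1: "2 \<le> j \<Longrightarrow> j \<le> n \<Longrightarrow> v \<in> W \<Longrightarrow> xs 1 (xs j v) = xs j (xs 1 v)"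
proof (induction j arbitrary: v rule: nat_induct_at_least)
  case base then show ?case using xx2[of v] by (simp add: cs_1 xs_1 xs_Suc numeral_2_eq_2)
next
  case (Suc j)
  have "xs 1 (s j w) = s j (xs 1 w)" "xs 1 (cs j w) = cs j (xs 1 w)" if "w \<in> W" for w
    using s_xs_far[of 1 j w] xs_cs_1[of j w] Suc that by auto
  with Suc show ?case by (simp add: xs_Suc flip: One_nat_def)
qed

lemma xs_xs_less: "1 \<le> i \<Longrightarrow> i < j \<Longrightarrow> j \<le> n \<Longrightarrow> v \<in> W \<Longrightarrow> xs i (xs j v) = xs j (xs i v)"
proof (induction i arbitrary: v rule: nat_induct_at_least)
  case base then show ?case using xs_xs_1[of j v] by simp
next
  case (Suc i)
  have "s i (xs j w) = xs j (s i w)" "cs i (xs j w) = xs j (cs i w)" if "w \<in> W" for w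
    using s_xs_far[of j i w] xs_cs_ne[of j i w] Suc that by auto
  with Suc show ?case by (simp add: xs_Suc)
qed

lemma xs_xs: "1 \<le> i \<Longrightarrow> i \<le> n \<Longrightarrow> 1 \<le> j \<Longrightarrow> j \<le> n \<Longrightarrow> v \<in> W \<Longrightarrow> xs i (xs j v) = xs j (xs i v)"
  using xs_xs_less[of i j v] xs_xs_less[of j i v] by (cases i j rule: linorder_cases) auto

end

section \<open>Normal words and the action of words\<close>

text \<open>Normal forms for the group part (Clifford group extended by the symmetric group): a
  normal word of rank n, followed by a coset representative c_(n+1)^b s_n ... s_j.\<close>

primrec NF :: "nat \<Rightarrow> sergeev_letter list set" where
  "NF 0 = {[]}"
| "NF (Suc n) = {y @ (if b then [C_letter (Suc n)] else []) @ map S_letter (rev [j..<Suc n]) | y b j.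
     y \<in> NF n \<and> 1 \<le> j \<and> j \<le> Suc n}"

text \<open>The top monomial x_1^e ... x_n^e; it is used with e = d - 1.\<close>

primrec xtop :: "nat \<Rightarrow> nat \<Rightarrow> sergeev_letter list" where
  "xtop e 0 = []"
| "xtop e (Suc n) = xtop e n @ replicate e (X_letter (Suc n))"

definition Y_letters :: "nat \<Rightarrow> sergeev_letter set" where
  "Y_letters n = S_letter ` {1..<n} \<union> C_letter ` {1..n}"

lemma NF_letters: "y \<in> NF n \<Longrightarrow> set y \<subseteq> Y_letters n"
proof (induction n arbitrary: y)
  case (Suc n)
  have "Y_letters n \<subseteq> Y_letters (Suc n)" by (auto simp: Y_letters_def)
  moreover obtain w b j where w: "w \<in> NF n" and "1 \<le> j"
    and "y = w @ (if b then [C_letter (Suc n)] else []) @ map S_letter (rev [j..<Suc n])"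
    using Suc.prems by auto
  then have "set y \<subseteq> set w \<union> {C_letter (Suc n)} \<union> S_letter ` {j..<Suc n}" by auto
  moreover have "{C_letter (Suc n)} \<union> S_letter ` {j..<Suc n} \<subseteq> Y_letters (Suc n)"
    using \<open>1 \<le> j\<close> by (auto simp: Y_letters_def)
  ultimately show ?case using Suc.IH[OF w] by blast
qed auto

definition xcount :: "sergeev_letter list \<Rightarrow> nat" where
  "xcount w = length (filter (\<lambda>l. \<exists>i. l = X_letter i) w)"

lemma xcount_simps [simp]: "xcount [] = 0" "xcount (S_letter i # w) = xcount w" "xcount (C_letter i # w) = xcount w"
  "xcount (X_letter i # w) = Suc (xcount w)" "xcount (u @ w) = xcount u + xcount w"
  by (auto simp: xcount_def)

context small_sergeev
begin

fun act1 :: "sergeev_letter \<Rightarrow> 'v \<Rightarrow> 'v" where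
  "act1 (S_letter i) = s i"
| "act1 (X_letter i) = xs i"
| "act1 (C_letter i) = cs i"

definition actw :: "sergeev_letter list \<Rightarrow> 'v \<Rightarrow> 'v" where "actw w v = foldr act1 w v"

lemma actw_simps [simp]: "actw [] v = v" "actw (l # w) v = act1 l (actw w v)" "actw (u @ w) v = actw u (actw w v)"
  by (simp_all add: actw_def)

lemma lin_act1: "lin (act1 l)"
  using lin_s lin_xs lin_cs by (cases l) auto

lemma lin_actw: "lin (actw w)"
proof (induction w)
  case Nil then show ?case by (simp add: lin_def)
next
  case (Cons l w) then show ?case using lin_act1[of l] by (simp add: lin_def)
qed

lemma actw_replicate: "actw (replicate m l) = (act1 l ^^ m)"
  by (induction m) auto

lemma act1_W: "l \<in> sergeev_letters n \<Longrightarrow> v \<in> W \<Longrightarrow> act1 l v \<in> W"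
  by (auto simp: sergeev_letters_def)

lemma actw_W: "set w \<subseteq> sergeev_letters n \<Longrightarrow> v \<in> W \<Longrightarrow> actw w v \<in> W"
  by (induction w) (auto simp: act1_W)

end

section \<open>Representations with a distinguished matrix coefficient\<close>

text \<open>The linear form in view is f -> ev(f om). The descending filtration \<open>G\<close>
  counts how many letters x are needed: \<open>om\<close> has depth n(d-1), the letters s and c keep
  the depth, x lowers it by at most one, and \<open>ev\<close> vanishes at positive depth.
  \<open>ev_NF\<close> fixes the form on the top monomial times normal words. The operator
  \<open>par\<close> commutes with even generators, anticommutes with odd ones and fixes
  \<open>om\<close> and \<open>ev\<close>; it forces the form to be even.\<close>

locale sergeev_rep = small_sergeev scale g n W x c s
  for scale :: "'r::comm_ring_1 \<Rightarrow> 'v::ab_group_add \<Rightarrow> 'v" (infixr \<open>\<cdot>\<close> 75) and g n W x c s +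
  fixes par :: "'v \<Rightarrow> 'v" and G :: "nat \<Rightarrow> 'v set" and om :: 'v and ev :: "'v \<Rightarrow> 'r"
  assumes lin_par: "lin par" and par_W: "v \<in> W \<Longrightarrow> par v \<in> W"
    and par_x: "par (x v) = x (par v)" and par_c: "par (c v) = - c (par v)" and par_s: "par (s i v) = s i (par v)"
    and par_om: "par om = om" and ev_par: "ev (par v) = ev v"
    and ev_add: "ev (u + v) = ev u + ev v" and ev_scale: "ev (r \<cdot> v) = r * ev v"
    and G_0: "G 0 = W" and G_subsp: "subsp (G k)" and G_anti: "G (Suc k) \<subseteq> G k"
    and G_x: "n \<ge> 1 \<Longrightarrow> v \<in> G k \<Longrightarrow> x v \<in> G (k - 1)"
    and G_c: "n \<ge> 1 \<Longrightarrow> v \<in> G k \<Longrightarrow> c v \<in> G k"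
    and G_s: "1 \<le> i \<Longrightarrow> i < n \<Longrightarrow> v \<in> G k \<Longrightarrow> s i v \<in> G k"
    and ev_G: "v \<in> G (Suc k) \<Longrightarrow> ev v = 0"
    and om_G: "om \<in> G (n * (degree g - 1))"
    and ev_NF: "y \<in> NF n \<Longrightarrow> ev (actw (xtop (degree g - 1) n @ y) om) = (if y = [] then 1 else 0)"
begin

lemmas par_lin [simp] = lin_rules[OF lin_par]
lemmas G_rules [simp] = subspD[OF G_subsp]

lemma G_mono: "k \<le> m \<Longrightarrow> v \<in> G m \<Longrightarrow> v \<in> G k"
  by (induction m rule: dec_induct) (use G_anti in auto)

lemma G_W: "v \<in> G k \<Longrightarrow> v \<in> W"
  using G_mono[of 0 k v] G_0 by simp

lemma G_cs: "1 \<le> i \<Longrightarrow> i \<le> n \<Longrightarrow> v \<in> G k \<Longrightarrow> cs i v \<in> G k"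
proof (induction i arbitrary: v rule: nat_induct_at_least)
  case (Suc i) then show ?case by (simp add: cs_Suc G_s)
qed (simp add: cs_1 G_c)

lemma G_xs: "1 \<le> i \<Longrightarrow> i \<le> n \<Longrightarrow> v \<in> G k \<Longrightarrow> xs i v \<in> G (k - 1)"
proof (induction i arbitrary: v rule: nat_induct_at_least)
  case (Suc i)
  have "s i v + cs i (s i (cs i v)) \<in> G (k - 1)"
    by (rule G_mono[of _ k]) (use Suc in \<open>auto intro!: G_s G_cs subspD(2)[OF G_subsp]\<close>)
  then show ?case using Suc by (auto simp: xs_Suc G_s add.assoc intro!: subspD(2)[OF G_subsp])
next
  case base then show ?case using G_x[of v k] by (simp add: xs_1)
qed

lemma G_actw: "set w \<subseteq> sergeev_letters n \<Longrightarrow> v \<in> G k \<Longrightarrow> actw w v \<in> G (k - xcount w)"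
proof (induction w)
  case (Cons l w)
  then show ?case
  proof (cases l)
    case (S_letter i) then show ?thesis using Cons by (auto simp: sergeev_letters_def intro!: G_s)
  next
    case (C_letter i) then show ?thesis using Cons by (auto simp: sergeev_letters_def intro!: G_cs)
  next
    case (X_letter i) then show ?thesis
      using Cons G_xs[of i "actw w v" "k - xcount w"] by (auto simp: sergeev_letters_def)
  qed
qed auto

lemma ev_zero [simp]: "ev 0 = 0" using ev_add[of 0 0] by simp
lemma ev_minus [simp]: "ev (- v) = - ev v" using ev_add[of "- v" v] by (simp add: eq_neg_iff_add_eq_0)

lemma par_cs: "par (cs i v) = - cs i (par v)"
proof (induction i arbitrary: v)
  case (Suc i) then show ?case by (cases i) (auto simp: cs.simps par_s par_c)
qed (simp add: cs.simps par_c)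

lemma par_xs: "par (xs i v) = xs i (par v)"
proof (induction i arbitrary: v)
  case (Suc i) then show ?case by (cases i) (auto simp: xs.simps par_s par_x par_cs)
qed (simp add: xs.simps par_x)

end

section \<open>The distinguished coefficient on the coinduced module\<close>

text \<open>The sequence \<open>y\<close> is the functional on R[x]/(g) that reads the coefficient
  of x^(d-1), evaluated at the powers x^a.\<close>

locale sergeev_rep_step = sergeev_rep scale g n W x c s par G om ev + sergeev_step scale g n W x c s slice build
  for scale :: "'r::comm_ring_1 \<Rightarrow> 'v::ab_group_add \<Rightarrow> 'v" (infixr \<open>\<cdot>\<close> 75) and g n W x c s par G om ev slice build +
  fixes y :: "nat \<Rightarrow> 'r"
  assumes deg_g: "degree g \<ge> 1" and y_lt: "a < degree g - 1 \<Longrightarrow> y a = 0" and y_eq: "y (degree g - 1) = 1"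
    and y_rec: "(\<Sum>m\<le>degree g. coeff g m * y (a + m)) = 0"
begin

interpretation P: small_sergeev scale g "Suc n" W' X' C' S'
  by (rule small_sergeev_step)

text \<open>The sign at b = True is the parity of the argument c_1^b.\<close>

definition par' :: "'v \<Rightarrow> 'v" where "par' f = build (\<lambda>j b a. if b then - par (slice f j b a) else par (slice f j b a))"
text \<open>A vector of depth k may lose a steps when it is evaluated at an argument with
  x_1^a.\<close>

definition G' :: "nat \<Rightarrow> 'v set" where "G' k = {f \<in> W'. \<forall>j b a. slice f j b a \<in> G (k - a)}"
text \<open>On slice n + 1 the arguments are z c_1^b x_1^a s_1 ... s_n, and z s_1 ... s_n = 1. So
  \<open>ev'\<close> is \<open>ev\<close> of the value at 1, and \<open>om'\<close> is the vector
  with value y(a) om at z x_1^a s_1 ... s_n and zero at the other arguments.\<close>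

definition om' :: 'v where "om' = build (\<lambda>j b a. if j = Suc n \<and> \<not> b then y a \<cdot> om else 0)"
definition ev' :: "'v \<Rightarrow> 'r" where "ev' f = ev (slice f (Suc n) False 0)"

lemma slice_par': "slice (par' f) j b a = (if b then - par (slice f j b a) else par (slice f j b a))"
  and slice_om': "slice om' j b a = (if j = Suc n \<and> \<not> b then y a \<cdot> om else 0)"
  by (simp_all add: par'_def om'_def)

lemma eqI3: "(\<And>j b a. slice f j b a = slice h j b a) \<Longrightarrow> f = h"
  by (rule slice_eqI) (auto simp: fun_eq_iff)

lemma lin_par': "lin par'"
  unfolding lin_def by (intro conjI allI; rule eqI3) (simp_all add: slice_par')

lemma se_par: "par (se a v) = se a (par v)" by (auto simp: se_def)

lemma par_xp: "par ((x ^^ a) v) = (x ^^ a) (par v)" by (induction a) (auto simp: par_x)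

lemma par'_W': "f \<in> W' \<Longrightarrow> par' f \<in> W'"
proof -
  assume f: "f \<in> W'"
  have "slice (par' f) j \<in> MR" for j
  proof -
    have m: "slice f j \<in> MR" using W'D(1)[OF f] .
    have "rec_seq (slice (par' f) j b)" for b
      using rec_seq_lin[OF lin_par, of "slice f j b"] rec_seq_minus[of "\<lambda>a. par (slice f j b a)"] m
      by (cases b) (simp_all add: slice_par'[abs_def] MR_def del: MR_MW)
    then show ?thesis using m by (auto simp: MR_def MW_def slice_par' par_W simp del: MR_MW MW_D)
  qed
  then show ?thesis using W'D(2)[OF f] by (auto simp: W'_def slice_par' zz_def fun_eq_iff)
qed

lemma par_qq: "par (qq lo k h b a) = qq lo k (\<lambda>b a. par (h b a)) b a"
  by (induction k arbitrary: lo) (auto simp: Sp_def par_s)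

lemma qq_par: "qq lo k (\<lambda>b a. if b then - h b a else h b a) = (\<lambda>b a. if b then - qq lo k h b a else qq lo k h b a)"
  by (induction k arbitrary: lo) (auto simp: Sp_def fun_eq_iff)

lemma Kop_par: "Kop (\<lambda>b a. if b then - par (h b a) else par (h b a)) b a = (if b then - par (Kop h b a) else par (Kop h b a))"
  by (auto simp: Kop_def se_par par_xp par_c algebra_simps)

lemma par'_X': "par' (X' f) = X' (par' f)"
proof (rule eqI3)
  fix j b a
  have q: "qq 1 k (slice (par' f) 1) = (\<lambda>b a. if b then - par (qq 1 k (slice f 1) b a) else par (qq 1 k (slice f 1) b a))" for k
    by (intro ext) (simp add: slice_par'[abs_def] par_qq qq_par del: One_nat_def)
  show "slice (par' (X' f)) j b a = slice (X' (par' f)) j b a"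
    by (simp add: slice_par' slice_X' q Kop_par Lx_def Yp_def par_x zz_def del: One_nat_def)
qed

lemma par'_C': "par' (C' f) = - C' (par' f)"
  by (rule eqI3) (auto simp: slice_par' slice_C' Lc_def Ct_def par_c se_par)

lemma par'_S': "par' (S' i f) = S' i (par' f)"
  by (rule eqI3) (auto simp: slice_par' slice_S' Sp_def par_s)

lemma om'_W': "om' \<in> W'"
proof -
  have omW: "om \<in> W" using om_G G_W by auto
  have z: "(\<lambda>a. 0 :: 'v) = zz b" for b by (auto simp: zz_def)
  have rz: "rec_seq (\<lambda>a. 0)" by (simp add: rec_seq_def)
  have "(\<Sum>m\<le>degree g. coeff g m \<cdot> y (a + m) \<cdot> om) = (\<Sum>m\<le>degree g. coeff g m * y (a + m)) \<cdot> om" for a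
    by (simp add: scale_scale scale_sum_left)
  then have "rec_seq (\<lambda>a. y a \<cdot> om)" by (simp add: rec_seq_def y_rec)
  then have "rec_seq (slice om' j b)" for j b using rz
    by (cases "j = Suc n"; cases b) (simp_all add: slice_om'[abs_def])
  then show ?thesis using omW by (auto simp: W'_def MR_def MW_def zz_def slice_om' fun_eq_iff simp del: MR_MW MW_D)
qed

lemma G'_W': "f \<in> G' k \<Longrightarrow> f \<in> W'" by (simp add: G'_def)

lemma G'D: "f \<in> G' k \<Longrightarrow> slice f j b a \<in> G (k - a)" by (simp add: G'_def)

lemma G_xp: "n \<ge> 1 \<Longrightarrow> v \<in> G k \<Longrightarrow> (x ^^ a) v \<in> G (k - a)"
proof (induction a)
  case (Suc a) then show ?case using G_x[of "(x ^^ a) v" "k - a"] by simp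
qed simp

lemma G_se: "v \<in> G k \<Longrightarrow> se a v \<in> G k" by (simp add: se_def)

lemma G_qq: "1 \<le> lo \<Longrightarrow> lo + m \<le> n \<Longrightarrow> (\<And>b a. h b a \<in> G (k - a)) \<Longrightarrow> qq lo m h b a \<in> G (k - a)"
  by (induction m arbitrary: lo b a) (auto simp: Sp_def intro!: G_s)

lemma G_Kop: "n \<ge> 1 \<Longrightarrow> (\<And>b a. h b a \<in> G (k - a)) \<Longrightarrow> Kop h b a \<in> G (k - a)"
proof -
  assume n: "n \<ge> 1" and h: "\<And>b a. h b a \<in> G (k - a)"
  have "(x ^^ a) (h b 0) \<in> G (k - a)" for b using G_xp[OF n h[of b 0]] by simp
  with h n show ?thesis by (auto simp: Kop_def G_c G_se)
qed

lemma G'_X': "f \<in> G' k \<Longrightarrow> X' f \<in> G' (k - 1)"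
proof -
  assume f: "f \<in> G' k"
  have "slice (X' f) j b a \<in> G (k - 1 - a)" for j b a
  proof (cases "2 \<le> j \<and> j \<le> Suc n")
    case True
    have "Kop (qq 1 (j - 2) (slice f 1)) b a \<in> G (k - a)"
      using True G'D[OF f] by (intro G_Kop G_qq) auto
    then have "Kop (qq 1 (j - 2) (slice f 1)) b a \<in> G (k - 1 - a)" by (rule G_mono[rotated]) simp
    moreover have "x (slice f j b a) \<in> G (k - 1 - a)" using G_x[OF _ G'D[OF f, of j b a]] True by simp
    ultimately show ?thesis using True by (simp add: slice_X' Yp_def)
  next
    case False
    then show ?thesis using G'D[OF f, of 1 b "Suc a"] by (auto simp: slice_X' Lx_def zz_def)
  qed
  then show ?thesis using W'_X[OF G'_W'[OF f]] by (simp add: G'_def)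
qed

lemma G'_C': "f \<in> G' k \<Longrightarrow> C' f \<in> G' k"
proof -
  assume f: "f \<in> G' k"
  have "slice (C' f) j b a \<in> G (k - a)" for j b a
    using W'D(2)[OF G'_W'[OF f], of j] G'D[OF f] G_c[OF _ G'D[OF f, of j b a]]
    by (cases "j = 1"; cases "n = 0"; cases "j = 0") (auto simp: slice_C' Lc_def Ct_def G_se zz_def)
  then show ?thesis using W'_C[OF G'_W'[OF f]] by (simp add: G'_def)
qed

lemma G'_S': "1 \<le> i \<Longrightarrow> i < Suc n \<Longrightarrow> f \<in> G' k \<Longrightarrow> S' i f \<in> G' k"
proof -
  assume i: "1 \<le> i" "i < Suc n" and f: "f \<in> G' k"
  have "slice (S' i f) j b a \<in> G (k - a)" for j b a
  proof -
    consider "j = i" | "j = Suc i" | "j = 0" | "0 < j" "j < i" | "Suc i < j" "j \<le> Suc n" | "Suc n < j" by linarith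
    then show ?thesis using W'D(2)[OF G'_W'[OF f], of j] G'D[OF f] i by cases (auto simp: slice_S' Sp_def zz_def G_s)
  qed
  then show ?thesis using W'_S[OF G'_W'[OF f]] i by (simp add: G'_def)
qed

lemma subsp_G': "subsp (G' k)"
  using subsp_W' by (auto simp: subsp_def G'_def)

lemma om'_G': "om' \<in> G' (Suc n * (degree g - 1))"
proof -
  have "y a \<cdot> om \<in> G (Suc n * (degree g - 1) - a)" for a
  proof (cases "a < degree g - 1")
    case False
    then have "om \<in> G (Suc n * (degree g - 1) - a)" by (intro G_mono[OF _ om_G]) simp
    then show ?thesis by simp
  qed (simp add: y_lt)
  then show ?thesis using om'_W' by (simp add: G'_def slice_om')
qed

text \<open>Evaluation of a coinduced vector at 1, the canonical map to \<open>W\<close>; the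
  following lemmas express that it is equivariant for rank n. For x_1 the correction drops out by
  \<open>K0\<close>, as a = 0 here.\<close>

definition E :: "'v \<Rightarrow> 'v" where "E f = slice f (Suc n) False 0"

lemma E_add: "E (f + h) = E f + E h" by (simp add: E_def)

lemma E_S': "1 \<le> i \<Longrightarrow> i < n \<Longrightarrow> E (S' i f) = s i (E f)"
  by (simp add: E_def slice_S' Sp_def)

lemma E_C': "1 \<le> n \<Longrightarrow> E (C' f) = c (E f)"
  by (simp add: E_def slice_C' Ct_def)

lemma E_X': "1 \<le> n \<Longrightarrow> f \<in> W' \<Longrightarrow> E (X' f) = x (E f)"
  using K0[of "qq 1 (n - 1) (slice f 1)"] W'D(1)[of f 1]
  by (simp add: E_def slice_X' Yp_def numeral_2_eq_2)

lemma E_cs: "1 \<le> i \<Longrightarrow> i \<le> n \<Longrightarrow> f \<in> W' \<Longrightarrow> E (P.cs i f) = cs i (E f)"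
proof (induction i arbitrary: f rule: nat_induct_at_least)
  case (Suc i) then show ?case by (simp add: cs_Suc P.cs_Suc E_S' W'_S)
qed (simp add: cs_1 P.cs_1 E_C')

lemma E_xs: "1 \<le> i \<Longrightarrow> i \<le> n \<Longrightarrow> f \<in> W' \<Longrightarrow> E (P.xs i f) = xs i (E f)"
proof (induction i arbitrary: f rule: nat_induct_at_least)
  case (Suc i) then show ?case by (simp add: xs_Suc P.xs_Suc E_S' W'_S E_cs E_add)
qed (simp add: xs_1 P.xs_1 E_X')

lemma E_actw: "set w \<subseteq> sergeev_letters n \<Longrightarrow> f \<in> W' \<Longrightarrow> E (P.actw w f) = actw w (E f)"
proof (induction w)
  case (Cons l w)
  have "sergeev_letters n \<subseteq> sergeev_letters (Suc n)" by (auto simp: sergeev_letters_def)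
  then have "P.actw w f \<in> W'" using Cons.prems by (intro P.actw_W) auto
  then show ?case using Cons by (auto simp: sergeev_letters_def E_S' E_cs E_xs)
qed simp

lemma G'_cs: "1 \<le> i \<Longrightarrow> i \<le> Suc n \<Longrightarrow> v \<in> G' k \<Longrightarrow> P.cs i v \<in> G' k"
proof (induction i arbitrary: v rule: nat_induct_at_least)
  case (Suc i) then show ?case by (simp add: P.cs_Suc G'_S')
qed (simp add: P.cs_1 G'_C')

lemma slice_cs: "1 \<le> i \<Longrightarrow> slice (P.cs i f) i = Lc (slice f i)"
proof (induction i arbitrary: f rule: nat_induct_at_least)
  case (Suc i) then show ?case by (simp add: P.cs_Suc slice_S')
qed (simp add: P.cs_1 slice_C')

text \<open>In x_i = s_(i-1) ... s_1 x_1 s_1 ... s_(i-1) + (terms without x), the first summand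
  shifts slice i, while the rest preserves the depth.\<close>

lemma slice_xs: "1 \<le> i \<Longrightarrow> i \<le> Suc n \<Longrightarrow> f \<in> G' k \<Longrightarrow> \<exists>h\<in>G' k. slice (P.xs i f) i = pl (Lx (slice f i)) (slice h i)"
proof (induction i arbitrary: f rule: nat_induct_at_least)
  case base
  have "0 \<in> G' k" by (rule subspD[OF subsp_G'])
  moreover have "slice 0 1 = zz" by (auto simp: fun_eq_iff zz_def)
  ultimately show ?case by (intro bexI[of _ 0]) (simp_all add: P.xs_1 slice_X')
next
  case (Suc i)
  have Sf: "S' i f \<in> G' k" using Suc by (intro G'_S') auto
  obtain h where h: "h \<in> G' k" "slice (P.xs i (S' i f)) i = pl (Lx (slice (S' i f) i)) (slice h i)"
    using bexE[OF Suc.IH[OF Suc_leD[OF Suc.prems(1)] Sf]] by metis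
  let ?h = "S' i h + S' i f + P.cs i (S' i (P.cs i f))"
  have "?h \<in> G' k" using Suc h(1) by (intro subspD(2)[OF subsp_G'] G'_S' G'_cs) auto
  moreover have "slice (P.xs (Suc i) f) (Suc i) = pl (Lx (slice f (Suc i))) (slice ?h (Suc i))"
  proof -
    have "slice (S' i f) i = slice f (Suc i)" using Suc.hyps by (simp add: slice_S')
    then show ?thesis using Suc.hyps h(2) by (simp add: P.xs_Suc slice_pl slice_S' fun_eq_iff)
  qed
  ultimately show ?case by blast
qed

lemma G'_mono: "k \<le> m \<Longrightarrow> f \<in> G' m \<Longrightarrow> f \<in> G' k"
proof -
  assume "k \<le> m" and f: "f \<in> G' m"
  then have "slice f j b a \<in> G (k - a)" for j b a by (intro G_mono[OF _ G'D[OF f]]) simp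
  then show ?thesis using f by (simp add: G'_def)
qed

lemma G'_xs: "1 \<le> i \<Longrightarrow> i \<le> Suc n \<Longrightarrow> v \<in> G' k \<Longrightarrow> P.xs i v \<in> G' (k - 1)"
proof (induction i arbitrary: v rule: nat_induct_at_least)
  case (Suc i)
  have m: "w \<in> G' k \<Longrightarrow> w \<in> G' (k - 1)" for w by (rule G'_mono[OF diff_le_self])
  have "S' i v + P.cs i (S' i (P.cs i v)) \<in> G' k"
    using Suc by (intro subspD(2)[OF subsp_G'] G'_S' G'_cs) auto
  then have 1: "S' i v + P.cs i (S' i (P.cs i v)) \<in> G' (k - 1)" by (rule m)
  have "S' i v \<in> G' k" using Suc by (intro G'_S') auto
  then have "P.xs i (S' i v) \<in> G' (k - 1)" using Suc.IH Suc.prems by simp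
  then have 2: "S' i (P.xs i (S' i v)) \<in> G' (k - 1)" using Suc by (intro G'_S') auto
  have "P.xs (Suc i) v = S' i (P.xs i (S' i v)) + (S' i v + P.cs i (S' i (P.cs i v)))"
    using Suc.hyps by (simp add: P.xs_Suc add.assoc)
  with subspD(2)[OF subsp_G' 2 1] show ?case by simp
next
  case base then show ?case using G'_X'[of v k] by (simp add: P.xs_1)
qed

text \<open>Each of the m factors contributes the shift and an error that is one step deeper than
  what a factor x could cost, so the error of the power is one step deeper as well.\<close>

lemma slice_xs_pow:
  assumes i: "1 \<le> i" "i \<le> Suc n" and f: "f \<in> G' k"
  shows "slice ((P.xs i ^^ m) f) i b a - slice f i b (a + m) \<in> G (Suc k - (a + m))"
proof (induction m arbitrary: a)
  case (Suc m)
  have fm: "(P.xs i ^^ m) f \<in> G' (k - m)"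
  proof (induction m)
    case (Suc m) then show ?case using G'_xs[OF i, of "(P.xs i ^^ m) f" "k - m"] by simp
  qed (simp add: f)
  obtain h where h: "h \<in> G' (k - m)" "slice (P.xs i ((P.xs i ^^ m) f)) i = pl (Lx (slice ((P.xs i ^^ m) f) i)) (slice h i)"
    using slice_xs[OF i fm] by blast
  have "slice h i b a \<in> G (k - m - a)" using G'D[OF h(1)] .
  then have 1: "slice h i b a \<in> G (Suc k - (a + Suc m))" by (simp add: add.commute)
  have 2: "slice ((P.xs i ^^ m) f) i b (Suc a) - slice f i b (Suc a + m) \<in> G (Suc k - (a + Suc m))"
    using Suc[of "Suc a"] by simp
  show ?case using subspD(2)[OF G_subsp 2 1] h(2) by (simp add: Lx_def algebra_simps)
qed simp

lemma xcount_xtop: "xcount (xtop e m) = m * e"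
proof (induction m)
  case (Suc m)
  have "xcount (replicate e (X_letter i)) = e" for i by (induction e) auto
  with Suc show ?case by simp
qed simp

text \<open>Write the normal word as w c_(n+1)^b s_n ... s_j with w of rank n. The power
  x_(n+1)^(d-1) commutes with w, and at slice n + 1 it turns the vector into \<open>om\<close> if j
  = n + 1 and b is False, and into 0 otherwise, up to an error too deep to be seen by
  \<open>ev\<close>. The claim for w in rank n finishes the computation.\<close>

lemma ev'_NF:
  assumes z: "z \<in> NF (Suc n)"
  shows "ev' (P.actw (xtop (degree g - 1) (Suc n) @ z) om') = (if z = [] then 1 else 0)"
proof -
  let ?e = "degree g - 1"
  obtain w b j where w: "w \<in> NF n" and j: "1 \<le> j" "j \<le> Suc n"
    and z: "z = w @ (if b then [C_letter (Suc n)] else []) @ map S_letter (rev [j..<Suc n])"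
    using z by auto
  define v0 where "v0 = P.actw (map S_letter (rev [j..<Suc n])) om'"
  define v where "v = (if b then P.cs (Suc n) v0 else v0)"
  \<comment> \<open>Applying s_j, then s_(j+1), up to s_n transports slice j of \<open>om'\<close>
    to slice n + 1.\<close>
  have "P.actw (map S_letter (rev [j..<i])) om' \<in> G' (Suc n * ?e) \<and>
      slice (P.actw (map S_letter (rev [j..<i])) om') i = slice om' j" if "j \<le> i" "i \<le> Suc n" for i
    using that
  proof (induction i rule: dec_induct)
    case (step i)
    then have "[j..<Suc i] = [j..<i] @ [i]" by simp
    then show ?case using step j by (auto simp: slice_S' intro!: G'_S')
  qed (use om'_G' in simp)
  from this[OF j(2)] have v0: "v0 \<in> G' (Suc n * ?e)" "slice v0 (Suc n) = slice om' j" by (auto simp: v0_def)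
  have v: "v \<in> G' (Suc n * ?e)" using v0(1) by (auto simp: v_def intro!: G'_cs)
  \<comment> \<open>A letter c_(n+1) moves the False slot of \<open>om'\<close> to the True slot, so
    the slot read here is then 0; otherwise y(d-1) = 1 leaves \<open>om\<close>.\<close>
  have vs: "slice v (Suc n) False ?e = (if j = Suc n \<and> \<not> b then om else 0)"
    using v0(2) by (auto simp: v_def slice_cs Lc_def slice_om' y_eq[unfolded One_nat_def])
  define r where "r = slice ((P.xs (Suc n) ^^ ?e) v) (Suc n) False 0 - slice v (Suc n) False ?e"
  have r: "r \<in> G (Suc (n * ?e))"
    using slice_xs_pow[OF _ _ v, of "Suc n" ?e False 0] by (simp add: r_def Suc_diff_le)
  have wl: "set w \<subseteq> Y_letters n" by (rule NF_letters[OF w])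
  have comm1: "(P.xs (Suc n) ^^ m) (P.act1 l f) = P.act1 l ((P.xs (Suc n) ^^ m) f)"
    if "l \<in> Y_letters n" "f \<in> W'" for l m f
  proof (induction m)
    case (Suc m)
    have "(P.xs (Suc n) ^^ m) f \<in> W'" using that(2) by (induction m) auto
    then show ?case using that(1) Suc by (auto simp: Y_letters_def P.s_xs_far P.xs_cs_ne)
  qed simp
  have YL: "Y_letters n \<subseteq> sergeev_letters n" "sergeev_letters n \<subseteq> sergeev_letters (Suc n)"
    by (auto simp: Y_letters_def sergeev_letters_def)
  have comm: "(P.xs (Suc n) ^^ m) (P.actw w f) = P.actw w ((P.xs (Suc n) ^^ m) f)" if "f \<in> W'" for m f
    using wl
  proof (induction w)
    case (Cons l w)
    have "P.actw w f \<in> W'" using Cons.prems that YL by (intro P.actw_W) auto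
    then show ?case using Cons comm1 by simp
  qed simp
  have vW: "v \<in> W'" by (rule G'_W'[OF v])
  have "(P.xs (Suc n) ^^ m) v \<in> W'" for m using vW by (induction m) auto
  note xvW = this[of ?e]
  have xt: "set (xtop e m) \<subseteq> sergeev_letters m" for e m
    by (induction m) (auto simp: sergeev_letters_def)
  have "P.actw (xtop ?e (Suc n) @ z) om' = P.actw (xtop ?e n) ((P.xs (Suc n) ^^ ?e) (P.actw w v))"
    by (simp add: z v_def v0_def P.actw_replicate)
  also have "\<dots> = P.actw (xtop ?e n @ w) ((P.xs (Suc n) ^^ ?e) v)" using comm vW by simp
  finally have "ev' (P.actw (xtop ?e (Suc n) @ z) om') = ev (E (P.actw (xtop ?e n @ w) ((P.xs (Suc n) ^^ ?e) v)))"
    by (simp add: ev'_def E_def)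
  also have "E (P.actw (xtop ?e n @ w) ((P.xs (Suc n) ^^ ?e) v)) = actw (xtop ?e n @ w) (E ((P.xs (Suc n) ^^ ?e) v))"
    using xvW xt[of ?e n] wl YL by (intro E_actw) auto
  also have "E ((P.xs (Suc n) ^^ ?e) v) = (if j = Suc n \<and> \<not> b then om else 0) + r"
    unfolding E_def r_def vs by simp
  also have "actw (xtop ?e n @ w) \<dots> = actw (xtop ?e n @ w) (if j = Suc n \<and> \<not> b then om else 0) + actw (xtop ?e n @ w) r"
    by (rule lin_add[OF lin_actw])
  \<comment> \<open>The word has exactly n(d-1) letters x while r has depth n(d-1) + 1, so the image
    of r still has depth 1 and \<open>ev\<close> kills it.\<close>
  also have "ev \<dots> = ev (actw (xtop ?e n @ w) (if j = Suc n \<and> \<not> b then om else 0))"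
  proof -
    have "xcount w = 0" using wl by (induction w) (auto simp: Y_letters_def)
    then have "actw (xtop ?e n @ w) r \<in> G (Suc (n * ?e) - n * ?e)"
      using G_actw[of "xtop ?e n @ w" r "Suc (n * ?e)"] r xt[of ?e n] wl YL by (auto simp: xcount_xtop)
    then show ?thesis using ev_G[of _ 0] by (simp add: ev_add Suc_diff_le)
  qed
  also have "\<dots> = (if z = [] then 1 else 0)"
    using ev_NF[OF w] lin_zero[OF lin_actw] j by (auto simp: z)
  finally show ?thesis .
qed

theorem sergeev_rep_step: "sergeev_rep scale g (Suc n) W' X' C' S' par' G' om' ev'"
proof (unfold_locales, goal_cases)
  case 1 show ?case by (rule lin_par')
next
  case 2 then show ?case by (rule par'_W')
next
  case 3 show ?case by (rule par'_X')
next
  case 4 show ?case by (rule par'_C')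
next
  case 5 show ?case by (rule par'_S')
next
  case 6 show ?case by (rule eqI3) (auto simp: slice_par' slice_om' par_om)
next
  case 7 show ?case by (simp add: ev'_def slice_par' ev_par)
next
  case 8 show ?case by (simp add: ev'_def ev_add)
next
  case 9 show ?case by (simp add: ev'_def ev_scale)
next
  case 10
  have "slice f j b a \<in> W" if "f \<in> W'" for f j b a using W'D(1)[OF that] by simp
  then show ?case by (auto simp: G'_def G_0)
next
  case 11 show ?case by (rule subsp_G')
next
  case 12 show ?case using G'_mono[OF le_SucI[OF order_refl]] by blast
next
  case 13 then show ?case by (intro G'_X')
next
  case 14 then show ?case by (intro G'_C')
next
  case 15 then show ?case by (intro G'_S')
next
  case 16 then show ?case using G'D[OF 16, of "Suc n" False 0] ev_G by (simp add: ev'_def)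
next
  case 17 show ?case by (rule om'_G')
next
  case 18 then show ?case by (rule ev'_NF)
qed

end

section \<open>Existence of the representation, by induction on n\<close>

text \<open>The leading coefficient is 1, so the recurrence can be solved forwards from the initial
  values 0, ..., 0, 1.\<close>

lemma fundamental_solution:
  fixes g :: "'r::comm_ring_1 poly"
  assumes "degree g \<ge> 1" "lead_coeff g = 1"
  obtains y :: "nat \<Rightarrow> 'r" where "\<And>a. a < degree g - 1 \<Longrightarrow> y a = 0" "y (degree g - 1) = 1"
    "\<And>a. (\<Sum>m\<le>degree g. coeff g m * y (a + m)) = 0"
proof -
  let ?d = "degree g"
  define y where "y = wfrec (measure id) (\<lambda>y a. if a < ?d then if a = ?d - 1 then 1 else 0
      else - (\<Sum>m<?d. coeff g m * y (a - ?d + m)))"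
  have y: "y a = (if a < ?d then if a = ?d - 1 then 1 else 0 else - (\<Sum>m<?d. coeff g m * y (a - ?d + m)))" for a
    unfolding y_def by (subst wfrec, simp) (auto simp: cut_def intro!: sum.cong)
  have "y a = 0" if "a < ?d - 1" for a using y[of a] that by auto
  moreover have "y (?d - 1) = 1" using y[of "?d - 1"] assms by simp
  moreover have "(\<Sum>m\<le>?d. coeff g m * y (a + m)) = 0" for a
    using y[of "a + ?d"] assms by (simp add: lessThan_Suc_atMost[symmetric])
  ultimately show thesis by (rule that)
qed

text \<open>Functions on infinite streams of indices (j, b, a). Fixing the head of the stream
  identifies this space with families of elements of itself, so one type hosts all iterated
  coinduced modules.\<close>

type_synonym 'r stream_space = "(nat \<Rightarrow> nat \<times> bool \<times> nat) \<Rightarrow> 'r"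

definition pointwise_scale :: "'r::comm_ring_1 \<Rightarrow> 'r stream_space \<Rightarrow> 'r stream_space" where
  "pointwise_scale r v = (\<lambda>\<sigma>. r * v \<sigma>)"

lemma stream_space_slices:
  obtains slice :: "'r::comm_ring_1 stream_space \<Rightarrow> nat \<Rightarrow> bool \<Rightarrow> nat \<Rightarrow> 'r stream_space" and build
  where "\<And>F. slice (build F) = F" "\<And>f. build (slice f) = f"
    "\<And>f h j b a. slice (f + h) j b a = slice f j b a + slice h j b a"
    "\<And>r f j b a. slice (pointwise_scale r f) j b a = pointwise_scale r (slice f j b a)"
proof -
  define slice where "slice f j b a \<sigma> = f (case_nat (j, b, a) \<sigma>)" for f :: "'r stream_space" and j b a \<sigma>
  define build where "build F \<sigma> = (case \<sigma> 0 of (j, b, a) \<Rightarrow> F j b a (\<lambda>i. \<sigma> (Suc i)))"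
    for F :: "nat \<Rightarrow> bool \<Rightarrow> nat \<Rightarrow> 'r stream_space" and \<sigma>
  have *: "case_nat (\<sigma> 0) (\<lambda>i. \<sigma> (Suc i)) = \<sigma>" for \<sigma> :: "nat \<Rightarrow> nat \<times> bool \<times> nat"
    by (auto simp: fun_eq_iff split: nat.split)
  show thesis
  proof (rule that[of slice build])
    show "slice (build F) = F" for F by (intro ext) (simp add: slice_def build_def)
    show "build (slice f) = f" for f by (rule ext) (auto simp: slice_def build_def * split: prod.split)
  qed (auto simp: slice_def pointwise_scale_def fun_eq_iff)
qed

text \<open>Coinduction is iterated from rank 0, each time with the fundamental solution as the
  functional on the powers of x_1.\<close>

theorem sergeev_rep_exists:
  fixes g :: "'r::comm_ring_1 poly"
  assumes "degree g \<ge> 1" "lead_coeff g = 1" and par: "\<And>m. coeff g m \<noteq> 0 \<Longrightarrow> even m = even (degree g)"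
  shows "\<exists>(W :: 'r stream_space set) x c s par G om ev. sergeev_rep pointwise_scale g n W x c s par G om ev"
proof (induction n)
  case 0
  \<comment> \<open>In rank 0 there are no generators: the operators are zero, \<open>om\<close> is
    the constant function 1, and \<open>ev\<close> evaluates at one fixed stream, so
    \<open>ev om\<close> is 1. Positive depth consists of 0 alone.\<close>
  have "sergeev_rep pointwise_scale g 0 UNIV (\<lambda>v. 0) (\<lambda>v. 0) (\<lambda>i v. 0) (\<lambda>v. v)
      (\<lambda>k. if k = 0 then UNIV else {0}) (\<lambda>\<sigma>. 1) (\<lambda>v. v (\<lambda>i. (0, False, 0)))"
  proof -
    interpret scaled "pointwise_scale :: 'r \<Rightarrow> 'r stream_space \<Rightarrow> 'r stream_space"
    proof (unfold_locales, goal_cases)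
      case (1 r u v) show ?case by (rule ext) (simp add: pointwise_scale_def distrib_left)
    next
      case (2 r q v) show ?case by (rule ext) (simp add: pointwise_scale_def distrib_right)
    next
      case (3 r q v) show ?case by (rule ext) (simp add: pointwise_scale_def mult.assoc)
    next
      case (4 v) show ?case by (rule ext) (simp add: pointwise_scale_def)
    qed
    have z: "pointwise_scale r (0 :: 'r stream_space) = 0" for r by (rule ext) (simp add: pointwise_scale_def)
    have "lin (\<lambda>v. 0)" unfolding lin_def by (simp only: z add_0_left) simp
    moreover have U: "subsp UNIV" by (simp add: subsp_def)
    ultimately have ss: "small_sergeev pointwise_scale g 0 UNIV (\<lambda>v. 0) (\<lambda>v. 0) (\<lambda>i v. 0)"
      using par by unfold_locales simp_all
    have Z: "subsp {0 :: 'r stream_space}" unfolding subsp_def using z by auto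
    show ?thesis
    proof (intro sergeev_rep.intro sergeev_rep_axioms.intro ss, goal_cases)
      case 1 show ?case by (rule lin_id)
    next
      case (11 k) show ?case using U Z by simp
    next
      case (18 y) then show ?case using small_sergeev.actw_simps(1)[OF ss] by simp
    qed (simp_all add: pointwise_scale_def split: if_splits)
  qed
  then show ?case by blast
next
  case (Suc n)
  then obtain W :: "'r stream_space set" and x c s par G om ev
    where rep: "sergeev_rep pointwise_scale g n W x c s par G om ev" by blast
  obtain y :: "nat \<Rightarrow> 'r" where y: "\<And>a. a < degree g - 1 \<Longrightarrow> y a = 0" "y (degree g - 1) = 1"
    "\<And>a. (\<Sum>m\<le>degree g. coeff g m * y (a + m)) = 0"
    using fundamental_solution[OF assms(1,2)] by blast
  obtain slice :: "'r stream_space \<Rightarrow> nat \<Rightarrow> bool \<Rightarrow> nat \<Rightarrow> 'r stream_space" and build where sb: "\<And>F. slice (build F) = F" "\<And>f. build (slice f) = f"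
    "\<And>f h j b a. slice (f + h) j b a = slice f j b a + slice h j b a"
    "\<And>r (f :: 'r stream_space) j b a. slice (pointwise_scale r f) j b a = pointwise_scale r (slice f j b a)"
  proof (rule stream_space_slices[where 'r = 'r], goal_cases)
    case (1 slice build) show ?case by (rule 1(1)[of slice build]) (rule 1(2-))+
  qed
  have "sergeev_rep_step pointwise_scale g n W x c s par G om ev slice build y"
  proof (intro sergeev_rep_step.intro sergeev_step.intro sergeev_step_axioms.intro sergeev_rep_step_axioms.intro, goal_cases)
    case 1 show ?case by (fact rep)
  next
    case 2 show ?case by (fact sergeev_rep.axioms(1)[OF rep])
  next
    case 3 show ?case by (fact sb(1))
  next
    case 4 show ?case by (fact sb(2))
  next
    case 5 show ?case by (fact sb(3))
  next
    case 6 show ?case by (fact sb(4))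
  next
    case 7 show ?case by (fact assms(1))
  next
    case 8 then show ?case by (fact y(1))
  next
    case 9 show ?case by (fact y(2))
  next
    case 10 show ?case by (fact y(3))
  qed
  from sergeev_rep_step.sergeev_rep_step[OF this]
  obtain W' :: "'r stream_space set" and x' c' s' par' G' om' ev'
    where "sergeev_rep pointwise_scale g (Suc n) W' x' c' s' par' G' om' ev'" by (rule that)
  then show ?case by blast
qed

section \<open>Words, constants and graded pieces of the free algebra\<close>

definition mon :: "sergeev_letter list \<Rightarrow> 'r::comm_ring_1 sergeev_free" where
  "mon w = Poly_Mapping.single (Word w) 1"

definition cst :: "'r::comm_ring_1 \<Rightarrow> 'r sergeev_free" where "cst r = Poly_Mapping.single 0 r"

definition Fsub :: "nat \<Rightarrow> 'r::comm_ring_1 sergeev_free set" where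
  "Fsub n = {f. \<forall>w\<in>Poly_Mapping.keys f. set (letters w) \<subseteq> sergeev_letters n}"

lemma mon_append: "mon (u @ v) = mon u * mon v"
  by (simp add: mon_def mult_single plus_free_monoid_def)

lemma mon_Nil [simp]: "mon [] = 1"
  by (simp add: mon_def zero_free_monoid_def[symmetric])

lemma generator_mon: "generator l = mon [l]" by (simp add: generator_def mon_def)

lemma cst_simps [simp]: "cst 0 = 0" "cst 1 = 1" "cst (r + q) = cst r + cst q" "cst (r * q) = cst r * cst q"
  "cst (- r) = - cst r"
  by (simp_all add: cst_def single_add mult_single single_uminus)

lemma single_Word: "Poly_Mapping.single (Word w) r = cst r * mon w"
  by (simp add: cst_def mon_def mult_single)

lemma poly_mapping_expand: "f = (\<Sum>w\<in>Poly_Mapping.keys f. cst (Poly_Mapping.lookup f w) * mon (letters w))"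
proof -
  have "f = (\<Sum>w\<in>Poly_Mapping.keys f. Poly_Mapping.single w (Poly_Mapping.lookup f w))"
    by (rule poly_mapping_eqI) (simp add: lookup_sum lookup_single when_def in_keys_iff)
  then show ?thesis by (simp add: single_Word[symmetric])
qed

lemma cst_comm: "cst r * f = f * cst r"
proof -
  have *: "cst r * (cst q * mon w) = (cst q * mon w) * cst r" for q w
    by (simp add: cst_def mon_def mult_single mult.commute)
  have "cst r * (\<Sum>w\<in>Poly_Mapping.keys f. cst (Poly_Mapping.lookup f w) * mon (letters w)) =
      (\<Sum>w\<in>Poly_Mapping.keys f. cst (Poly_Mapping.lookup f w) * mon (letters w)) * cst r"
    by (simp only: sum_distrib_left sum_distrib_right *)
  then show ?thesis using poly_mapping_expand[of f] by simp
qed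

lemma Fsub_cl [simp]:
  "0 \<in> Fsub n" "f \<in> Fsub n \<Longrightarrow> h \<in> Fsub n \<Longrightarrow> f + h \<in> Fsub n" "f \<in> Fsub n \<Longrightarrow> - f \<in> Fsub n"
  "f \<in> Fsub n \<Longrightarrow> h \<in> Fsub n \<Longrightarrow> f - h \<in> Fsub n"
  "f \<in> Fsub n \<Longrightarrow> h \<in> Fsub n \<Longrightarrow> f * h \<in> Fsub n" "cst r \<in> Fsub n" "1 \<in> Fsub n"
proof -
  show add: "f \<in> Fsub n \<Longrightarrow> h \<in> Fsub n \<Longrightarrow> f + h \<in> Fsub n" for f h
    using keys_add[of f h] by (auto simp: Fsub_def)
  show neg: "f \<in> Fsub n \<Longrightarrow> - f \<in> Fsub n" for f by (simp add: Fsub_def)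
  show "f \<in> Fsub n \<Longrightarrow> h \<in> Fsub n \<Longrightarrow> f - h \<in> Fsub n"
    using add[of f "- h"] neg[of h] by simp
  show "f \<in> Fsub n \<Longrightarrow> h \<in> Fsub n \<Longrightarrow> f * h \<in> Fsub n"
    using keys_mult[of f h] by (fastforce simp: Fsub_def plus_free_monoid_def)
  show c: "cst r \<in> Fsub n" for r
    by (auto simp: Fsub_def cst_def zero_free_monoid_def split: if_splits)
  from c[of 0] c[of 1] show "0 \<in> Fsub n" "1 \<in> Fsub n" by simp_all
qed

lemma Fsub_mon [simp]: "set w \<subseteq> sergeev_letters n \<Longrightarrow> mon w \<in> Fsub n"
  by (auto simp: Fsub_def mon_def split: if_splits)

text \<open>The subalgebra on the letters of rank n is the linear span of its words.\<close>

lemma Fsub_induct [consumes 1, case_names zero mon add scale]: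
  assumes f: "f \<in> Fsub n" and "P 0" and "\<And>w. set w \<subseteq> sergeev_letters n \<Longrightarrow> P (mon w)"
    and "\<And>f h. f \<in> Fsub n \<Longrightarrow> h \<in> Fsub n \<Longrightarrow> P f \<Longrightarrow> P h \<Longrightarrow> P (f + h)" and "\<And>r f. f \<in> Fsub n \<Longrightarrow> P f \<Longrightarrow> P (cst r * f)"
  shows "P f"
proof -
  have m: "cst (Poly_Mapping.lookup f w) * mon (letters w) \<in> Fsub n \<and> P (cst (Poly_Mapping.lookup f w) * mon (letters w))" if "w \<in> Poly_Mapping.keys f" for w
  proof -
    have w: "set (letters w) \<subseteq> sergeev_letters n" using that f unfolding Fsub_def by blast
    show ?thesis using Fsub_mon[OF w] assms(5)[OF Fsub_mon[OF w] assms(3)[OF w]] by (intro conjI Fsub_cl(5,6))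
  qed
  have "(\<Sum>w\<in>K. cst (Poly_Mapping.lookup f w) * mon (letters w)) \<in> Fsub n \<and> P (\<Sum>w\<in>K. cst (Poly_Mapping.lookup f w) * mon (letters w))"
    if "finite K" "K \<subseteq> Poly_Mapping.keys f" for K
    using that
  proof (induction K rule: finite_induct)
    case empty then show ?case using assms(2) by simp
  next
    case (insert w K)
    then have "w \<in> Poly_Mapping.keys f" and K: "K \<subseteq> Poly_Mapping.keys f" by auto
    note mw = m[OF this(1)] and IH = insert.IH[OF K]
    show ?case unfolding sum.insert[OF insert.hyps]
      using Fsub_cl(2)[OF mw[THEN conjunct1] IH[THEN conjunct1]]
        assms(4)[OF mw[THEN conjunct1] IH[THEN conjunct1] mw[THEN conjunct2] IH[THEN conjunct2]] by (rule conjI)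
  qed
  from this[of "Poly_Mapping.keys f"] show ?thesis using poly_mapping_expand[of f] by simp
qed

section \<open>Computing modulo the relations: the letters s and c\<close>

text \<open>\<open>J\<close> is any two-sided ideal of the free algebra on the letters of rank n
  containing the relations and g(x_1); congruence modulo \<open>J\<close> replaces equality in the
  quotient, so that all computations are with words.\<close>

locale sergeev_ideal =
  fixes n d :: nat and g :: "'r::idom poly" and J :: "'r sergeev_free set"
  assumes n1: "n \<ge> 1" and d1: "d \<ge> 1" and deg: "degree g = d" and lead: "coeff g d = 1"
    and par: "coeff g m \<noteq> 0 \<Longrightarrow> even m = even d"
    and J_0: "0 \<in> J" and J_add: "a \<in> J \<Longrightarrow> b \<in> J \<Longrightarrow> a + b \<in> J"
    and J_left: "a \<in> Fsub n \<Longrightarrow> f \<in> J \<Longrightarrow> a * f \<in> J" and J_right: "a \<in> Fsub n \<Longrightarrow> f \<in> J \<Longrightarrow> f * a \<in> J"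
    and J_rel: "sergeev_rel n u v \<Longrightarrow> u - v \<in> J"
    and J_g: "(\<Sum>i\<le>d. cst (coeff g i) * mon (replicate i (X_letter 1))) \<in> J"
begin

abbreviation "L \<equiv> sergeev_letters n"
abbreviation "Yl \<equiv> Y_letters n"

lemma YL: "Y_letters n \<subseteq> L" by (auto simp: Y_letters_def sergeev_letters_def)

lemma J_minus: "a \<in> J \<Longrightarrow> - a \<in> J" using J_left[of "- 1" a] by simp

lemma J_diff: "a \<in> J \<Longrightarrow> b \<in> J \<Longrightarrow> a - b \<in> J" using J_add[of a "- b"] J_minus[of b] by simp

definition eqv :: "'r sergeev_free \<Rightarrow> 'r sergeev_free \<Rightarrow> bool" (infix "\<asymp>" 50) where
  "a \<asymp> b \<longleftrightarrow> a - b \<in> J"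

lemma eqv_refl [simp]: "a \<asymp> a" by (simp add: eqv_def J_0)
lemma eqv_sym: "a \<asymp> b \<Longrightarrow> b \<asymp> a" using J_minus[of "a - b"] by (simp add: eqv_def)
lemma eqv_trans [trans]: "a \<asymp> b \<Longrightarrow> b \<asymp> c \<Longrightarrow> a \<asymp> c" using J_add[of "a - b" "b - c"] by (simp add: eqv_def)
lemma eqv_eq_trans [trans]: "a \<asymp> b \<Longrightarrow> b = c \<Longrightarrow> a \<asymp> c" "a = b \<Longrightarrow> b \<asymp> c \<Longrightarrow> a \<asymp> c" by simp_all
lemma eqv_add: "a \<asymp> b \<Longrightarrow> a' \<asymp> b' \<Longrightarrow> a + a' \<asymp> b + b'"
  using J_add[of "a - b" "a' - b'"] by (simp add: eqv_def algebra_simps)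
lemma eqv_minus: "a \<asymp> b \<Longrightarrow> - a \<asymp> - b" using J_minus[of "a - b"] by (simp add: eqv_def)
lemma eqv_diff: "a \<asymp> b \<Longrightarrow> a' \<asymp> b' \<Longrightarrow> a - a' \<asymp> b - b'"
  using eqv_add[OF _ eqv_minus, of a b a' b'] by simp
lemma eqv_left: "c \<in> Fsub n \<Longrightarrow> a \<asymp> b \<Longrightarrow> c * a \<asymp> c * b"
  using J_left[of c "a - b"] by (simp add: eqv_def algebra_simps)
lemma eqv_right: "c \<in> Fsub n \<Longrightarrow> a \<asymp> b \<Longrightarrow> a * c \<asymp> b * c"
  using J_right[of c "a - b"] by (simp add: eqv_def algebra_simps)
lemma eqv_scale: "a \<asymp> b \<Longrightarrow> cst r * a \<asymp> cst r * b" by (rule eqv_left) auto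

lemma eqv_ctx: "mon u \<asymp> mon v \<Longrightarrow> set p \<subseteq> L \<Longrightarrow> set q \<subseteq> L \<Longrightarrow> mon (p @ u @ q) \<asymp> mon (p @ v @ q)"
  unfolding mon_append by (intro eqv_left eqv_right) auto

text \<open>Words in s and c multiply like a group up to sign. Signs are suppressed as long as only
  the class of a word matters.\<close>

definition pm :: "'r sergeev_free \<Rightarrow> 'r sergeev_free \<Rightarrow> bool" where "pm a b \<longleftrightarrow> a \<asymp> b \<or> a \<asymp> - b"

lemma pm_eqv: "a \<asymp> b \<Longrightarrow> pm a b" and pm_neg: "a \<asymp> - b \<Longrightarrow> pm a b" and pm_refl [simp]: "pm a a"
  by (auto simp: pm_def)
lemma pm_sym: "pm a b \<Longrightarrow> pm b a"
  unfolding pm_def using eqv_sym[of a b] eqv_sym[of "- a" b] eqv_minus[of a "- b"] by auto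
lemma pm_trans [trans]: "pm a b \<Longrightarrow> pm b c \<Longrightarrow> pm a c"
  unfolding pm_def using eqv_trans[of a b c] eqv_trans[of a b "- c"] eqv_trans[of a "- b" c] eqv_trans[of a "- b" "- c"] eqv_minus[of b c] eqv_minus[of b "- c"] by auto
lemma pm_eqv_trans [trans]: "pm a b \<Longrightarrow> b \<asymp> c \<Longrightarrow> pm a c" "a \<asymp> b \<Longrightarrow> pm b c \<Longrightarrow> pm a c"
  using pm_trans pm_eqv by blast+
lemma pm_left: "c \<in> Fsub n \<Longrightarrow> pm a b \<Longrightarrow> pm (c * a) (c * b)"
  unfolding pm_def using eqv_left[of c a b] eqv_left[of c a "- b"] by auto
lemma pm_right: "c \<in> Fsub n \<Longrightarrow> pm a b \<Longrightarrow> pm (a * c) (b * c)"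
  unfolding pm_def using eqv_right[of c a b] eqv_right[of c a "- b"] by auto
lemma pm_ctx: "pm (mon u) (mon v) \<Longrightarrow> set p \<subseteq> L \<Longrightarrow> set q \<subseteq> L \<Longrightarrow> pm (mon (p @ u @ q)) (mon (p @ v @ q))"
  unfolding mon_append by (intro pm_left pm_right) auto

lemma rel_eqv: "sergeev_rel n u v \<Longrightarrow> u \<asymp> v" using J_rel by (simp add: eqv_def)

lemma SS: "1 \<le> i \<Longrightarrow> i < n \<Longrightarrow> mon [S_letter i, S_letter i] \<asymp> 1"
  using rel_eqv[OF sergeev_rel.intros(1)[of i n]] by (simp add: generator_mon flip: mon_append)
lemma S_far: "1 \<le> i \<Longrightarrow> i < n \<Longrightarrow> 1 \<le> j \<Longrightarrow> j < n \<Longrightarrow> i + 1 < j \<or> j + 1 < i \<Longrightarrow> mon [S_letter i, S_letter j] \<asymp> mon [S_letter j, S_letter i]"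
  using rel_eqv[OF sergeev_rel.intros(2)[of i n j]] by (simp add: generator_mon flip: mon_append) linarith
lemma S_braid: "1 \<le> i \<Longrightarrow> i + 1 < n \<Longrightarrow> mon [S_letter i, S_letter (Suc i), S_letter i] \<asymp> mon [S_letter (Suc i), S_letter i, S_letter (Suc i)]"
  using rel_eqv[OF sergeev_rel.intros(3)[of i n]] by (simp add: generator_mon flip: mon_append)
lemma XX: "1 \<le> i \<Longrightarrow> i \<le> n \<Longrightarrow> 1 \<le> j \<Longrightarrow> j \<le> n \<Longrightarrow> mon [X_letter i, X_letter j] \<asymp> mon [X_letter j, X_letter i]"
  using rel_eqv[OF sergeev_rel.intros(4)[of i n j]] by (simp add: generator_mon flip: mon_append)
lemma CC: "1 \<le> i \<Longrightarrow> i \<le> n \<Longrightarrow> mon [C_letter i, C_letter i] \<asymp> 1"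
  using rel_eqv[OF sergeev_rel.intros(5)[of i n]] by (simp add: generator_mon flip: mon_append)
lemma C_anti: "1 \<le> i \<Longrightarrow> i \<le> n \<Longrightarrow> 1 \<le> j \<Longrightarrow> j \<le> n \<Longrightarrow> i \<noteq> j \<Longrightarrow> mon [C_letter i, C_letter j] \<asymp> - mon [C_letter j, C_letter i]"
  using rel_eqv[OF sergeev_rel.intros(6)[of i n j]] by (simp add: generator_mon flip: mon_append)
lemma SX: "1 \<le> i \<Longrightarrow> i < n \<Longrightarrow> mon [S_letter i, X_letter i] \<asymp> mon [X_letter (Suc i), S_letter i] - 1 - mon [C_letter i, C_letter (Suc i)]"
  using rel_eqv[OF sergeev_rel.intros(7)[of i n]] by (simp add: generator_mon diff_diff_eq flip: mon_append)
lemma SX_far: "1 \<le> i \<Longrightarrow> i < n \<Longrightarrow> 1 \<le> j \<Longrightarrow> j \<le> n \<Longrightarrow> j \<noteq> i \<Longrightarrow> j \<noteq> i + 1 \<Longrightarrow> mon [S_letter i, X_letter j] \<asymp> mon [X_letter j, S_letter i]"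
  using rel_eqv[OF sergeev_rel.intros(8)[of i n j]] by (simp add: generator_mon flip: mon_append)
lemma SC: "1 \<le> i \<Longrightarrow> i < n \<Longrightarrow> mon [S_letter i, C_letter i] \<asymp> mon [C_letter (Suc i), S_letter i]"
  using rel_eqv[OF sergeev_rel.intros(9)[of i n]] by (simp add: generator_mon flip: mon_append)
lemma SC': "1 \<le> i \<Longrightarrow> i < n \<Longrightarrow> mon [S_letter i, C_letter (Suc i)] \<asymp> mon [C_letter i, S_letter i]"
  using rel_eqv[OF sergeev_rel.intros(10)[of i n]] by (simp add: generator_mon flip: mon_append)
lemma SC_far: "1 \<le> i \<Longrightarrow> i < n \<Longrightarrow> 1 \<le> j \<Longrightarrow> j \<le> n \<Longrightarrow> j \<noteq> i \<Longrightarrow> j \<noteq> i + 1 \<Longrightarrow> mon [S_letter i, C_letter j] \<asymp> mon [C_letter j, S_letter i]"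
  using rel_eqv[OF sergeev_rel.intros(11)[of i n j]] by (simp add: generator_mon flip: mon_append)
lemma XC: "1 \<le> i \<Longrightarrow> i \<le> n \<Longrightarrow> mon [X_letter i, C_letter i] \<asymp> - mon [C_letter i, X_letter i]"
  using rel_eqv[OF sergeev_rel.intros(12)[of i n]] by (simp add: generator_mon flip: mon_append)
lemma XC_far: "1 \<le> i \<Longrightarrow> i \<le> n \<Longrightarrow> 1 \<le> j \<Longrightarrow> j \<le> n \<Longrightarrow> i \<noteq> j \<Longrightarrow> mon [X_letter i, C_letter j] \<asymp> mon [C_letter j, X_letter i]"
  using rel_eqv[OF sergeev_rel.intros(13)[of i n j]] by (simp add: generator_mon flip: mon_append)

lemma L_simps [simp]: "S_letter i \<in> sergeev_letters m \<longleftrightarrow> 1 \<le> i \<and> i < m" "X_letter i \<in> sergeev_letters m \<longleftrightarrow> 1 \<le> i \<and> i \<le> m"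
   "C_letter i \<in> sergeev_letters m \<longleftrightarrow> 1 \<le> i \<and> i \<le> m"
  by (auto simp: sergeev_letters_def)

lemma Y_simps [simp]: "S_letter i \<in> Y_letters m \<longleftrightarrow> 1 \<le> i \<and> i < m" "X_letter i \<notin> Y_letters m"
   "C_letter i \<in> Y_letters m \<longleftrightarrow> 1 \<le> i \<and> i \<le> m"
  by (auto simp: Y_letters_def)

lemma Y_cases: assumes "l \<in> Y_letters m" obtains i where "l = S_letter i" "1 \<le> i" "i < m" | i where "l = C_letter i" "1 \<le> i" "i \<le> m"
  using assms by (cases l) auto

lemma comm_word:
  assumes "set u \<subseteq> L" "l \<in> L" "\<And>k. k \<in> set u \<Longrightarrow> mon [k, l] \<asymp> mon [l, k]"
  shows "mon (u @ [l]) \<asymp> mon (l # u)"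
  using assms
proof (induction u)
  case (Cons k u)
  have "mon ([k] @ (u @ [l])) \<asymp> mon ([k] @ (l # u))"
    unfolding mon_append[of "[k]"] using Cons by (intro eqv_left) auto
  also have "mon ([k] @ (l # u)) = mon ([] @ [k, l] @ u)" by simp
  also have "\<dots> \<asymp> mon ([] @ [l, k] @ u)" using Cons by (intro eqv_ctx) auto
  finally show ?case by simp
qed simp

abbreviation sd :: "nat \<Rightarrow> nat \<Rightarrow> sergeev_letter list" where "sd m j \<equiv> map S_letter (rev [j..<Suc m])"

lemma sd_split: "j \<le> m \<Longrightarrow> sd m j = sd m (Suc j) @ [S_letter j]"
  using upt_rec[of j "Suc m"] by simp

lemma sd_split2: "j \<le> k \<Longrightarrow> k \<le> Suc m \<Longrightarrow> sd m j = sd m k @ map S_letter (rev [j..<k])"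
proof -
  assume "j \<le> k" "k \<le> Suc m"
  then have "[j..<Suc m] = [j..<k] @ [k..<Suc m]" using upt_add_eq_append[of j k "Suc m - k"] by simp
  then show ?thesis by simp
qed

lemma sd_L: "1 \<le> j \<Longrightarrow> m < n \<Longrightarrow> set (sd m j) \<subseteq> L" by auto

text \<open>The descending product s_m ... s_j is a cycle, so it conjugates s_i to s_(i-1) for j < i
  <= m; the only braid move takes place at the letters s_i s_(i-1).\<close>

lemma sd_S: assumes "1 \<le> j" "j < i" "i \<le> m" "m < n"
  shows "mon (sd m j @ [S_letter i]) \<asymp> mon (S_letter (i - 1) # sd m j)"
proof -
  let ?t = "map S_letter (rev [j..<i - 1])" and ?h = "sd m (Suc i)"
  let ?i = "S_letter i" and ?i' = "S_letter (i - 1)"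
  have t: "set ?t \<subseteq> L" using assms by auto
  have h: "set ?h \<subseteq> L" using assms by auto
  have sd: "sd m j = ?h @ [?i, ?i'] @ ?t"
    using sd_split[of i m] sd_split[of "i - 1" m] sd_split2[of j "i - 1" m] assms by simp
  have "mon (sd m j @ [?i]) = mon ((?h @ [?i, ?i']) @ (?t @ [?i]) @ [])" unfolding sd by simp
  also have "\<dots> \<asymp> mon ((?h @ [?i, ?i']) @ (?i # ?t) @ [])"
    using assms h t by (intro eqv_ctx comm_word S_far) (auto intro!: S_far)
  also have "\<dots> = mon (?h @ [?i, ?i', ?i] @ ?t)" by simp
  also have "\<dots> \<asymp> mon (?h @ [?i', ?i, ?i'] @ ?t)"
    using assms h t eqv_sym[OF S_braid[of "i - 1"]] by (intro eqv_ctx) auto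
  also have "\<dots> = mon ([] @ (?h @ [?i']) @ ([?i, ?i'] @ ?t))" by simp
  also have "\<dots> \<asymp> mon ([] @ (?i' # ?h) @ ([?i, ?i'] @ ?t))"
    using assms h t by (intro eqv_ctx comm_word) (auto intro!: S_far)
  finally show ?thesis unfolding sd by simp
qed

lemma sd_S_far: assumes "1 \<le> i" "i + 1 < j" "j \<le> Suc m" "m < n"
  shows "mon (sd m j @ [S_letter i]) \<asymp> mon (S_letter i # sd m j)"
  using assms by (intro comm_word) (auto intro!: S_far)

text \<open>The cycle s_m ... s_j carries the index j to m + 1; the variants below cover the indices
  it fixes and those it lowers by one.\<close>

lemma sd_C_top: "1 \<le> j \<Longrightarrow> j \<le> Suc m \<Longrightarrow> m < n \<Longrightarrow> mon (sd m j @ [C_letter j]) \<asymp> mon (C_letter (Suc m) # sd m j)"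
proof (induction "Suc m - j" arbitrary: j)
  case (Suc k)
  have j: "j \<le> m" using Suc(2) by simp
  have "mon (sd m j @ [C_letter j]) = mon (sd m (Suc j) @ [S_letter j, C_letter j] @ [])"
    unfolding sd_split[OF j] by simp
  also have "\<dots> \<asymp> mon (sd m (Suc j) @ [C_letter (Suc j), S_letter j] @ [])"
    using Suc j by (intro eqv_ctx SC) auto
  also have "\<dots> = mon ([] @ (sd m (Suc j) @ [C_letter (Suc j)]) @ [S_letter j])" by simp
  also have "\<dots> \<asymp> mon ([] @ (C_letter (Suc m) # sd m (Suc j)) @ [S_letter j])"
    using Suc j by (intro eqv_ctx Suc(1)) auto
  finally show ?case using sd_split[OF j] by simp
qed simp

lemma sd_C_far: assumes "1 \<le> k" "k < j" "j \<le> Suc m" "m < n"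
  shows "mon (sd m j @ [C_letter k]) \<asymp> mon (C_letter k # sd m j)"
  using assms by (intro comm_word) (auto intro!: SC_far)

lemma sd_C: assumes "1 \<le> j" "j < k" "k \<le> Suc m" "m < n"
  shows "mon (sd m j @ [C_letter k]) \<asymp> mon (C_letter (k - 1) # sd m j)"
proof -
  let ?t = "map S_letter (rev [j..<k - 1])" and ?h = "sd m k"
  have t: "set ?t \<subseteq> L" using assms by auto
  have h: "set ?h \<subseteq> L" using assms by auto
  have sd: "sd m j = ?h @ [S_letter (k - 1)] @ ?t"
    using sd_split[of "k - 1" m] sd_split2[of j "k - 1" m] assms by simp
  have "mon (sd m j @ [C_letter k]) = mon ((?h @ [S_letter (k - 1)]) @ (?t @ [C_letter k]) @ [])" unfolding sd by simp
  also have "\<dots> \<asymp> mon ((?h @ [S_letter (k - 1)]) @ (C_letter k # ?t) @ [])"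
    using assms h t by (intro eqv_ctx comm_word) (auto intro!: SC_far)
  also have "\<dots> = mon (?h @ [S_letter (k - 1), C_letter k] @ ?t)" by simp
  also have "\<dots> \<asymp> mon (?h @ [C_letter (k - 1), S_letter (k - 1)] @ ?t)"
    using assms h t SC'[of "k - 1"] by (intro eqv_ctx) auto
  also have "\<dots> = mon ([] @ (?h @ [C_letter (k - 1)]) @ ([S_letter (k - 1)] @ ?t))" by simp
  also have "\<dots> \<asymp> mon ([] @ (C_letter (k - 1) # ?h) @ ([S_letter (k - 1)] @ ?t))"
    using assms h t by (intro eqv_ctx comm_word) (auto intro!: SC_far)
  finally show ?thesis unfolding sd by simp
qed

text \<open>Appending a letter to w c_(m+1)^b s_m ... s_j either changes j by one, or toggles b, or
  the letter travels left through the coset representative and joins w, where the induction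
  hypothesis applies.\<close>

lemma NF_snoc:
  "m \<le> n \<Longrightarrow> z \<in> NF m \<Longrightarrow> l \<in> Y_letters m \<Longrightarrow> \<exists>z'\<in>NF m. pm (mon (z @ [l])) (mon z')"
proof (induction m arbitrary: z l)
  case 0 then show ?case by (auto simp: Y_letters_def)
next
  case (Suc m)
  have mn: "m < n" using Suc by simp
  obtain w b j where w: "w \<in> NF m" and j: "1 \<le> j" "j \<le> Suc m"
    and z: "z = w @ (if b then [C_letter (Suc m)] else []) @ sd m j" using Suc.prems by auto
  let ?c = "\<lambda>b. if b then [C_letter (Suc m)] else []"
  have NFI: "w' \<in> NF m \<Longrightarrow> 1 \<le> j' \<Longrightarrow> j' \<le> Suc m \<Longrightarrow> w' @ ?c b' @ sd m j' \<in> NF (Suc m)" for w' b' j' by auto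
  have YmL: "Y_letters m \<subseteq> L" using mn by (auto simp: Y_letters_def)
  have wL: "set w \<subseteq> L" using NF_letters[OF w] YmL by blast
  have cL: "set (?c b') \<subseteq> L" for b' using mn by auto
  have sL: "set (sd m j) \<subseteq> L" using j mn by auto
  have main: "\<exists>z'\<in>NF (Suc m). pm (mon (z @ [l])) (mon z')"
    if l: "mon (sd m j @ [l]) \<asymp> mon (l' # sd m j)" and c: "pm (mon (?c b @ [l'])) (mon (l' # ?c b))" and l': "l' \<in> Y_letters m" for l'
  proof -
    obtain w' where w': "w' \<in> NF m" "pm (mon (w @ [l'])) (mon w')" using Suc.IH[OF _ w l'] mn by auto
    have w'L: "set w' \<subseteq> L" using NF_letters[OF w'(1)] YmL by blast
    have "mon (z @ [l]) = mon ((w @ ?c b) @ (sd m j @ [l]) @ [])" by (simp add: z)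
    also have "\<dots> \<asymp> mon ((w @ ?c b) @ (l' # sd m j) @ [])" using wL cL by (intro eqv_ctx l) auto
    also have "\<dots> = mon (w @ (?c b @ [l']) @ sd m j)" by simp
    also have "pm \<dots> (mon (w @ (l' # ?c b) @ sd m j))" using wL sL by (intro pm_ctx c) auto
    also have "mon (w @ (l' # ?c b) @ sd m j) = mon ([] @ (w @ [l']) @ (?c b @ sd m j))" by simp
    also have "pm \<dots> (mon ([] @ w' @ (?c b @ sd m j)))" using sL cL w'(2) by (intro pm_ctx) auto
    finally show ?thesis using NFI[OF w'(1) j] by (intro bexI[OF _ NFI[OF w'(1) j]]) simp
  qed
  from Suc.prems(3) show ?case
  proof (cases rule: Y_cases)
    case (1 i)
    have Sc: "pm (mon (?c b @ [S_letter i'])) (mon (S_letter i' # ?c b))" if "1 \<le> i'" "i' < m" for i'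
      using that mn by (auto intro!: pm_eqv eqv_sym[OF SC_far])
    consider "i + 1 < j" | "i + 1 = j" | "i = j" | "j < i" by linarith
    then show ?thesis
    proof cases
      case a: 1 show ?thesis
        by (rule main[of "S_letter i"]) (use a 1 j mn sd_S_far Sc in auto)
    next
      case 2
      then have "sd m j @ [S_letter i] = sd m i" using sd_split[of i m] j by simp
      then have "z @ [l] = w @ ?c b @ sd m i" using 1 z by simp
      then show ?thesis using 1 by (intro bexI[OF _ NFI[OF w, of i b]]) simp_all
    next
      case 3
      have jm: "j \<le> m" using 3 1 by simp
      have "mon (z @ [l]) = mon ((w @ ?c b @ sd m (Suc j)) @ [S_letter j, S_letter j] @ [])"
        unfolding z sd_split[OF jm] using 3 1 by simp
      also have "\<dots> \<asymp> mon ((w @ ?c b @ sd m (Suc j)) @ [] @ [])"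
        using wL cL jm j mn SS[of j] by (intro eqv_ctx) auto
      finally have "pm (mon (z @ [l])) (mon (w @ ?c b @ sd m (Suc j)))" by (auto intro: pm_eqv)
      then show ?thesis using NFI[OF w, of "Suc j" b] jm by (intro bexI[of _ "w @ ?c b @ sd m (Suc j)"]) (simp_all del: NF.simps)
    next
      case 4 show ?thesis
        by (rule main[of "S_letter (i - 1)"]) (use 4 1 j mn sd_S[of j i m] Sc[of "i - 1"] in auto)
    qed
  next
    case (2 k)
    have Cc: "pm (mon (?c b @ [C_letter k'])) (mon (C_letter k' # ?c b))" if "1 \<le> k'" "k' \<le> m" for k'
      using that mn by (auto intro!: pm_neg C_anti)
    consider "k < j" | "k = j" | "j < k" by linarith
    then show ?thesis
    proof cases
      case a: 1 show ?thesis
        by (rule main[of "C_letter k"]) (use a 2 j mn sd_C_far Cc in auto)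
    next
      case a: 3 show ?thesis
        by (rule main[of "C_letter (k - 1)"]) (use a 2 j mn sd_C[of j k m] Cc[of "k - 1"] in auto)
    next
      case a: 2
      have 3: "mon (?c b @ [C_letter (Suc m)]) \<asymp> mon (?c (\<not> b))" using mn CC[of "Suc m"] by auto
      have "mon (z @ [l]) = mon ((w @ ?c b) @ (sd m j @ [C_letter j]) @ [])" using a 2 by (simp add: z)
      also have "\<dots> \<asymp> mon ((w @ ?c b) @ (C_letter (Suc m) # sd m j) @ [])"
        using wL cL mn j by (intro eqv_ctx sd_C_top) auto
      also have "\<dots> = mon (w @ (?c b @ [C_letter (Suc m)]) @ sd m j)" by simp
      also have "\<dots> \<asymp> mon (w @ ?c (\<not> b) @ sd m j)" using wL sL by (intro eqv_ctx 3) auto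
      finally show ?thesis by (intro bexI[OF _ NFI[OF w j, of "\<not> b"]] pm_eqv)
    qed
  qed
qed

lemma Nil_NF: "[] \<in> NF m"
proof (induction m)
  case (Suc m)
  have "[] @ (if False then [C_letter (Suc m)] else []) @ sd m (Suc m) \<in> NF (Suc m)"
    unfolding NF.simps by (rule CollectI, rule exI[of _ "[]"], rule exI[of _ False], rule exI[of _ "Suc m"]) (use Suc in simp)
  then show ?case by simp
qed simp

lemma NF_pm: "set y \<subseteq> Yl \<Longrightarrow> \<exists>z\<in>NF n. pm (mon y) (mon z)"
proof (induction y rule: rev_induct)
  case Nil then show ?case using Nil_NF by (intro bexI[of _ "[]"]) auto
next
  case (snoc l y)
  then obtain z where z: "z \<in> NF n" "pm (mon y) (mon z)" by auto
  then obtain z' where z': "z' \<in> NF n" "pm (mon (z @ [l])) (mon z')" using NF_snoc[of n z l] snoc by auto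
  have "pm (mon ([] @ y @ [l])) (mon ([] @ z @ [l]))" using z(2) snoc YL by (intro pm_ctx) auto
  then show ?case using z' pm_trans by auto
qed

lemma finite_NF: "finite (NF m)"
proof (induction m)
  case (Suc m)
  let ?F = "\<lambda>y b j. y @ (if b then [C_letter (Suc m)] else []) @ sd m j"
  have "NF (Suc m) \<subseteq> (\<Union>y\<in>NF m. \<Union>b. (\<lambda>j. ?F y b j) ` {1..Suc m})"
  proof
    fix z assume "z \<in> NF (Suc m)"
    then obtain y b j where "y \<in> NF m" "1 \<le> j" "j \<le> Suc m" "z = ?F y b j" unfolding NF.simps by blast
    then show "z \<in> (\<Union>y\<in>NF m. \<Union>b. (\<lambda>j. ?F y b j) ` {1..Suc m})" by (intro UN_I[of y] UN_I[of b] image_eqI[of _ _ j]) simp_all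
  qed
  then show ?case by (rule finite_subset) (use Suc in simp)
qed simp

text \<open>One normal word is chosen for each class up to sign. Since the choice depends on the
  class alone, different elements of \<open>reps\<close> are incongruent even up to sign.\<close>

definition rep :: "sergeev_letter list \<Rightarrow> sergeev_letter list" where
  "rep y = (SOME z. z \<in> NF n \<and> pm (mon y) (mon z))"

lemma rep: assumes "set y \<subseteq> Yl" shows "rep y \<in> NF n" "pm (mon y) (mon (rep y))"
  using someI_ex[of "\<lambda>z. z \<in> NF n \<and> pm (mon y) (mon z)"] NF_pm[OF assms] by (auto simp: rep_def)

lemma rep_eq: "pm (mon y) (mon y') \<Longrightarrow> rep y = rep y'"
proof -
  assume "pm (mon y) (mon y')"
  then have "pm (mon y) (mon z) \<longleftrightarrow> pm (mon y') (mon z)" for z using pm_trans pm_sym by blast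
  then show ?thesis by (simp add: rep_def)
qed

definition reps :: "sergeev_letter list set" where "reps = rep ` {y. set y \<subseteq> Yl}"

lemma finite_reps: "finite reps"
  by (rule finite_subset[OF _ finite_NF[of n]]) (auto simp: reps_def rep)

lemma reps_Y: "y \<in> reps \<Longrightarrow> set y \<subseteq> Yl"
  using NF_letters[of _ n] rep(1) by (auto simp: reps_def)

lemma reps_unique: "y \<in> reps \<Longrightarrow> y' \<in> reps \<Longrightarrow> pm (mon y) (mon y') \<Longrightarrow> y = y'"
proof -
  assume *: "y \<in> reps" "y' \<in> reps" and "pm (mon y) (mon y')"
  then have eq: "rep y = rep y'" by (intro rep_eq)
  have "rep (rep v) = rep v" if "set v \<subseteq> Yl" for v using rep_eq[OF rep(2)[OF that]] by simp
  then have "rep y = y" "rep y' = y'" using * by (auto simp: reps_def)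
  with eq show ?thesis by simp
qed

lemma reps_ex: "set y \<subseteq> Yl \<Longrightarrow> \<exists>z\<in>reps. pm (mon y) (mon z)"
  using rep(2) by (auto simp: reps_def)

lemma Y_invol: "l \<in> Yl \<Longrightarrow> mon [l, l] \<asymp> 1"
  by (erule Y_cases) (auto intro: SS CC)

text \<open>Every letter s or c is an involution, so reversing a word inverts it.\<close>

lemma Y_inv: "set y \<subseteq> Yl \<Longrightarrow> mon (y @ rev y) \<asymp> 1"
proof (induction y)
  case (Cons l y)
  have "mon (l # y @ rev y @ [l]) = mon [l] * mon (y @ rev y) * mon [l]" by (simp flip: mon_append)
  also have "\<dots> \<asymp> mon [l] * 1 * mon [l]" using Cons YL by (intro eqv_left eqv_right) auto
  also have "\<dots> = mon [l, l]" by (simp flip: mon_append)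
  also have "\<dots> \<asymp> 1" using Cons by (intro Y_invol) auto
  finally show ?case by simp
qed simp

lemma Y_inv': "set y \<subseteq> Yl \<Longrightarrow> mon (rev y @ y) \<asymp> 1"
  using Y_inv[of "rev y"] by simp

end

section \<open>The filtration by the number of letters x\<close>

context sergeev_ideal
begin

lemma cst_left_comm: "mon w * (cst r * f) = cst r * (mon w * f)"
  by (metis cst_comm mult.assoc)

text \<open>Elements of degree less than k in the x_i, modulo \<open>J\<close>: the span of words
  with all x in front and fewer than k of them.\<close>

inductive_set M :: "nat \<Rightarrow> 'r sergeev_free set" for k where
  M_J: "f \<in> J \<Longrightarrow> f \<in> M k"
| M_word: "set \<alpha> \<subseteq> {1..n} \<Longrightarrow> length \<alpha> < k \<Longrightarrow> set y \<subseteq> Yl \<Longrightarrow> mon (map X_letter \<alpha> @ y) \<in> M k"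
| M_add: "f \<in> M k \<Longrightarrow> h \<in> M k \<Longrightarrow> f + h \<in> M k"
| M_scale: "f \<in> M k \<Longrightarrow> cst r * f \<in> M k"

lemma M_0: "0 \<in> M k" by (rule M_J[OF J_0])
lemma M_minus: "f \<in> M k \<Longrightarrow> - f \<in> M k" using M_scale[where f = f and k = k and r = "- 1"] by simp
lemma M_diff: "f \<in> M k \<Longrightarrow> h \<in> M k \<Longrightarrow> f - h \<in> M k" using M_add[where f = f and h = "- h" and k = k] M_minus[of h k] by simp
lemma M_eqv: "a \<asymp> b \<Longrightarrow> b \<in> M k \<Longrightarrow> a \<in> M k"
  using M_add[where f = "a - b" and h = b and k = k] M_J[where f = "a - b" and k = k] by (simp add: eqv_def)
lemma M_sum: "(\<And>i. i \<in> I \<Longrightarrow> f i \<in> M k) \<Longrightarrow> (\<Sum>i\<in>I. f i) \<in> M k"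
  by (induction I rule: infinite_finite_induct) (auto simp: M_0 M_add)

lemma M_mono: "f \<in> M k \<Longrightarrow> k \<le> m \<Longrightarrow> f \<in> M m"
proof (induction rule: M.induct)
  case (M_word \<alpha> y) then show ?case by (intro M.M_word) auto
qed (auto intro: M.intros)

lemma XL: "set \<alpha> \<subseteq> {1..n} \<Longrightarrow> set (map X_letter \<alpha>) \<subseteq> L" by auto

lemma M_right: "f \<in> M k \<Longrightarrow> set u \<subseteq> Yl \<Longrightarrow> f * mon u \<in> M k"
proof (induction rule: M.induct)
  case (M_J f)
  then have "f * mon u \<in> J" using YL by (intro J_right) auto
  then show ?case by (rule M.M_J)
next
  case (M_word \<alpha> y)
  then have "mon (map X_letter \<alpha> @ (y @ u)) \<in> M k" by (intro M.M_word) auto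
  then show ?case by (simp add: mon_append mult.assoc)
qed (auto simp: distrib_right mult.assoc intro: M.intros)

lemma M_X: "f \<in> M k \<Longrightarrow> 1 \<le> i \<Longrightarrow> i \<le> n \<Longrightarrow> mon [X_letter i] * f \<in> M (Suc k)"
proof (induction rule: M.induct)
  case (M_J f)
  then have "mon [X_letter i] * f \<in> J" by (intro J_left) auto
  then show ?case by (rule M.M_J)
next
  case (M_word \<alpha> y)
  then have "mon (map X_letter (i # \<alpha>) @ y) \<in> M (Suc k)" by (intro M.M_word) auto
  then show ?case by (simp flip: mon_append)
next
  case (M_scale f r)
  then have "cst r * (mon [X_letter i] * f) \<in> M (Suc k)" by (intro M.M_scale) auto
  then show ?case using cst_comm[of r "mon [X_letter i]"] by (metis mult.assoc)
qed (auto simp: distrib_left intro: M.intros)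

text \<open>The relation for s_i x_i multiplied by s_i on both sides; conjugation by s_i
  interchanges c_i and c_(i+1), which flips the sign of c_i c_(i+1).\<close>

lemma SX': assumes i: "1 \<le> i" "i < n"
  shows "mon [S_letter i, X_letter (Suc i)] \<asymp> mon [X_letter i, S_letter i] + 1 - mon [C_letter i, C_letter (Suc i)]"
proof -
  let ?s = "mon [S_letter i]" and ?c = "mon [C_letter i]" and ?c' = "mon [C_letter (Suc i)]"
  let ?x = "mon [X_letter i]" and ?x' = "mon [X_letter (Suc i)]"
  have m2: "mon [a, b] = mon [a] * mon [b]" for a b by (simp flip: mon_append)
  have mem: "?s \<in> Fsub n" "?c \<in> Fsub n" "?c' \<in> Fsub n" "?x \<in> Fsub n" "?x' \<in> Fsub n" using i by auto
  have ss: "?s * ?s \<asymp> 1" using SS[OF i] by (simp add: m2)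
  have "?s * ?x + 1 + ?c * ?c' \<asymp> ?x' * ?s"
    using eqv_add[OF SX[OF i], of "1 + mon [C_letter i, C_letter (Suc i)]" "1 + mon [C_letter i, C_letter (Suc i)]"]
    by (simp add: m2 algebra_simps)
  then have "?s * (?s * ?x + 1 + ?c * ?c') * ?s \<asymp> ?s * (?x' * ?s) * ?s" using mem by (intro eqv_left eqv_right) auto
  moreover have "?s * (?x' * ?s) * ?s \<asymp> ?s * ?x'"
    using eqv_left[OF Fsub_cl(5)[OF mem(1,5)] ss] by (simp add: mult.assoc)
  moreover have "?s * (?s * ?x + 1 + ?c * ?c') * ?s \<asymp> ?x * ?s + 1 - ?c * ?c'"
  proof -
    have a: "?s * (?s * ?x) * ?s \<asymp> ?x * ?s"
      using eqv_right[OF Fsub_cl(5)[OF mem(4,1)] ss] by (simp add: mult.assoc)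
    have "?s * (?c * ?c') * ?s = (?s * ?c) * (?c' * ?s)" by (simp add: mult.assoc)
    also have "\<dots> \<asymp> (?c' * ?s) * (?c' * ?s)" using SC[OF i] mem i by (intro eqv_right) (auto simp: m2)
    also have "\<dots> = ?c' * (?s * ?c') * ?s" by (simp add: mult.assoc)
    also have "\<dots> \<asymp> ?c' * (?c * ?s) * ?s" using SC'[OF i] mem i by (intro eqv_right eqv_left) (auto simp: m2)
    also have "\<dots> = ?c' * ?c * (?s * ?s)" by (simp add: mult.assoc)
    also have "\<dots> \<asymp> ?c' * ?c * 1" using mem ss i by (intro eqv_left) auto
    also have "\<dots> = ?c' * ?c" by simp
    also have "\<dots> \<asymp> - (?c * ?c')" using C_anti[of "Suc i" i] i by (simp add: m2)
    finally have b: "?s * (?c * ?c') * ?s \<asymp> - (?c * ?c')" .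
    show ?thesis using eqv_add[OF eqv_add[OF a ss] b] by (simp add: algebra_simps)
  qed
  ultimately show ?thesis unfolding m2 using eqv_sym eqv_trans by blast
qed

lemma m2: "mon [a, b] = mon [a] * mon [b]" by (simp flip: mon_append)

text \<open>Moving a letter s or c past the first x produces a letter x in front of a shorter
  product, plus terms with one letter x fewer. The induction on k absorbs both; it ranges over all
  letters because s_i x_i releases c_i c_(i+1).\<close>

lemma M_Y: "f \<in> M k \<Longrightarrow> l \<in> Yl \<Longrightarrow> mon [l] * f \<in> M k"
proof (induction k arbitrary: f l)
  case 0
  from this(1) show ?case
  proof (induction rule: M.induct)
    case (M_J f) then show ?case using 0(2) YL by (intro M.M_J J_left) auto
  next
    case (M_scale f r)
    then have "cst r * (mon [l] * f) \<in> M 0" by (intro M.M_scale)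
    then show ?case using cst_comm[of r "mon [l]"] by (metis mult.assoc)
  qed (auto simp: distrib_left intro: M.intros)
next
  case (Suc k)
  from Suc.prems(1) show ?case
  proof (induction rule: M.induct)
    case (M_J f) then show ?case using Suc.prems YL by (intro M.M_J J_left) auto
  next
    case (M_scale f r)
    then have "cst r * (mon [l] * f) \<in> M (Suc k)" by (intro M.M_scale)
    then show ?case using cst_comm[of r "mon [l]"] by (metis mult.assoc)
  next
    case (M_word \<alpha> y)
    show ?case
    proof (cases \<alpha>)
      case Nil
      then have "mon (map X_letter [] @ (l # y)) \<in> M (Suc k)" using M_word Suc.prems by (intro M.M_word) auto
      then show ?thesis using Nil by (simp flip: mon_append)
    next
      case (Cons j \<beta>)
      then have j: "1 \<le> j" "j \<le> n" using M_word by auto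
      let ?z = "mon (map X_letter \<beta> @ y)"
      have z: "?z \<in> M k" using Cons M_word by (intro M.M_word) auto
      have "set (map X_letter \<beta> @ y) \<subseteq> L" using Cons M_word XL[of \<beta>] YL by auto
      then have zF: "?z \<in> Fsub n" by (rule Fsub_mon)
      note IH = Suc.IH
      have XY: "mon [X_letter j', l'] * ?z \<in> M (Suc k)" if "l' \<in> Yl" "1 \<le> j'" "j' \<le> n" for j' l'
        using M_X[OF IH[OF z that(1)] that(2,3)] by (simp add: m2 mult.assoc)
      have up: "f \<in> M (Suc k)" if "f \<in> M k" for f using M_mono[OF that] by simp
      have *: ?thesis if "mon [l, X_letter j] \<asymp> b" "b * ?z \<in> M (Suc k)" for b
      proof -
        have "mon [l, X_letter j] * ?z \<in> M (Suc k)" using M_eqv[OF eqv_right[OF zF that(1)] that(2)] .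
        then show ?thesis using Cons by (simp flip: mon_append)
      qed
      from Suc.prems(2) show ?thesis
      proof (cases rule: Y_cases)
        case (1 i)
        have CC: "mon [C_letter i, C_letter (Suc i)] * ?z \<in> M (Suc k)"
          using up[OF IH[OF IH[OF z]], of "C_letter (Suc i)" "C_letter i"] 1 by (simp add: m2 mult.assoc)
        consider "j = i" | "j = Suc i" | "j \<noteq> i" "j \<noteq> i + 1" by linarith
        then show ?thesis
        proof cases
          case a: 1
          show ?thesis
          proof (rule *)
            show "mon [l, X_letter j] \<asymp> mon [X_letter (Suc i), S_letter i] - 1 - mon [C_letter i, C_letter (Suc i)]"
              using SX 1 a by simp
            show "(mon [X_letter (Suc i), S_letter i] - 1 - mon [C_letter i, C_letter (Suc i)]) * ?z \<in> M (Suc k)"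
              using XY[of "S_letter i" "Suc i"] up[OF z] CC 1 unfolding left_diff_distrib by (intro M_diff) auto
          qed
        next
          case a: 2
          show ?thesis
          proof (rule *)
            show "mon [l, X_letter j] \<asymp> mon [X_letter i, S_letter i] + 1 - mon [C_letter i, C_letter (Suc i)]"
              using SX' 1 a by simp
            show "(mon [X_letter i, S_letter i] + 1 - mon [C_letter i, C_letter (Suc i)]) * ?z \<in> M (Suc k)"
              using XY[of "S_letter i" i] up[OF z] CC 1 unfolding left_diff_distrib distrib_right by (intro M_diff M_add) auto
          qed
        next
          case 3
          show ?thesis by (rule *[OF _ XY[OF Suc.prems(2) j]]) (use 1 3 j SX_far in simp)
        qed
      next
        case (2 i)
        show ?thesis
        proof (cases "i = j")
          case True
          have "mon [l, X_letter j] \<asymp> - mon [X_letter j, l]"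
            using eqv_minus[OF eqv_sym[OF XC[OF j]]] True 2 by simp
          then show ?thesis by (rule *) (use M_minus[OF XY[OF Suc.prems(2) j]] in simp)
        next
          case False
          show ?thesis by (rule *[OF _ XY[OF Suc.prems(2) j]]) (use 2 False j eqv_sym[OF XC_far] in simp)
        qed
      qed
    qed
  qed (auto simp: distrib_left intro: M.intros)
qed

lemma M_Yword: "set y \<subseteq> Yl \<Longrightarrow> f \<in> M k \<Longrightarrow> mon y * f \<in> M k"
proof (induction y)
  case (Cons l y)
  then have "mon [l] * (mon y * f) \<in> M k" by (intro M_Y) auto
  then show ?case by (simp flip: mon_append mult.assoc)
qed simp

lemma M_word_left: "set w \<subseteq> L \<Longrightarrow> f \<in> M k \<Longrightarrow> mon w * f \<in> M (xcount w + k)"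
proof (induction w)
  case (Cons l w)
  have e: "mon (l # w) * f = mon [l] * (mon w * f)" by (simp flip: mon_append mult.assoc)
  show ?case
  proof (cases l)
    case (X_letter i) then show ?thesis unfolding e using Cons M_X[of "mon w * f" _ i] by simp
  qed (use Cons M_Y[of "mon w * f" "xcount w + k" l] e in auto)
qed simp

lemma word_M: "set w \<subseteq> L \<Longrightarrow> mon w \<in> M (Suc (xcount w))"
  using M_word_left[of w "mon (map X_letter [] @ [])" 1] M_word[of "[]" 1 "[]"] by simp

lemma Fsub_M: "f \<in> Fsub n \<Longrightarrow> \<exists>k. f \<in> M k"
proof (induction rule: Fsub_induct)
  case zero show ?case using M_0 by blast
next
  case (mon w) then show ?case using word_M by blast
next
  case (add f h)
  then obtain k k' where "f \<in> M k" "h \<in> M k'" by blast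
  then have "f + h \<in> M (max k k')" by (intro M_add) (auto intro: M_mono)
  then show ?case by blast
next
  case (scale r f) then show ?case using M_scale by blast
qed

lemma X_perm: "set \<alpha> \<subseteq> {1..n} \<Longrightarrow> mset \<alpha> = mset \<beta> \<Longrightarrow> mon (map X_letter \<alpha>) \<asymp> mon (map X_letter \<beta>)"
proof (induction \<alpha> arbitrary: \<beta>)
  case (Cons a \<alpha>)
  then have "a \<in> set \<beta>" by (metis list.set_intros(1) mset_eq_setD)
  then obtain \<beta>1 \<beta>2 where b: "\<beta> = \<beta>1 @ a # \<beta>2" by (meson split_list)
  have "set \<beta> \<subseteq> {1..n}" using Cons.prems mset_eq_setD by blast
  then have s: "set \<beta>1 \<subseteq> {1..n}" "set \<beta>2 \<subseteq> {1..n}" "a \<in> {1..n}" using b by auto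
  have "mset \<alpha> = mset (\<beta>1 @ \<beta>2)" using Cons.prems(2) b by simp
  then have IH: "mon (map X_letter \<alpha>) \<asymp> mon (map X_letter (\<beta>1 @ \<beta>2))"
    using Cons.prems(1) by (intro Cons.IH) auto
  have "mon (map X_letter \<beta>) = mon ([] @ (map X_letter \<beta>1 @ [X_letter a]) @ map X_letter \<beta>2)" by (simp add: b)
  also have "\<dots> \<asymp> mon ([] @ (X_letter a # map X_letter \<beta>1) @ map X_letter \<beta>2)"
    using s XL[of \<beta>1] XL[of \<beta>2] by (intro eqv_ctx comm_word) (auto intro!: XX)
  also have "\<dots> = mon [X_letter a] * mon (map X_letter (\<beta>1 @ \<beta>2))" by (simp flip: mon_append)
  finally have "mon (map X_letter \<beta>) \<asymp> mon [X_letter a] * mon (map X_letter (\<beta>1 @ \<beta>2))" .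
  moreover have "mon [X_letter a] * mon (map X_letter \<alpha>) \<asymp> mon [X_letter a] * mon (map X_letter (\<beta>1 @ \<beta>2))"
    using s by (intro eqv_left IH) auto
  moreover have "mon [X_letter a] * mon (map X_letter \<alpha>) = mon (map X_letter (a # \<alpha>))" by (simp flip: mon_append)
  ultimately show ?case using eqv_sym eqv_trans by metis
qed simp

text \<open>In x_1^d = - (lower terms of g) the term of degree d - 1 is missing by parity, so the
  degree falls by at least two. This is the property of g that makes x_1 satisfy the trace
  identity.\<close>

lemma x1_pow: "mon (replicate d (X_letter 1)) \<in> M (d - 1)"
proof -
  have "cst (coeff g i) * mon (replicate i (X_letter 1)) \<in> M (d - 1)" if "i < d" for i
  proof (cases "i = d - 1")
    case True
    then have "coeff g i = 0" using par[of i] d1 by (cases d) auto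
    then show ?thesis by (simp add: M_0)
  next
    case False
    then have "mon (map X_letter (replicate i 1) @ []) \<in> M (d - 1)" using that n1 by (intro M_word) auto
    then show ?thesis by (intro M_scale) simp
  qed
  then have A: "(\<Sum>i<d. cst (coeff g i) * mon (replicate i (X_letter 1))) \<in> M (d - 1)" by (intro M_sum) auto
  have E: "(\<Sum>i\<le>d. cst (coeff g i) * mon (replicate i (X_letter 1))) =
      (\<Sum>i<d. cst (coeff g i) * mon (replicate i (X_letter 1))) + mon (replicate d (X_letter 1))"
    unfolding lessThan_Suc_atMost[symmetric] by (simp add: lead)
  from M_diff[OF M_J[OF J_g] A] show ?thesis unfolding E by (simp only: add_diff_cancel_left')
qed

text \<open>Passing s_i through a power of x_i costs only terms of smaller degree, one correction
  for each factor.\<close>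

lemma SX_pow: assumes i: "1 \<le> i" "i < n"
  shows "mon [S_letter i] * mon (replicate m (X_letter i)) - mon (replicate m (X_letter (Suc i))) * mon [S_letter i] \<in> M m"
proof (induction m)
  case 0 then show ?case by (simp add: M_0)
next
  case (Suc m)
  let ?s = "mon [S_letter i]" and ?x = "mon [X_letter i]" and ?x' = "mon [X_letter (Suc i)]"
  let ?A = "mon (replicate m (X_letter i))" and ?B = "mon (replicate m (X_letter (Suc i)))"
  let ?q = "mon [S_letter i, X_letter i] - (mon [X_letter (Suc i), S_letter i] - 1 - mon [C_letter i, C_letter (Suc i)])"
  have A: "mon (replicate (Suc m) (X_letter i)) = ?x * ?A" "mon (replicate (Suc m) (X_letter (Suc i))) = ?x' * ?B"
    by (simp_all flip: mon_append)
  have "?q \<in> J" using SX[OF i] by (simp add: eqv_def)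
  moreover have "?A \<in> Fsub n" by (rule Fsub_mon) (use i in auto)
  ultimately have 1: "?q * ?A \<in> M (Suc m)" by (intro M_J J_right)
  have 2: "?x' * (?s * ?A - ?B * ?s) \<in> M (Suc m)" using i by (intro M_X Suc) auto
  have AM: "?A \<in> M (Suc m)" using M_word[of "replicate m i" "Suc m" "[]"] i
    by (simp add: set_replicate_conv_if)
  then have 3: "mon [C_letter i] * (mon [C_letter (Suc i)] * ?A) \<in> M (Suc m)" using i by (intro M_Y) auto
  have E: "?s * (?x * ?A) - ?x' * ?B * ?s = ?q * ?A + ?x' * (?s * ?A - ?B * ?s) - ?A - mon [C_letter i] * (mon [C_letter (Suc i)] * ?A)"
    by (simp add: m2 algebra_simps)
  show ?case unfolding A E by (rule M_diff[OF M_diff[OF M_add[OF 1 2] AM] 3])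
qed

text \<open>Conjugating by s_i transports the degree drop from x_i to x_(i+1); the errors from
  \<open>SX_pow\<close> reduce the guaranteed drop to one.\<close>

lemma xi_pow: "1 \<le> i \<Longrightarrow> i \<le> n \<Longrightarrow> mon (replicate d (X_letter i)) \<in> M d"
proof (induction i rule: nat_induct_at_least)
  case base then show ?case using M_mono[OF x1_pow, of d] by simp
next
  case (Suc i)
  let ?s = "mon [S_letter i]"
  let ?A = "mon (replicate d (X_letter i))" and ?B = "mon (replicate d (X_letter (Suc i)))"
  have B: "?B \<in> Fsub n" using Suc by (intro Fsub_mon) auto
  have "?B \<asymp> ?B * (?s * ?s)" using eqv_left[OF B eqv_sym[OF SS[of i]]] Suc by (simp add: m2)
  moreover have "?B * (?s * ?s) = ?s * ?A * ?s - (?s * ?A - ?B * ?s) * ?s" by (simp add: algebra_simps)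
  moreover have "?s * ?A * ?s - (?s * ?A - ?B * ?s) * ?s \<in> M d"
  proof (rule M_diff)
    show "?s * ?A * ?s \<in> M d" by (rule M_right[OF M_Y]) (use Suc in auto)
    show "(?s * ?A - ?B * ?s) * ?s \<in> M d" by (rule M_right[OF SX_pow]) (use Suc in auto)
  qed
  ultimately show ?case using M_eqv by metis
qed

lemma extract_count:
  assumes "count (mset \<alpha>) i \<ge> m" obtains \<beta> where "mset \<alpha> = mset (\<beta> @ replicate m i)" "length \<alpha> = length \<beta> + m"
proof -
  obtain \<beta> where b: "mset \<beta> = mset \<alpha> - replicate_mset m i" using ex_mset by blast
  have "mset \<alpha> = mset (\<beta> @ replicate m i)" using assms b by (simp add: count_le_replicate_mset_subset_eq)
  moreover from arg_cong[OF this, of size] have "length \<alpha> = length \<beta> + m" by simp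
  ultimately show thesis by (rule that)
qed

text \<open>Since the x_i commute, d copies of x_i can be gathered at the end of the x part and
  replaced by something of smaller degree.\<close>

lemma count_M_gen:
  assumes p: "mon (replicate d (X_letter i)) \<in> M m" and a: "set \<alpha> \<subseteq> {1..n}" "set y \<subseteq> Yl" "count (mset \<alpha>) i \<ge> d" 
  shows "mon (map X_letter \<alpha> @ y) \<in> M (length \<alpha> - d + m)"
proof -
  obtain \<beta> where b: "mset \<alpha> = mset (\<beta> @ replicate d i)" "length \<alpha> = length \<beta> + d" using extract_count[OF a(3)] by blast
  have s: "set \<beta> \<subseteq> {1..n}" using a(1) mset_eq_setD[OF b(1)] by auto
  have xc: "xcount (map X_letter \<beta>) = length \<beta>" by (induction \<beta>) auto
  have "mon (map X_letter \<beta>) * (mon (replicate d (X_letter i)) * mon y) \<in> M (length \<beta> + m)"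
    using M_word_left[OF XL[OF s] M_right[OF p a(2)]] by (simp add: xc)
  moreover have "mon (map X_letter \<alpha> @ y) \<asymp> mon (map X_letter \<beta>) * (mon (replicate d (X_letter i)) * mon y)"
    using eqv_right[OF _ X_perm[OF a(1) b(1)], of "mon y"] a(2) YL by (simp add: mon_append mult.assoc subset_iff)
  ultimately show ?thesis using b(2) M_eqv by simp
qed

lemma count_M: "set \<alpha> \<subseteq> {1..n} \<Longrightarrow> set y \<subseteq> Yl \<Longrightarrow> i \<in> {1..n} \<Longrightarrow> count (mset \<alpha>) i \<ge> d \<Longrightarrow> mon (map X_letter \<alpha> @ y) \<in> M (length \<alpha>)"
  using count_M_gen[OF xi_pow, of i \<alpha> y] count_le_replicate_mset_subset_eq[of d "mset \<alpha>" i] size_mset_mono[of "replicate_mset d i" "mset \<alpha>"] by auto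

lemma count_M1: "set \<alpha> \<subseteq> {1..n} \<Longrightarrow> set y \<subseteq> Yl \<Longrightarrow> count (mset \<alpha>) 1 \<ge> d \<Longrightarrow> mon (map X_letter \<alpha> @ y) \<in> M (length \<alpha> - 1)"
  using count_M_gen[OF x1_pow, of \<alpha> y] count_le_replicate_mset_subset_eq[of d "mset \<alpha>" 1] size_mset_mono[of "replicate_mset d 1" "mset \<alpha>"] d1 by auto

primrec toplist :: "nat \<Rightarrow> nat list" where
  "toplist 0 = []" | "toplist (Suc m) = toplist m @ replicate (d - 1) (Suc m)"

lemma toplist_xtop: "map X_letter (toplist m) = xtop (d - 1) m"
  by (induction m) (auto simp: map_replicate_const)

lemma set_toplist: "set (toplist m) \<subseteq> {1..m}"
  by (induction m) auto

lemma count_toplist: "count (mset (toplist m)) i = (if 1 \<le> i \<and> i \<le> m then d - 1 else 0)"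
  by (induction m) auto

definition topm :: "nat multiset" where "topm = mset (toplist n)"

lemma size_topm: "size topm = n * (d - 1)"
proof -
  have "length (toplist m) = m * (d - 1)" for m by (induction m) auto
  then show ?thesis by (simp add: topm_def)
qed

lemma not_sub_topm: "set \<alpha> \<subseteq> {1..n} \<Longrightarrow> \<not> mset \<alpha> \<subseteq># topm \<Longrightarrow> \<exists>i\<in>{1..n}. count (mset \<alpha>) i \<ge> d"
proof -
  assume a: "set \<alpha> \<subseteq> {1..n}" "\<not> mset \<alpha> \<subseteq># topm"
  then obtain i where i: "count (mset \<alpha>) i > count topm i" by (auto simp: subseteq_mset_def not_le)
  then have "i \<in># mset \<alpha>" by (metis count_inI less_zeroE)
  with a have "i \<in> {1..n}" by auto
  with i show ?thesis by (intro bexI[of _ i]) (auto simp: topm_def count_toplist)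
qed

text \<open>The span, modulo \<open>J\<close>, of the words with all exponents of the x_i at most d
  - 1; \<open>Fsub_B\<close> below shows that it contains every element.\<close>

inductive_set B :: "'r sergeev_free set" where
  B_J: "f \<in> J \<Longrightarrow> f \<in> B"
| B_word: "mset \<alpha> \<subseteq># topm \<Longrightarrow> set y \<subseteq> Yl \<Longrightarrow> mon (map X_letter \<alpha> @ y) \<in> B"
| B_add: "f \<in> B \<Longrightarrow> h \<in> B \<Longrightarrow> f + h \<in> B"
| B_scale: "f \<in> B \<Longrightarrow> cst r * f \<in> B"

text \<open>A word with some exponent at least d has smaller degree than its length suggests, so
  strong induction on the degree applies.\<close>

lemma M_B: "f \<in> M k \<Longrightarrow> f \<in> B"
proof (induction k arbitrary: f rule: less_induct)
  case (less k)
  from less.prems show ?case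
  proof (induction rule: M.induct)
    case (M_word \<alpha> y)
    show ?case
    proof (cases "mset \<alpha> \<subseteq># topm")
      case True then show ?thesis using M_word by (intro B_word)
    next
      case False
      then obtain i where "i \<in> {1..n}" "count (mset \<alpha>) i \<ge> d" using not_sub_topm M_word by blast
      then have "mon (map X_letter \<alpha> @ y) \<in> M (length \<alpha>)" using M_word by (intro count_M) auto
      then show ?thesis using less.IH M_word by blast
    qed
  qed (auto intro: B.intros)
qed

lemma Fsub_B: "f \<in> Fsub n \<Longrightarrow> f \<in> B"
  using Fsub_M M_B by blast

lemma sub_topm_set: "mset \<alpha> \<subseteq># topm \<Longrightarrow> set \<alpha> \<subseteq> {1..n}"
  using set_toplist[of n] set_mset_mono[of "mset \<alpha>" topm] by (auto simp: topm_def)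

lemma sub_topm_len: "mset \<alpha> \<subseteq># topm \<Longrightarrow> length \<alpha> < n * (d - 1) \<or> mset \<alpha> = topm"
  using size_mset_mono[of "mset \<alpha>" topm] mset_subset_size[of "mset \<alpha>" topm] by (auto simp: size_topm subset_mset.less_le)

section \<open>Commuting s and c past the top monomial\<close>

text \<open>c_i anticommutes with x_i and commutes with the other x_j, so the sign counts the
  occurrences of x_i. In the top monomial it is (-1)^(d-1), the source of the dichotomy between odd
  and even d.\<close>

lemma C_word: "set \<alpha> \<subseteq> {1..n} \<Longrightarrow> 1 \<le> i \<Longrightarrow> i \<le> n \<Longrightarrow>
  mon (C_letter i # map X_letter \<alpha>) \<asymp> cst ((- 1) ^ count (mset \<alpha>) i) * mon (map X_letter \<alpha> @ [C_letter i])"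
proof (induction \<alpha>)
  case (Cons j \<alpha>)
  let ?e = "\<lambda>j. if j = i then cst (- 1) else (1 :: 'r sergeev_free)"
  have A: "mon [C_letter i, X_letter j] \<asymp> ?e j * mon [X_letter j, C_letter i]"
  proof (cases "i = j")
    case True then show ?thesis using eqv_minus[OF eqv_sym[OF XC[of j]]] Cons by simp
  next
    case False then show ?thesis using eqv_sym[OF XC_far[of j i]] Cons by simp
  qed
  have "mon (C_letter i # map X_letter (j # \<alpha>)) = mon [C_letter i, X_letter j] * mon (map X_letter \<alpha>)" by (simp flip: mon_append)
  also have "\<dots> \<asymp> ?e j * mon [X_letter j, C_letter i] * mon (map X_letter \<alpha>)" using Cons.prems XL[of \<alpha>] by (intro eqv_right A Fsub_mon) auto
  also have "\<dots> = ?e j * mon [X_letter j] * mon (C_letter i # map X_letter \<alpha>)" by (simp add: mult.assoc flip: mon_append)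
  also have "\<dots> \<asymp> ?e j * mon [X_letter j] * (cst ((- 1) ^ count (mset \<alpha>) i) * mon (map X_letter \<alpha> @ [C_letter i]))"
    using Cons by (intro eqv_left) auto
  also have "\<dots> = ?e j * cst ((- 1) ^ count (mset \<alpha>) i) * (mon [X_letter j] * mon (map X_letter \<alpha> @ [C_letter i]))"
    by (simp add: mult.assoc cst_left_comm)
  also have "mon [X_letter j] * mon (map X_letter \<alpha> @ [C_letter i]) = mon (map X_letter (j # \<alpha>) @ [C_letter i])" by (simp flip: mon_append)
  also have "?e j * cst ((- 1) ^ count (mset \<alpha>) i) = cst ((- 1) ^ count (mset (j # \<alpha>)) i)" by auto
  finally show ?case .
qed simp

lemma top_C: "mset \<alpha> = topm \<Longrightarrow> 1 \<le> i \<Longrightarrow> i \<le> n \<Longrightarrow>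
  mon (C_letter i # map X_letter \<alpha>) \<asymp> cst ((- 1) ^ (d - 1)) * mon (map X_letter \<alpha> @ [C_letter i])"
  using C_word[of \<alpha> i] sub_topm_set[of \<alpha>] by (simp add: topm_def count_toplist)

text \<open>The constants 1 cancel between the two exchange relations, and the terms c_i c_(i+1)
  cancel because x_(i+1) anticommutes with c_(i+1).\<close>

lemma S_pair: assumes i: "1 \<le> i" "i < n"
  shows "mon [S_letter i, X_letter i, X_letter (Suc i)] \<asymp> mon [X_letter i, X_letter (Suc i), S_letter i]"
proof -
  let ?s = "mon [S_letter i]" and ?c = "mon [C_letter i]" and ?c' = "mon [C_letter (Suc i)]"
  let ?x = "mon [X_letter i]" and ?x' = "mon [X_letter (Suc i)]"
  have mem: "?s \<in> Fsub n" "?c \<in> Fsub n" "?c' \<in> Fsub n" "?x \<in> Fsub n" "?x' \<in> Fsub n" using i by auto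
  have 1: "?s * ?x * ?x' \<asymp> (?x' * ?s - 1 - ?c * ?c') * ?x'" using SX[OF i] mem i by (intro eqv_right) (auto simp: m2)
  have 2: "?x' * (?s * ?x') \<asymp> ?x' * (?x * ?s + 1 - ?c * ?c')" using SX'[OF i] mem i by (intro eqv_left) (auto simp: m2)
  have 3: "?c * (?c' * ?x') \<asymp> ?c * (- (?x' * ?c'))"
    using eqv_minus[OF eqv_sym[OF XC[of "Suc i"]]] i mem by (intro eqv_left) (auto simp: m2)
  have 4: "(?c * ?x') * ?c' \<asymp> (?x' * ?c) * ?c'" using eqv_sym[OF XC_far[of "Suc i" i]] i mem by (intro eqv_right) (auto simp: m2)
  have 5: "(?x' * ?x) * ?s \<asymp> (?x * ?x') * ?s" using XX[of "Suc i" i] i mem by (intro eqv_right) (auto simp: m2)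
  have "(?x' * ?s - 1 - ?c * ?c') * ?x' = ?x' * (?s * ?x') - ?x' - ?c * (?c' * ?x')" by (simp add: algebra_simps)
  also have "\<dots> \<asymp> ?x' * (?x * ?s + 1 - ?c * ?c') - ?x' - ?c * (- (?x' * ?c'))" by (intro eqv_diff 2 3 eqv_refl)
  also have "\<dots> = (?x' * ?x) * ?s + ((?c * ?x') * ?c' - (?x' * ?c) * ?c')" by (simp add: algebra_simps)
  also have "\<dots> \<asymp> (?x * ?x') * ?s + ((?x' * ?c) * ?c' - (?x' * ?c) * ?c')" by (intro eqv_add eqv_diff 4 5 eqv_refl)
  finally have "?s * ?x * ?x' \<asymp> (?x * ?x') * ?s" using eqv_trans[OF 1] by simp
  then show ?thesis by (simp flip: mon_append)
qed

text \<open>The top monomial is rearranged as (x_i x_(i+1))^(d-1) times powers of the other x_k.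
  Each block commutes with s_i.\<close>

lemma top_S: assumes a: "mset \<alpha> = topm" and i: "1 \<le> i" "i < n"
  shows "mon (S_letter i # map X_letter \<alpha>) \<asymp> mon (map X_letter \<alpha> @ [S_letter i])"
proof -
  let ?p = "\<lambda>m. concat (replicate m [i, Suc i])" and ?r = "filter (\<lambda>k. k \<noteq> i \<and> k \<noteq> Suc i) (toplist n)"
  let ?s = "S_letter i"
  have tl: "set (toplist n) \<subseteq> {1..n}" by (rule set_toplist)
  have p: "mon (?s # map X_letter (?p m)) \<asymp> mon (map X_letter (?p m) @ [?s])" "set (?p m) \<subseteq> {1..n}" for m
  proof (induction m)
    case (Suc m)
    {
      case 1
      have sub: "set (map X_letter (?p m)) \<subseteq> L" using XL[OF Suc(2)] .
      have "mon (?s # map X_letter (?p (Suc m))) = mon ([] @ [?s, X_letter i, X_letter (Suc i)] @ map X_letter (?p m))" by simp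
      also have "\<dots> \<asymp> mon ([] @ [X_letter i, X_letter (Suc i), ?s] @ map X_letter (?p m))"
        using sub i by (intro eqv_ctx S_pair) auto
      also have "\<dots> = mon ([X_letter i, X_letter (Suc i)] @ (?s # map X_letter (?p m)) @ [])" by simp
      also have "\<dots> \<asymp> mon ([X_letter i, X_letter (Suc i)] @ (map X_letter (?p m) @ [?s]) @ [])"
        using i by (intro eqv_ctx Suc(1)) auto
      finally show ?case by simp
    next
      case 2 then show ?case using Suc(2) i by auto
    }
  qed auto
  have r: "mon (map X_letter ?r @ [?s]) \<asymp> mon (?s # map X_letter ?r)"
    using i tl by (intro comm_word) (auto intro!: eqv_sym[OF SX_far])
  have cp: "count (mset (?p m)) k = (if k = i \<or> k = Suc i then m else 0)" for m k
    by (induction m) auto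
  have "mset \<alpha> = mset (?p (d - 1) @ ?r)"
    unfolding a topm_def using i
    by (intro multiset_eqI) (auto simp: cp count_toplist)
  then have eq: "mon (map X_letter \<alpha>) \<asymp> mon (map X_letter (?p (d - 1) @ ?r))"
    using a sub_topm_set[of \<alpha>] by (intro X_perm) auto
  have sub: "set (map X_letter (?p m)) \<subseteq> L" "set (map X_letter ?r) \<subseteq> L" for m
    using XL[OF p(2)] tl by auto
  have "mon (?s # map X_letter \<alpha>) = mon [?s] * mon (map X_letter \<alpha>)" by (simp flip: mon_append)
  also have "\<dots> \<asymp> mon [?s] * mon (map X_letter (?p (d - 1) @ ?r))" using i by (intro eqv_left eq) auto
  also have "\<dots> = mon ([] @ (?s # map X_letter (?p (d - 1))) @ map X_letter ?r)" by (simp flip: mon_append)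
  also have "\<dots> \<asymp> mon ([] @ (map X_letter (?p (d - 1)) @ [?s]) @ map X_letter ?r)" using sub(2) i by (intro eqv_ctx p) auto
  also have "\<dots> = mon (map X_letter (?p (d - 1)) @ (?s # map X_letter ?r) @ [])" by simp
  also have "\<dots> \<asymp> mon (map X_letter (?p (d - 1)) @ (map X_letter ?r @ [?s]) @ [])" by (intro eqv_ctx eqv_sym[OF r] sub) auto
  also have "\<dots> = mon (map X_letter (?p (d - 1) @ ?r)) * mon [?s]" by (simp flip: mon_append)
  also have "\<dots> \<asymp> mon (map X_letter \<alpha>) * mon [?s]" using i by (intro eqv_right eqv_sym[OF eq]) auto
  finally show ?thesis by (simp add: mon_append)
qed

lemma top_l: assumes "mset \<alpha> = topm" "l \<in> Yl"
  obtains e where "e = 1 \<or> e = - 1" "mon [l] * mon (map X_letter \<alpha>) \<asymp> cst e * (mon (map X_letter \<alpha>) * mon [l])"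
  using assms(2)
proof (cases rule: Y_cases)
  case (1 i) then show ?thesis using that[of 1] top_S[OF assms(1)] by (simp flip: mon_append)
next
  case (2 i) 
  have "(- 1 :: 'r) ^ (d - 1) = 1 \<or> (- 1 :: 'r) ^ (d - 1) = - 1" by (metis minus_one_power_iff)
  then show ?thesis using that[of "(- 1) ^ (d - 1)"] top_C[OF assms(1), of i] 2 by (simp flip: mon_append)
qed

text \<open>Letter by letter from \<open>top_l\<close>; the accumulated sign is irrelevant where
  this is applied.\<close>

lemma top_Y: assumes a: "mset \<alpha> = topm" shows "set y \<subseteq> Yl \<Longrightarrow> pm (mon y * mon (map X_letter \<alpha>)) (mon (map X_letter \<alpha>) * mon y)"
proof (induction y)
  case (Cons l y)
  obtain e where e: "e = 1 \<or> e = - 1" "mon [l] * mon (map X_letter \<alpha>) \<asymp> cst e * (mon (map X_letter \<alpha>) * mon [l])"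
    using top_l[OF a] Cons by auto
  then have e': "pm (mon [l] * mon (map X_letter \<alpha>)) (mon (map X_letter \<alpha>) * mon [l])" by (auto simp: pm_def)
  have l: "mon (l # y) = mon [l] * mon y" by (simp flip: mon_append)
  have s: "set y \<subseteq> L" "l \<in> L" using Cons YL by auto
  have "mon (l # y) * mon (map X_letter \<alpha>) = mon [l] * (mon y * mon (map X_letter \<alpha>))" by (simp add: l mult.assoc)
  also have "pm \<dots> (mon [l] * (mon (map X_letter \<alpha>) * mon y))" using Cons s by (intro pm_left) auto
  also have "mon [l] * (mon (map X_letter \<alpha>) * mon y) = (mon [l] * mon (map X_letter \<alpha>)) * mon y" by (simp add: mult.assoc)
  also have "pm \<dots> ((mon (map X_letter \<alpha>) * mon [l]) * mon y)" using s e' by (intro pm_right) auto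
  finally show ?case by (simp add: l mult.assoc)
qed simp

end

section \<open>The trace form\<close>

definition ccount :: "sergeev_letter list \<Rightarrow> nat" where
  "ccount w = length (filter (\<lambda>l. \<exists>i. l = C_letter i) w)"

lemma ccount_simps [simp]: "ccount [] = 0" "ccount (S_letter i # w) = ccount w" "ccount (X_letter i # w) = ccount w"
  "ccount (C_letter i # w) = Suc (ccount w)" "ccount (u @ w) = ccount u + ccount w"
  by (auto simp: ccount_def)

text \<open>\<open>T\<close> reads the coefficient of the top monomial in the span of the words x^A
  y; \<open>T_low\<close> and \<open>T_NF\<close> are the values required.\<close>

locale sergeev_trace = sergeev_ideal n d g J for n d and g :: "'r::idom poly" and J +
  fixes T :: "'r sergeev_free \<Rightarrow> 'r"
  assumes T_add: "T (f + h) = T f + T h" and T_scale: "T (cst r * f) = r * T f"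
    and T_J: "f \<in> J \<Longrightarrow> T f = 0"
    and T_low: "set w \<subseteq> sergeev_letters n \<Longrightarrow> xcount w < n * (d - 1) \<Longrightarrow> T (mon w) = 0"
    and T_NF: "y \<in> NF n \<Longrightarrow> T (mon (xtop (d - 1) n @ y)) = (if y = [] then 1 else 0)"
begin

lemma T_0 [simp]: "T 0 = 0" using T_scale[of 0 0] by simp
lemma T_minus [simp]: "T (- f) = - T f" using T_scale[of "- 1" f] by simp
lemma T_diff: "T (f - h) = T f - T h" using T_add[of f "- h"] by simp
lemma T_eqv: "a \<asymp> b \<Longrightarrow> T a = T b" using T_J[of "a - b"] by (simp add: eqv_def T_diff)
lemma T_pm: "pm a b \<Longrightarrow> T a = T b \<or> T a = - T b" using T_eqv by (fastforce simp: pm_def)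

lemma xcount_map [simp]: "xcount (map X_letter \<alpha>) = length \<alpha>" by (induction \<alpha>) auto
lemma xcount_Y: "set y \<subseteq> Yl \<Longrightarrow> xcount y = 0"
proof (induction y)
  case (Cons l y) then show ?case by (cases l) auto
qed simp

lemma XYL: "set \<alpha> \<subseteq> {1..n} \<Longrightarrow> set y \<subseteq> Yl \<Longrightarrow> set (map X_letter \<alpha> @ y) \<subseteq> L"
  using XL[of \<alpha>] YL by auto

lemma T_M: "f \<in> M k \<Longrightarrow> k \<le> n * (d - 1) \<Longrightarrow> T f = 0"
proof (induction rule: M.induct)
  case (M_word \<alpha> y)
  have "xcount (map X_letter \<alpha> @ y) < n * (d - 1)" using M_word xcount_Y[of y] by simp
  with XYL[of \<alpha> y] M_word show ?case by (intro T_low) auto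
qed (auto simp: T_J T_add T_scale)

text \<open>On the group generated by the letters s and c this is the delta function at the
  identity, taken with sign: \<open>tau_eqv\<close> and \<open>tau_ne\<close>.\<close>

definition tau :: "sergeev_letter list \<Rightarrow> 'r" where "tau y = T (mon (xtop (d - 1) n @ y))"

lemma tau_eqv: "set y \<subseteq> Yl \<Longrightarrow> mon y \<asymp> cst e \<Longrightarrow> tau y = e"
proof -
  assume y: "set y \<subseteq> Yl" "mon y \<asymp> cst e"
  have t: "set (xtop (d - 1) n) \<subseteq> L" unfolding toplist_xtop[symmetric] by (rule XL[OF set_toplist])
  have "mon (xtop (d - 1) n) * mon y \<asymp> mon (xtop (d - 1) n) * cst e" using y(2) t by (intro eqv_left) auto
  then have "T (mon (xtop (d - 1) n) * mon y) = T (cst e * mon (xtop (d - 1) n))" using T_eqv by (simp add: cst_comm)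
  then show ?thesis using T_NF[OF Nil_NF] by (simp add: T_scale tau_def mon_append)
qed

lemma tau_ne: "set y \<subseteq> Yl \<Longrightarrow> \<not> pm (mon y) 1 \<Longrightarrow> tau y = 0"
proof -
  assume y: "set y \<subseteq> Yl" "\<not> pm (mon y) 1"
  obtain z where z: "z \<in> NF n" "pm (mon y) (mon z)" using NF_pm[OF y(1)] by blast
  then have "z \<noteq> []" using y(2) by auto
  have t: "set (xtop (d - 1) n) \<subseteq> L" unfolding toplist_xtop[symmetric] by (rule XL[OF set_toplist])
  have "pm (mon (xtop (d - 1) n) * mon y) (mon (xtop (d - 1) n) * mon z)" using z(2) t by (intro pm_left) auto
  from T_pm[OF this] show ?thesis using T_NF[OF z(1)] \<open>z \<noteq> []\<close> by (simp add: tau_def mon_append)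
qed

lemma pm1E: assumes "pm a 1" obtains e where "e = 1 \<or> e = - 1" "a \<asymp> cst e"
  using assms that[of 1] that[of "- 1"] by (auto simp: pm_def)

text \<open>v u is the conjugate u^(-1) (u v) u, and scalars are central.\<close>

lemma cyc: assumes "set u \<subseteq> Yl" "set v \<subseteq> Yl" "mon (u @ v) \<asymp> cst e" shows "mon (v @ u) \<asymp> cst e"
proof -
  have m: "mon u \<in> Fsub n" "mon v \<in> Fsub n" "mon (rev u) \<in> Fsub n" using assms YL by auto
  have "mon (v @ u) = 1 * mon v * mon u" by (simp add: mon_append)
  also have "\<dots> \<asymp> mon (rev u @ u) * mon v * mon u" using assms m by (intro eqv_right eqv_sym[OF Y_inv']) auto
  also have "\<dots> = mon (rev u) * mon (u @ v) * mon u" by (simp add: mon_append mult.assoc)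
  also have "\<dots> \<asymp> mon (rev u) * cst e * mon u" using assms(3) m by (intro eqv_right eqv_left) auto
  also have "\<dots> = cst e * mon (rev u @ u)" by (metis cst_comm mon_append mult.assoc)
  also have "\<dots> \<asymp> cst e * 1" using assms by (intro eqv_scale Y_inv') auto
  finally show ?thesis by simp
qed

lemma tau_cyc: assumes "set u \<subseteq> Yl" "set v \<subseteq> Yl" shows "tau (u @ v) = tau (v @ u)"
proof (cases "pm (mon (u @ v)) 1")
  case True
  then obtain e where "mon (u @ v) \<asymp> cst e" by (rule pm1E)
  with cyc[OF assms this] assms show ?thesis by (simp add: tau_eqv)
next
  case False
  have "\<not> pm (mon (v @ u)) 1"
  proof
    assume "pm (mon (v @ u)) 1"
    then obtain e where e: "e = 1 \<or> e = - 1" "mon (v @ u) \<asymp> cst e" by (rule pm1E)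
    from cyc[OF assms(2,1) e(2)] e(1) False show False by (auto simp: pm_def)
  qed
  with False assms show ?thesis by (simp add: tau_ne)
qed

lemma T_top: "mset \<alpha> = topm \<Longrightarrow> set y \<subseteq> Yl \<Longrightarrow> T (mon (map X_letter \<alpha>) * mon y) = tau y"
proof -
  assume a: "mset \<alpha> = topm" and y: "set y \<subseteq> Yl"
  have "mon (map X_letter \<alpha>) \<asymp> mon (xtop (d - 1) n)"
    unfolding toplist_xtop[symmetric] using a sub_topm_set[of \<alpha>] by (intro X_perm) (auto simp: topm_def)
  then have "mon (map X_letter \<alpha>) * mon y \<asymp> mon (xtop (d - 1) n) * mon y" using y YL by (intro eqv_right) auto
  then show ?thesis by (simp add: T_eqv tau_def mon_append)
qed

text \<open>Up to the top degree, either some exponent is at least d and the degree falls, or the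
  degree is below the top, or the monomial is the top one and contributes
  \<open>tau y\<close>.\<close>

lemma L0: assumes "set \<alpha> \<subseteq> {1..n}" "length \<alpha> \<le> n * (d - 1)" "set y \<subseteq> Yl" "mset \<alpha> = topm \<Longrightarrow> tau y = 0"
  shows "T (mon (map X_letter \<alpha>) * mon y) = 0"
proof (cases "mset \<alpha> \<subseteq># topm")
  case True
  then consider "length \<alpha> < n * (d - 1)" | "mset \<alpha> = topm" using sub_topm_len by blast
  then show ?thesis
  proof cases
    case 1
    have "mon (map X_letter \<alpha> @ y) \<in> M (n * (d - 1))" using 1 assms by (intro M_word)
    from T_M[OF this] show ?thesis by (simp add: mon_append)
  next
    case 2 then show ?thesis using T_top assms by simp
  qed
next
  case False
  then obtain i where "i \<in> {1..n}" "count (mset \<alpha>) i \<ge> d" using not_sub_topm assms by blast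
  then have "mon (map X_letter \<alpha> @ y) \<in> M (length \<alpha>)" using assms by (intro count_M) auto
  from T_M[OF this assms(2)] show ?thesis by (simp add: mon_append)
qed

text \<open>A letter s or c moves past x_k at the cost of a permuted index, a sign, and terms
  without any x.\<close>

lemma letter_X: assumes l: "l \<in> Yl" and k: "1 \<le> k" "k \<le> n"
  shows "\<exists>k' e. 1 \<le> k' \<and> k' \<le> n \<and> mon [l] * mon [X_letter k] - cst e * (mon [X_letter k'] * mon [l]) \<in> M 1"
  using l
proof (cases rule: Y_cases)
  case (1 i)
  have one: "1 \<in> M 1" using M_word[of "[]" 1 "[]"] by simp
  have cc: "mon [C_letter i, C_letter (Suc i)] \<in> M 1" using M_word[of "[]" 1 "[C_letter i, C_letter (Suc i)]"] 1 by simp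
  have fin: "a - b \<in> M 1" if "a \<asymp> b + r" "r \<in> M 1" for a b r
  proof -
    have "a - b \<asymp> r" using that(1) by (simp add: eqv_def algebra_simps)
    then show ?thesis using that(2) by (rule M_eqv)
  qed
  consider "k = i" | "k = Suc i" | "k \<noteq> i" "k \<noteq> i + 1" by linarith
  then show ?thesis
  proof cases
    case a: 1
    have "mon [l] * mon [X_letter k] - cst 1 * (mon [X_letter (Suc i)] * mon [l]) \<in> M 1"
    proof (rule fin[OF _ M_diff[OF M_minus[OF one] cc]])
      have E: "mon [X_letter (Suc i), S_letter i] - 1 - mon [C_letter i, C_letter (Suc i)] =
          cst 1 * (mon [X_letter (Suc i)] * mon [l]) + (- 1 - mon [C_letter i, C_letter (Suc i)])"
        using 1 by (simp add: m2[of "X_letter (Suc i)"])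
      show "mon [l] * mon [X_letter k] \<asymp>
          cst 1 * (mon [X_letter (Suc i)] * mon [l]) + (- 1 - mon [C_letter i, C_letter (Suc i)])"
        unfolding E[symmetric] using SX[of i] 1 a by (simp add: m2[of "S_letter i"])
    qed
    then show ?thesis using 1 by (intro exI[of _ "Suc i"] exI[of _ 1]) auto
  next
    case a: 2
    have "mon [l] * mon [X_letter k] - cst 1 * (mon [X_letter i] * mon [l]) \<in> M 1"
    proof (rule fin[OF _ M_diff[OF one cc]])
      have E: "mon [X_letter i, S_letter i] + 1 - mon [C_letter i, C_letter (Suc i)] =
          cst 1 * (mon [X_letter i] * mon [l]) + (1 - mon [C_letter i, C_letter (Suc i)])"
        using 1 by (simp add: m2[of "X_letter i"])
      show "mon [l] * mon [X_letter k] \<asymp>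
          cst 1 * (mon [X_letter i] * mon [l]) + (1 - mon [C_letter i, C_letter (Suc i)])"
        unfolding E[symmetric] using SX'[of i] 1 a by (simp add: m2[of "S_letter i"])
    qed
    then show ?thesis using 1 by (intro exI[of _ i] exI[of _ 1]) auto
  next
    case 3
    have "mon [l] * mon [X_letter k] - cst 1 * (mon [X_letter k] * mon [l]) \<in> J"
      using SX_far[of i k] 1 3 k by (simp add: eqv_def m2)
    then show ?thesis using k M_J by blast
  qed
next
  case (2 i)
  have "mon [l] * mon [X_letter k] - cst (if i = k then - 1 else 1) * (mon [X_letter k] * mon [l]) \<in> J"
    using eqv_minus[OF eqv_sym[OF XC[OF k]]] eqv_sym[OF XC_far[of k i]] 2 k by (auto simp: eqv_def m2)
  then show ?thesis using k M_J by blast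
qed

lemma Y_X: "set y \<subseteq> Yl \<Longrightarrow> 1 \<le> j \<Longrightarrow> j \<le> n \<Longrightarrow>
  \<exists>k e. 1 \<le> k \<and> k \<le> n \<and> mon y * mon [X_letter j] - cst e * (mon [X_letter k] * mon y) \<in> M 1"
proof (induction y)
  case Nil
  have "mon [] * mon [X_letter j] - cst 1 * (mon [X_letter j] * mon []) \<in> M 1" by (simp add: M_0)
  then show ?case using Nil by blast
next
  case (Cons l y)
  then obtain k e where k: "1 \<le> k" "k \<le> n" "mon y * mon [X_letter j] - cst e * (mon [X_letter k] * mon y) \<in> M 1" by auto
  obtain k' e' where k': "1 \<le> k'" "k' \<le> n" "mon [l] * mon [X_letter k] - cst e' * (mon [X_letter k'] * mon [l]) \<in> M 1"
    using letter_X[of l k] Cons k by auto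
  have ly: "mon (l # y) = mon [l] * mon y" by (simp flip: mon_append)
  have "mon (l # y) * mon [X_letter j] - cst (e * e') * (mon [X_letter k'] * mon (l # y)) =
      mon [l] * (mon y * mon [X_letter j] - cst e * (mon [X_letter k] * mon y)) +
      cst e * ((mon [l] * mon [X_letter k] - cst e' * (mon [X_letter k'] * mon [l])) * mon y)"
  proof -
    have "cst e * (cst e' * f) = cst e' * (cst e * f)" for f by (metis cst_comm mult.assoc)
    then show ?thesis unfolding ly by (simp add: algebra_simps cst_left_comm)
  qed
  also have "\<dots> \<in> M 1" using k k' Cons by (intro M_add M_Y M_scale M_right) auto
  finally show ?case using k' by blast
qed

text \<open>The twisted trace identity for one element; the twist is 1 for even generators and
  (-1)^(d-1) for c_i. It is stable under products (\<open>tr_mult\<close>), so generators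
  suffice.\<close>

definition tr :: "'r sergeev_free \<Rightarrow> 'r \<Rightarrow> bool" where
  "tr a e \<longleftrightarrow> a \<in> Fsub n \<and> (\<forall>f\<in>Fsub n. T (a * f) = e * T (f * a))"

lemma trI:
  assumes a: "a \<in> Fsub n" and w: "\<And>\<alpha> y. mset \<alpha> \<subseteq># topm \<Longrightarrow> set y \<subseteq> Yl \<Longrightarrow>
    T (a * (mon (map X_letter \<alpha>) * mon y)) = e * T (mon (map X_letter \<alpha>) * mon y * a)"
  shows "tr a e"
proof -
  have "T (a * f) = e * T (f * a)" if "f \<in> B" for f
    using that
  proof (induction rule: B.induct)
    case (B_J f) then show ?case using J_left[OF a] J_right[OF a] by (simp add: T_J)
  next
    case (B_word \<alpha> y) then show ?case using w by (simp add: mon_append)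
  next
    case (B_add f h) then show ?case by (simp add: distrib_left distrib_right T_add)
  next
    case (B_scale f r)
    have "a * (cst r * f) = cst r * (a * f)" by (metis cst_comm mult.assoc)
    then show ?case using B_scale by (simp add: T_scale mult.assoc)
  qed
  then show ?thesis using a Fsub_B by (auto simp: tr_def)
qed

text \<open>Below the top degree both sides vanish. At the top the letter passes the top monomial
  with the factor e, and \<open>tau_cyc\<close> moves it to the other end.\<close>

lemma tr_Y: assumes l: "l \<in> Yl" and e: "\<And>\<alpha>. mset \<alpha> = topm \<Longrightarrow> mon [l] * mon (map X_letter \<alpha>) \<asymp> cst e * (mon (map X_letter \<alpha>) * mon [l])"
  shows "tr (mon [l]) e"
proof (rule trI)
  show lF: "mon [l] \<in> Fsub n" using l YL by auto
  fix \<alpha> y assume a: "mset \<alpha> \<subseteq># topm" and y: "set y \<subseteq> Yl"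
  from sub_topm_len[OF a] show "T (mon [l] * (mon (map X_letter \<alpha>) * mon y)) = e * T (mon (map X_letter \<alpha>) * mon y * mon [l])"
  proof
    assume len: "length \<alpha> < n * (d - 1)"
    have w: "mon (map X_letter \<alpha> @ y) \<in> M (n * (d - 1))" using len y sub_topm_set[OF a] by (intro M_word)
    from T_M[OF M_Y[OF w l]] T_M[OF M_right[OF w, of "[l]"]] l show ?thesis by (simp add: mon_append mult.assoc)
  next
    assume t: "mset \<alpha> = topm"
    have yF: "mon y \<in> Fsub n" using y YL by auto
    have "T (mon [l] * (mon (map X_letter \<alpha>) * mon y)) = T (cst e * (mon (map X_letter \<alpha>) * mon [l]) * mon y)"
      using T_eqv[OF eqv_right[OF yF e[OF t]]] by (simp add: mult.assoc)
    also have "\<dots> = e * T (mon (map X_letter \<alpha>) * mon ([l] @ y))" by (simp only: mult.assoc T_scale mon_append)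
    also have "\<dots> = e * tau ([l] @ y)" using t y l by (subst T_top) auto
    also have "\<dots> = e * tau (y @ [l])" using tau_cyc[of "[l]" y] y l by simp
    also have "\<dots> = e * T (mon (map X_letter \<alpha>) * mon (y @ [l]))" using t y l by (subst T_top) auto
    finally show ?thesis by (simp add: mon_append mult.assoc)
  qed
qed

lemma tr_S: "1 \<le> i \<Longrightarrow> i < n \<Longrightarrow> tr (mon [S_letter i]) 1"
  using top_S by (intro tr_Y) (auto simp flip: mon_append)

lemma tr_C: "1 \<le> i \<Longrightarrow> i \<le> n \<Longrightarrow> tr (mon [C_letter i]) ((- 1) ^ (d - 1))"
  using top_C by (intro tr_Y) (auto simp flip: mon_append)

text \<open>If y is 1 or -1, the factors commute. Otherwise both sides are 0: the y part of every
  top degree term is still y up to sign, on which \<open>tau\<close> vanishes, and multiplying the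
  top monomial by x_1 gives x_1^d, which falls by two degrees and thus below the top.\<close>

lemma tr_X1: "tr (mon [X_letter 1]) 1"
proof (rule trI)
  let ?x = "mon [X_letter 1]"
  show xF: "?x \<in> Fsub n" using n1 by auto
  fix \<alpha> y assume a: "mset \<alpha> \<subseteq># topm" and y: "set y \<subseteq> Yl"
  let ?a = "mon (map X_letter \<alpha>)"
  have as: "set \<alpha> \<subseteq> {1..n}" by (rule sub_topm_set[OF a])
  have aF: "?a \<in> Fsub n" "mon y \<in> Fsub n" using XL[OF as] y YL by auto
  show "T (?x * (?a * mon y)) = 1 * T (?a * mon y * ?x)"
  proof (cases "pm (mon y) 1")
    case True
    then obtain e where e: "mon y \<asymp> cst e" by (rule pm1E)
    have "?x * ?a \<asymp> ?a * ?x" using X_perm[of "1 # \<alpha>" "\<alpha> @ [1]"] as n1 by (simp flip: mon_append)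
    then have 1: "T (?x * ?a) = T (?a * ?x)" by (rule T_eqv)
    have "T (?x * ?a * mon y) = T (?x * ?a * cst e)" by (intro T_eqv eqv_left e Fsub_cl(5) xF aF)
    also have "\<dots> = e * T (?x * ?a)" by (simp add: T_scale flip: cst_comm)
    also have "\<dots> = T (?a * cst e * ?x)" unfolding 1 by (simp add: T_scale mult.assoc flip: cst_comm[of e ?a])
    also have "\<dots> = T (?a * mon y * ?x)" by (intro T_eqv eqv_right eqv_left eqv_sym[OF e] xF aF)
    finally show ?thesis by (simp add: mult.assoc)
  next
    case False
    then have t0: "tau y = 0" using y by (intro tau_ne)
    have 1: "?x * ?a = mon (map X_letter (1 # \<alpha>))" by (simp flip: mon_append)
    from sub_topm_len[OF a] have "T (?x * ?a * mon y) = 0 \<and> T (?a * mon y * ?x) = 0"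
    proof
      assume len: "length \<alpha> < n * (d - 1)"
      \<comment> \<open>Moving x_1 in front of y replaces it by some x_k with a factor e; the
        remainder has lost a letter x, so its total degree stays below the top.\<close>
      obtain k e where k: "1 \<le> k" "k \<le> n" "mon y * ?x - cst e * (mon [X_letter k] * mon y) \<in> M 1"
        using Y_X[OF y, of 1] n1 by auto
      have 2: "?a * mon y * ?x = cst e * (mon (map X_letter (\<alpha> @ [k])) * mon y) + ?a * (mon y * ?x - cst e * (mon [X_letter k] * mon y))"
        by (simp add: algebra_simps cst_left_comm mon_append)
      have "?a * (mon y * ?x - cst e * (mon [X_letter k] * mon y)) \<in> M (xcount (map X_letter \<alpha>) + 1)"
        using XL[OF as] k by (intro M_word_left)
      then have "T (?a * (mon y * ?x - cst e * (mon [X_letter k] * mon y))) = 0" using len by (intro T_M) auto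
      moreover have "T (mon (map X_letter (\<alpha> @ [k])) * mon y) = 0" using as len k y t0 by (intro L0) auto
      moreover have "T (?x * ?a * mon y) = 0" unfolding 1 using as len n1 y t0 by (intro L0) auto
      ultimately show ?thesis unfolding 2 by (simp add: T_add T_scale)
    next
      assume t: "mset \<alpha> = topm"
      have c: "count (mset \<alpha>) 1 = d - 1" using t n1 by (simp add: topm_def count_toplist)
      have len: "length \<alpha> = n * (d - 1)" using t size_topm by (metis size_mset)
      \<comment> \<open>The degree is one above the top and falls by two. A drop by one, as for a
        general x_i, would leave a term of top degree.\<close>
      have "mon (map X_letter (1 # \<alpha>) @ y) \<in> M (length (1 # \<alpha>) - 1)" using as n1 y c by (intro count_M1) auto
      then have m: "mon (map X_letter (1 # \<alpha>) @ y) \<in> M (n * (d - 1))" using len by simp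
      have L: "T (?x * ?a * mon y) = 0" unfolding 1 mon_append[symmetric] using T_M[OF m order_refl] by simp
      have "mon (map X_letter (\<alpha> @ [1]) @ []) \<in> M (length (\<alpha> @ [1]) - 1)" using as n1 c by (intro count_M1) auto
      \<comment> \<open>On the other side y is put in front, which preserves the filtration;
        \<open>top_Y\<close> allows this up to sign, and a vanishing value does not see the
        sign.\<close>
      then have "mon y * (?a * ?x) \<in> M (n * (d - 1))" using len by (intro M_Yword[OF y]) (simp add: mon_append)
      then have "T (mon y * (?a * ?x)) = 0" by (intro T_M) auto
      moreover have "pm (mon y * ?a * ?x) (?a * mon y * ?x)" using top_Y[OF t y] xF by (intro pm_right)
      ultimately have "T (?a * mon y * ?x) = 0" using T_pm[of "mon y * ?a * ?x" "?a * mon y * ?x"] by (auto simp: mult.assoc)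
      with L show ?thesis by blast
    qed
    then show ?thesis by (simp add: mult.assoc)
  qed
qed

lemma tr_mult: "tr a e \<Longrightarrow> tr b e' \<Longrightarrow> tr (a * b) (e * e')"
proof -
  assume a: "tr a e" and b: "tr b e'"
  have "T (a * b * f) = e * e' * T (f * (a * b))" if f: "f \<in> Fsub n" for f
  proof -
    have "T (a * (b * f)) = e * T (b * f * a)" using a b f by (simp add: tr_def)
    also have "b * f * a = b * (f * a)" by (rule mult.assoc)
    also have "T (b * (f * a)) = e' * T (f * a * b)" using a b f by (simp add: tr_def)
    finally show ?thesis by (simp add: mult.assoc)
  qed
  then show ?thesis using a b by (simp add: tr_def)
qed

lemma tr_add: "tr a e \<Longrightarrow> tr b e \<Longrightarrow> tr (a + b) e"
  by (simp add: tr_def distrib_left distrib_right T_add)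

lemma tr_eqv: "a \<asymp> b \<Longrightarrow> a \<in> Fsub n \<Longrightarrow> tr b e \<Longrightarrow> tr a e"
  unfolding tr_def using T_eqv[OF eqv_right] T_eqv[OF eqv_left] by auto

lemma tr_scale: "tr a e \<Longrightarrow> tr (cst r * a) e"
proof -
  assume a: "tr a e"
  have "f * (cst r * a) = cst r * (f * a)" for f by (metis cst_comm mult.assoc)
  with a show ?thesis by (simp add: tr_def T_scale mult.assoc)
qed

text \<open>x_(i+1) = s_i x_i s_i + s_i + c_i s_i c_i, and the twist of c_i occurs twice in the last
  term, hence cancels.\<close>

lemma tr_X: "1 \<le> i \<Longrightarrow> i \<le> n \<Longrightarrow> tr (mon [X_letter i]) 1"
proof (induction i rule: nat_induct_at_least)
  case base show ?case by (rule tr_X1)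
next
  case (Suc i)
  let ?s = "mon [S_letter i]" and ?c = "mon [C_letter i]" and ?c' = "mon [C_letter (Suc i)]"
  let ?x = "mon [X_letter i]" and ?x' = "mon [X_letter (Suc i)]"
  have i: "1 \<le> i" "i < n" using Suc by auto
  have mem: "?s \<in> Fsub n" "?c \<in> Fsub n" "?c' \<in> Fsub n" "?x \<in> Fsub n" "?x' \<in> Fsub n" using i by auto
  have "?x' * ?s \<asymp> ?s * ?x + 1 + ?c * ?c'"
    using eqv_sym[OF eqv_add[OF SX[OF i], of "1 + mon [C_letter i, C_letter (Suc i)]" "1 + mon [C_letter i, C_letter (Suc i)]"]]
    by (simp add: m2 algebra_simps)
  from eqv_right[OF mem(1) this]
  have 1: "?x' * (?s * ?s) \<asymp> ?s * ?x * ?s + ?s + ?c * (?c' * ?s)" by (simp add: algebra_simps)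
  have "?x' * 1 \<asymp> ?x' * (?s * ?s)" using eqv_sym[OF SS[OF i]] mem by (intro eqv_left) (auto simp: m2)
  also note 1
  also have "?s * ?x * ?s + ?s + ?c * (?c' * ?s) \<asymp> ?s * ?x * ?s + ?s + ?c * (?s * ?c)"
    using eqv_sym[OF SC[OF i]] mem by (intro eqv_add eqv_left eqv_refl) (auto simp: m2)
  finally have "?x' \<asymp> ?s * ?x * ?s + ?s + ?c * (?s * ?c)" by simp
  moreover have "tr (?s * ?x * ?s + ?s + ?c * (?s * ?c)) 1"
  proof (intro tr_add)
    have s: "tr ?s 1" using tr_S i by simp
    have c: "tr ?c ((- 1) ^ (d - 1))" using tr_C i by simp
    show "tr (?s * ?x * ?s) 1" using tr_mult[OF tr_mult[OF s Suc.IH] s] i by simp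
    have "((- 1) ^ (d - 1)) * (1 * (- 1) ^ (d - 1)) = (1 :: 'r)" by (simp flip: power_add)
    then show "tr (?c * (?s * ?c)) 1" using tr_mult[OF c tr_mult[OF s c]] by simp
    show "tr ?s 1" by (rule s)
  qed
  ultimately show ?case using mem(5) tr_eqv by blast
qed

theorem trace_word: "set w \<subseteq> L \<Longrightarrow> tr (mon w) (((- 1) ^ (d - 1)) ^ ccount w)"
proof (induction w)
  case Nil then show ?case by (simp add: tr_def)
next
  case (Cons l w)
  have e: "mon (l # w) = mon [l] * mon w" by (simp flip: mon_append)
  have IH: "tr (mon w) (((- 1) ^ (d - 1)) ^ ccount w)" using Cons by simp
  show ?case
  proof (cases l)
    case (S_letter i) then show ?thesis unfolding e using tr_mult[OF tr_S IH, of i] Cons by simp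
  next
    case (X_letter i) then show ?thesis unfolding e using tr_mult[OF tr_X IH, of i] Cons by simp
  next
    case (C_letter i) then show ?thesis unfolding e using tr_mult[OF tr_C IH, of i] Cons by simp
  qed
qed

section \<open>Two dual spanning families\<close>

abbreviation lst :: "nat multiset \<Rightarrow> nat list" where "lst \<equiv> sorted_list_of_multiset"

lemma length_lst [simp]: "length (lst A) = size A"
  by (metis mset_sorted_list_of_multiset size_mset)

text \<open>The pairing partner of x^A y is y^(-1) x^(top - A): their product in this order is the
  top monomial up to lower terms and signs. Exponents are multisets, turned into words through
  sorted lists.\<close>

definition Ix :: "(nat multiset \<times> sergeev_letter list) set" where "Ix = {A. A \<subseteq># topm} \<times> reps"
definition bb :: "nat multiset \<times> sergeev_letter list \<Rightarrow> sergeev_letter list" where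
  "bb i = map X_letter (lst (fst i)) @ snd i"
definition bd :: "nat multiset \<times> sergeev_letter list \<Rightarrow> sergeev_letter list" where
  "bd i = rev (snd i) @ map X_letter (lst (topm - fst i))"

lemma finite_Ix: "finite Ix"
proof -
  have "{A. A \<subseteq># topm} \<subseteq> mset ` {\<alpha>. set \<alpha> \<subseteq> {1..n} \<and> length \<alpha> \<le> n * (d - 1)}"
  proof
    fix A assume "A \<in> {A. A \<subseteq># topm}"
    then have A: "mset (lst A) \<subseteq># topm" by simp
    have "length (lst A) \<le> n * (d - 1)" using size_mset_mono[OF A] by (simp add: size_topm)
    then show "A \<in> mset ` {\<alpha>. set \<alpha> \<subseteq> {1..n} \<and> length \<alpha> \<le> n * (d - 1)}"
      using sub_topm_set[OF A] by (intro image_eqI[of _ _ "lst A"]) (simp_all only: mset_sorted_list_of_multiset mem_Collect_eq simp_thms)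
  qed
  then have "finite {A. A \<subseteq># topm}" by (rule finite_subset) (simp add: finite_lists_length_le)
  then show ?thesis using finite_reps by (simp add: Ix_def)
qed

lemma lst_set: "A \<subseteq># topm \<Longrightarrow> set (lst A) \<subseteq> {1..n}"
  using sub_topm_set[of "lst A"] by simp

lemma bb_L: "i \<in> Ix \<Longrightarrow> set (bb i) \<subseteq> L"
proof -
  assume "i \<in> Ix"
  then have "fst i \<subseteq># topm" "snd i \<in> reps" by (auto simp: Ix_def)
  then show ?thesis unfolding bb_def by (intro XYL lst_set reps_Y)
qed

lemma bd_L: "i \<in> Ix \<Longrightarrow> set (bd i) \<subseteq> L"
proof -
  assume "i \<in> Ix"
  then have "snd i \<in> reps" by (auto simp: Ix_def)
  then have "set (snd i) \<subseteq> L" using reps_Y YL by blast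
  moreover have "set (map X_letter (lst (topm - fst i))) \<subseteq> L" by (intro XL lst_set) simp
  ultimately show ?thesis by (simp add: bd_def)
qed

text \<open>\<open>Fsub_B\<close> with the x part sorted and the group part replaced by its
  representative, up to sign.\<close>

theorem spanning: assumes "f \<in> Fsub n" shows "\<exists>v. f \<asymp> (\<Sum>i\<in>Ix. cst (v i) * mon (bb i))"
proof -
  have "\<exists>v. f \<asymp> (\<Sum>i\<in>Ix. cst (v i) * mon (bb i))" if "f \<in> B" for f
    using that
  proof (induction rule: B.induct)
    case (B_J f)
    then have "f \<asymp> (\<Sum>i\<in>Ix. cst 0 * mon (bb i))" by (simp add: eqv_def)
    then show ?case by (intro exI[of _ "\<lambda>_. 0"])
  next
    case (B_word \<alpha> y)
    obtain z where z: "z \<in> reps" "pm (mon y) (mon z)" using reps_ex[OF B_word(2)] by blast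
    let ?i = "(mset \<alpha>, z)"
    have i: "?i \<in> Ix" using z B_word by (simp add: Ix_def)
    have as: "set \<alpha> \<subseteq> {1..n}" by (rule sub_topm_set[OF B_word(1)])
    obtain e where e: "mon y \<asymp> cst e * mon z"
      using z(2) by (auto simp: pm_def dest: that[of 1, simplified] that[of "- 1", simplified])
    have zF: "mon z \<in> Fsub n" using reps_Y[OF z(1)] YL by auto
    have aF: "mon (map X_letter \<alpha>) \<in> Fsub n" using XL[OF as] by auto
    have "mon (map X_letter \<alpha> @ y) \<asymp> mon (map X_letter \<alpha>) * (cst e * mon z)" unfolding mon_append by (intro eqv_left aF e)
    also have "\<dots> = cst e * (mon (map X_letter \<alpha>) * mon z)" by (rule cst_left_comm)
    also have "\<dots> \<asymp> cst e * (mon (map X_letter (lst (mset \<alpha>))) * mon z)" using as by (intro eqv_scale eqv_right zF X_perm) auto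
    also have "\<dots> = (\<Sum>i\<in>Ix. cst (if i = ?i then e else 0) * mon (bb i))"
    proof -
      have "(\<Sum>i\<in>Ix. cst (if i = ?i then e else 0) * mon (bb i)) = (\<Sum>i\<in>Ix. if i = ?i then cst e * mon (bb ?i) else 0)"
        by (intro sum.cong) auto
      also have "\<dots> = cst e * mon (bb ?i)" using i finite_Ix by (subst sum.delta) auto
      finally show ?thesis by (simp add: bb_def mon_append)
    qed
    finally show ?case by (intro exI[of _ "\<lambda>i. if i = ?i then e else 0"])
  next
    case (B_add f h)
    then obtain v w where "f \<asymp> (\<Sum>i\<in>Ix. cst (v i) * mon (bb i))" "h \<asymp> (\<Sum>i\<in>Ix. cst (w i) * mon (bb i))" by blast
    from eqv_add[OF this] have "f + h \<asymp> (\<Sum>i\<in>Ix. cst (v i + w i) * mon (bb i))" by (simp add: distrib_right sum.distrib)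
    then show ?case by (intro exI[of _ "\<lambda>i. v i + w i"])
  next
    case (B_scale f r)
    then obtain v where "f \<asymp> (\<Sum>i\<in>Ix. cst (v i) * mon (bb i))" by blast
    from eqv_scale[OF this, of r] have "cst r * f \<asymp> (\<Sum>i\<in>Ix. cst (r * v i) * mon (bb i))" by (simp add: sum_distrib_left mult.assoc)
    then show ?case by (intro exI[of _ "\<lambda>i. r * v i"])
  qed
  then show ?thesis using Fsub_B[OF assms] .
qed

text \<open>The x part of the product has degree n(d-1) - |A| + |C|, at most the top. If it is
  smaller, or if some exponent reaches d, the value is 0. If it is the top monomial, then C = A, and
  \<open>tau\<close> vanishes on y^(-1) z because y and z represent different classes.\<close>

lemma gram_off:
  assumes i: "i \<in> Ix" and j: "j \<in> Ix" and le: "size (fst j) \<le> size (fst i)" and ne: "size (fst j) = size (fst i) \<Longrightarrow> i \<noteq> j"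
  shows "T (mon (bd i) * mon (bb j)) = 0"
proof -
  obtain A y where iA: "i = (A, y)" by (cases i)
  obtain C z where jC: "j = (C, z)" by (cases j)
  have A: "A \<subseteq># topm" "C \<subseteq># topm" and yz: "y \<in> reps" "z \<in> reps" using i j by (auto simp: iA jC Ix_def)
  have Y: "set (rev y) \<subseteq> Yl" "set z \<subseteq> Yl" using yz reps_Y by auto
  let ?\<alpha> = "lst (topm - A) @ lst C"
  have as: "set ?\<alpha> \<subseteq> {1..n}" using lst_set[of "topm - A"] lst_set[OF A(2)] by auto
  have ms: "mset ?\<alpha> = topm - A + C" by simp
  have len: "length ?\<alpha> = n * (d - 1) - size A + size C"
    using arg_cong[OF ms, of size] A by (simp add: size_Diff_submset size_topm)
  have sA: "size A \<le> n * (d - 1)" using size_mset_mono[OF A(1)] by (simp add: size_topm)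
  have w: "mon (bd i) * mon (bb j) = mon (rev y) * (mon (map X_letter ?\<alpha> @ z))"
    by (simp add: bd_def bb_def iA jC mon_append mult.assoc)
  have inM: "T (mon (bd i) * mon (bb j)) = 0" if "mon (map X_letter ?\<alpha> @ z) \<in> M (n * (d - 1))"
    unfolding w using T_M[OF M_Yword[OF Y(1) that]] by simp
  show ?thesis
  proof (cases "size C < size A")
    case True
    then have "length ?\<alpha> < n * (d - 1)" using len sA by simp
    then show ?thesis by (intro inM M_word as Y)
  next
    case False
    then have sz: "size C = size A" using le by (simp add: iA jC)
    then have len': "length ?\<alpha> = n * (d - 1)" using len sA by simp
    show ?thesis
    proof (cases "mset ?\<alpha> \<subseteq># topm")
      case False
      then obtain k where "k \<in> {1..n}" "count (mset ?\<alpha>) k \<ge> d" using not_sub_topm[OF as] by blast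
      from count_M[OF as Y(2) this] show ?thesis unfolding len' by (rule inM)
    next
      case True
      then have top: "mset ?\<alpha> = topm" using sub_topm_len[of ?\<alpha>] len' by auto
      then have "topm - A + C = topm - A + A" using A by (simp add: subset_mset.diff_add)
      then have "C = A" by simp
      then have "y \<noteq> z" using ne sz by (auto simp: iA jC)
      have zF: "mon z \<in> Fsub n" "mon (rev y) \<in> Fsub n" "mon y \<in> Fsub n" using Y YL by auto
      have pmX: "pm (mon (rev y) * mon (map X_letter ?\<alpha>) * mon z) (mon (map X_letter ?\<alpha>) * mon (rev y) * mon z)"
        using top_Y[OF top Y(1)] zF by (intro pm_right)
      have top': "T (mon (map X_letter ?\<alpha>) * mon (rev y @ z)) = tau (rev y @ z)" using Y by (intro T_top top) auto
      \<comment> \<open>Otherwise multiplication by y on the left would make z and y congruent up to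
        sign.\<close>
      have "\<not> pm (mon (rev y @ z)) 1"
      proof
        assume "pm (mon (rev y @ z)) 1"
        then have 1: "pm (mon y * mon (rev y @ z)) (mon y * 1)" using zF by (intro pm_left)
        have "mon (y @ rev y) * mon z \<asymp> 1 * mon z" using Y zF by (intro eqv_right Y_inv) auto
        then have "pm (mon z) (mon y * mon (rev y @ z))" by (intro pm_sym[OF pm_eqv]) (simp add: mon_append mult.assoc)
        with 1 have "pm (mon z) (mon y)" using pm_trans by simp
        then show False using reps_unique[OF yz(2,1)] \<open>y \<noteq> z\<close> by simp
      qed
      then have "tau (rev y @ z) = 0" using Y by (intro tau_ne) auto
      with top' have "T (mon (map X_letter ?\<alpha>) * mon (rev y) * mon z) = 0" by (simp add: mon_append mult.assoc)
      with T_pm[OF pmX] have "T (mon (rev y) * mon (map X_letter ?\<alpha>) * mon z) = 0" by simp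
      then show ?thesis unfolding w by (simp add: mon_append mult.assoc)
    qed
  qed
qed

text \<open>Here the product is the top monomial between y^(-1) and y, so the value is
  \<open>tau\<close> of the identity up to the sign of moving y^(-1) past the monomial.\<close>

lemma gram_diag:
  assumes i: "i \<in> Ix" shows "T (mon (bd i) * mon (bb i)) = 1 \<or> T (mon (bd i) * mon (bb i)) = - 1"
proof -
  obtain A y where iA: "i = (A, y)" by (cases i)
  have A: "A \<subseteq># topm" and y: "set y \<subseteq> Yl" using i reps_Y by (auto simp: iA Ix_def)
  let ?\<alpha> = "lst (topm - A) @ lst A"
  have top: "mset ?\<alpha> = topm" using A by simp
  have w: "mon (bd i) * mon (bb i) = mon (rev y) * mon (map X_letter ?\<alpha>) * mon y"
    by (simp add: bd_def bb_def iA mon_append mult.assoc)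
  have pmX: "pm (mon (rev y) * mon (map X_letter ?\<alpha>) * mon y) (mon (map X_letter ?\<alpha>) * mon (rev y) * mon y)"
    using top_Y[OF top, of "rev y"] y YL by (intro pm_right) auto
  have "T (mon (map X_letter ?\<alpha>) * mon (rev y @ y)) = tau (rev y @ y)" using y by (intro T_top top) auto
  moreover have "tau (rev y @ y) = 1" using Y_inv'[OF y] y by (intro tau_eqv) auto
  ultimately have "T (mon (map X_letter ?\<alpha>) * mon (rev y) * mon y) = 1" by (simp add: mon_append mult.assoc)
  with T_pm[OF pmX] show ?thesis unfolding w by metis
qed

end

section \<open>Quotients of the free superalgebra as images of the free algebra\<close>

lemma ring_of_type_simps [simp]:
  "carrier ring_of_type_algebra = UNIV" "r \<oplus>\<^bsub>ring_of_type_algebra\<^esub> q = r + q" "r \<otimes>\<^bsub>ring_of_type_algebra\<^esub> q = r * q"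
  "\<one>\<^bsub>ring_of_type_algebra\<^esub> = 1" "\<zero>\<^bsub>ring_of_type_algebra\<^esub> = 0"
  by (simp_all add: ring_of_type_algebra_def)

definition Gr :: "nat \<Rightarrow> bit \<Rightarrow> 'r::comm_ring_1 sergeev_free set" where
  "Gr n p = {f. \<forall>w\<in>Poly_Mapping.keys f. set (letters w) \<subseteq> sergeev_letters n \<and> sum_list (map sergeev_parity (letters w)) = p}"

lemma Gr_Fsub: "f \<in> Gr n p \<Longrightarrow> f \<in> Fsub n" by (auto simp: Gr_def Fsub_def)

lemma Gr_0 [simp]: "0 \<in> Gr n p" by (simp add: Gr_def)

lemma Gr_add: "f \<in> Gr n p \<Longrightarrow> h \<in> Gr n p \<Longrightarrow> f + h \<in> Gr n p"
  using keys_add[of f h] by (auto simp: Gr_def)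

lemma Gr_mult: assumes "f \<in> Gr n p" "h \<in> Gr n q" shows "f * h \<in> Gr n (p + q)"
  unfolding Gr_def
proof (intro CollectI ballI)
  fix w assume "w \<in> Poly_Mapping.keys (f * h)"
  then obtain u v where w: "w = u + v" "u \<in> Poly_Mapping.keys f" "v \<in> Poly_Mapping.keys h" using keys_mult[of f h] by blast
  have u: "set (letters u) \<subseteq> sergeev_letters n" "sum_list (map sergeev_parity (letters u)) = p" using assms(1) w(2) by (auto simp: Gr_def)
  have v: "set (letters v) \<subseteq> sergeev_letters n" "sum_list (map sergeev_parity (letters v)) = q" using assms(2) w(3) by (auto simp: Gr_def)
  show "set (letters w) \<subseteq> sergeev_letters n \<and> sum_list (map sergeev_parity (letters w)) = p + q"
    using u v by (simp add: w(1) plus_free_monoid_def)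
qed

lemma Gr_cst: "cst r \<in> Gr n 0"
  by (auto simp: Gr_def cst_def zero_free_monoid_def split: if_splits)

lemma Gr_1: "1 \<in> Gr n 0" using Gr_cst[of 1 n] by simp

lemma Gr_scale: "f \<in> Gr n p \<Longrightarrow> cst r * f \<in> Gr n p"
  using Gr_mult[OF Gr_cst, of f n p r] unfolding add_0_left .

lemma Gr_minus: "f \<in> Gr n p \<Longrightarrow> - f \<in> Gr n p"
  using Gr_scale[of f n p "- 1"] by simp

lemma Gr_mon: "set w \<subseteq> sergeev_letters n \<Longrightarrow> mon w \<in> Gr n (sum_list (map sergeev_parity w))"
  by (auto simp: Gr_def mon_def split: if_splits)

text \<open>Every word is homogeneous, so the splitting extends from words by linearity.\<close>

lemma Fsub_split: "f \<in> Fsub n \<Longrightarrow> \<exists>f0\<in>Gr n 0. \<exists>f1\<in>Gr n 1. f = f0 + f1"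
proof (induction rule: Fsub_induct)
  case zero then show ?case by (intro bexI[of _ 0]) auto
next
  case (mon w)
  show ?case
  proof (cases "sum_list (map sergeev_parity w) = 0")
    case True then show ?thesis using Gr_mon[OF mon] by (intro bexI[of _ "mon w"] bexI[of _ 0]) auto
  next
    case False
    then have "sum_list (map sergeev_parity w) = 1" by simp
    then show ?thesis using Gr_mon[OF mon] by (intro bexI[of _ "mon w"] bexI[of _ 0]) auto
  qed
next
  case (add f h)
  then obtain f0 f1 h0 h1 where "f0 \<in> Gr n 0" "f1 \<in> Gr n 1" "f = f0 + f1" "h0 \<in> Gr n 0" "h1 \<in> Gr n 1" "h = h0 + h1" by blast
  then show ?case by (intro bexI[of _ "f0 + h0"] bexI[of _ "f1 + h1"] Gr_add) auto
next
  case (scale r f)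
  then obtain f0 f1 where "f0 \<in> Gr n 0" "f1 \<in> Gr n 1" "f = f0 + f1" by blast
  then show ?case by (intro bexI[of _ "cst r * f0"] bexI[of _ "cst r * f1"] Gr_scale) (auto simp: distrib_left)
qed

lemma F_simps:
  "carrier (sergeev_free_superalgebra n) = Fsub n" "f \<oplus>\<^bsub>sergeev_free_superalgebra n\<^esub> h = f + h"
  "f \<otimes>\<^bsub>sergeev_free_superalgebra n\<^esub> h = f * h" "\<one>\<^bsub>sergeev_free_superalgebra n\<^esub> = 1" "\<zero>\<^bsub>sergeev_free_superalgebra n\<^esub> = 0"
  "r \<odot>\<^bsub>sergeev_free_superalgebra n\<^esub> f = cst r * f" "grade (sergeev_free_superalgebra n) p = Gr n p"
  by (simp_all add: sergeev_free_superalgebra_def free_superalgebra_def Fsub_def Gr_def cst_def)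

text \<open>A structure all of whose operations are computed on representatives in the free algebra.
  The free algebra is an instance, and quotients of instances are instances, so the affine and then
  the cyclotomic algebra are reached in two steps.\<close>

locale free_image =
  fixes A :: "('r::comm_ring_1, 'a, 'm) superalgebra_scheme" and n :: nat and \<pi> :: "'r sergeev_free \<Rightarrow> 'a"
  assumes carr: "carrier A = \<pi> ` Fsub n"
    and \<pi>_add: "f \<in> Fsub n \<Longrightarrow> h \<in> Fsub n \<Longrightarrow> \<pi> f \<oplus>\<^bsub>A\<^esub> \<pi> h = \<pi> (f + h)"
    and \<pi>_mult: "f \<in> Fsub n \<Longrightarrow> h \<in> Fsub n \<Longrightarrow> \<pi> f \<otimes>\<^bsub>A\<^esub> \<pi> h = \<pi> (f * h)"
    and \<pi>_one: "\<one>\<^bsub>A\<^esub> = \<pi> 1" and \<pi>_zero: "\<zero>\<^bsub>A\<^esub> = \<pi> 0"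
    and \<pi>_smult: "f \<in> Fsub n \<Longrightarrow> r \<odot>\<^bsub>A\<^esub> \<pi> f = \<pi> (cst r * f)"
    and \<pi>_grade: "grade A p = \<pi> ` Gr n p"
begin

lemma \<pi>_in [simp]: "f \<in> Fsub n \<Longrightarrow> \<pi> f \<in> carrier A" by (simp add: carr)

lemma carrE: assumes "a \<in> carrier A" obtains f where "f \<in> Fsub n" "a = \<pi> f"
  using assms by (auto simp: carr)

lemma abelian_group_A: "abelian_group A"
proof (rule abelian_groupI)
  fix x y z assume "x \<in> carrier A" "y \<in> carrier A" "z \<in> carrier A"
  then obtain f h k where "f \<in> Fsub n" "x = \<pi> f" "h \<in> Fsub n" "y = \<pi> h" "k \<in> Fsub n" "z = \<pi> k" by (metis carrE)
  then show "x \<oplus>\<^bsub>A\<^esub> y \<oplus>\<^bsub>A\<^esub> z = x \<oplus>\<^bsub>A\<^esub> (y \<oplus>\<^bsub>A\<^esub> z)" "x \<oplus>\<^bsub>A\<^esub> y = y \<oplus>\<^bsub>A\<^esub> x" "x \<oplus>\<^bsub>A\<^esub> y \<in> carrier A"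
    by (simp_all add: \<pi>_add ac_simps)
next
  show "\<zero>\<^bsub>A\<^esub> \<in> carrier A" by (simp add: \<pi>_zero)
next
  fix x assume "x \<in> carrier A"
  then obtain f where f: "f \<in> Fsub n" "x = \<pi> f" by (metis carrE)
  then show "\<zero>\<^bsub>A\<^esub> \<oplus>\<^bsub>A\<^esub> x = x" by (simp add: \<pi>_zero \<pi>_add)
  show "\<exists>y\<in>carrier A. y \<oplus>\<^bsub>A\<^esub> x = \<zero>\<^bsub>A\<^esub>" using f by (intro bexI[of _ "\<pi> (- f)"]) (simp_all add: \<pi>_zero \<pi>_add)
qed

lemma ring_A: "ring A"
proof (rule ringI[OF abelian_group_A])
  show "Group.monoid A"
  proof (rule monoidI)
    fix x y z assume "x \<in> carrier A" "y \<in> carrier A" "z \<in> carrier A"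
    then obtain f h k where "f \<in> Fsub n" "x = \<pi> f" "h \<in> Fsub n" "y = \<pi> h" "k \<in> Fsub n" "z = \<pi> k" by (metis carrE)
    then show "x \<otimes>\<^bsub>A\<^esub> y \<otimes>\<^bsub>A\<^esub> z = x \<otimes>\<^bsub>A\<^esub> (y \<otimes>\<^bsub>A\<^esub> z)" "x \<otimes>\<^bsub>A\<^esub> y \<in> carrier A" by (simp_all add: \<pi>_mult mult.assoc)
  next
    show "\<one>\<^bsub>A\<^esub> \<in> carrier A" by (simp add: \<pi>_one)
  next
    fix x assume "x \<in> carrier A"
    then obtain f where "f \<in> Fsub n" "x = \<pi> f" by (metis carrE)
    then show "\<one>\<^bsub>A\<^esub> \<otimes>\<^bsub>A\<^esub> x = x" "x \<otimes>\<^bsub>A\<^esub> \<one>\<^bsub>A\<^esub> = x" by (simp_all add: \<pi>_one \<pi>_mult)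
  qed
next
  fix x y z assume "x \<in> carrier A" "y \<in> carrier A" "z \<in> carrier A"
  then obtain f h k where "f \<in> Fsub n" "x = \<pi> f" "h \<in> Fsub n" "y = \<pi> h" "k \<in> Fsub n" "z = \<pi> k" by (metis carrE)
  then show "(x \<oplus>\<^bsub>A\<^esub> y) \<otimes>\<^bsub>A\<^esub> z = x \<otimes>\<^bsub>A\<^esub> z \<oplus>\<^bsub>A\<^esub> y \<otimes>\<^bsub>A\<^esub> z" "z \<otimes>\<^bsub>A\<^esub> (x \<oplus>\<^bsub>A\<^esub> y) = z \<otimes>\<^bsub>A\<^esub> x \<oplus>\<^bsub>A\<^esub> z \<otimes>\<^bsub>A\<^esub> y"
    by (simp_all add: \<pi>_mult \<pi>_add distrib_left distrib_right)
qed

lemma \<pi>_minus: "f \<in> Fsub n \<Longrightarrow> \<ominus>\<^bsub>A\<^esub> \<pi> f = \<pi> (- f)"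
proof -
  interpret ring A by (rule ring_A)
  assume f: "f \<in> Fsub n"
  then have "\<pi> (- f) \<oplus>\<^bsub>A\<^esub> \<pi> f = \<zero>\<^bsub>A\<^esub>" by (simp add: \<pi>_add \<pi>_zero)
  then show ?thesis using f by (intro minus_equality) auto
qed

lemma \<pi>_eq_iff: "f \<in> Fsub n \<Longrightarrow> h \<in> Fsub n \<Longrightarrow> \<pi> f = \<pi> h \<longleftrightarrow> \<pi> (f - h) = \<pi> 0"
proof -
  interpret ring A by (rule ring_A)
  assume f: "f \<in> Fsub n" "h \<in> Fsub n"
  have "\<pi> (f - h) = \<pi> f \<oplus>\<^bsub>A\<^esub> \<ominus>\<^bsub>A\<^esub> \<pi> h" using f by (simp add: \<pi>_minus \<pi>_add)
  then show ?thesis using f by (metis \<pi>_in \<pi>_zero r_right_minus_eq minus_eq)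
qed

lemma \<pi>_pow: "f \<in> Fsub n \<Longrightarrow> \<pi> f [^]\<^bsub>A\<^esub> (k::nat) = \<pi> (f ^ k)"
proof -
  interpret ring A by (rule ring_A)
  assume f: "f \<in> Fsub n"
  have "f ^ k \<in> Fsub n" for k using f by (induction k) auto
  then show ?thesis using f by (induction k) (simp_all add: \<pi>_one \<pi>_mult power_commutes)
qed

lemma \<pi>_finsum: assumes "finite I" "\<And>i. i \<in> I \<Longrightarrow> f i \<in> Fsub n"
  shows "(\<Oplus>\<^bsub>A\<^esub>i\<in>I. \<pi> (f i)) = \<pi> (\<Sum>i\<in>I. f i) \<and> (\<Sum>i\<in>I. f i) \<in> Fsub n"
proof -
  interpret ring A by (rule ring_A)
  show ?thesis using assms
    by (induction I rule: finite_induct) (simp_all add: \<pi>_zero \<pi>_add)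
qed

text \<open>Cosets compose with the old projection; the scalar action deserves care because it is
  defined by a union over the coset.\<close>

lemma quotient_image:
  assumes I: "ideal I A"
  shows "free_image (quot_superalgebra A I) n (\<lambda>f. I +>\<^bsub>A\<^esub> \<pi> f)"
proof -
  interpret ring A by (rule ring_A)
  interpret ideal I A by (rule I)
  let ?Q = "quot_superalgebra A I"
  show ?thesis
  proof
    show "carrier ?Q = (\<lambda>f. I +>\<^bsub>A\<^esub> \<pi> f) ` Fsub n"
      by (auto simp: quot_superalgebra_def FactRing_def A_RCOSETS_def' carr)
  next
    fix f h :: "'r sergeev_free" assume f: "f \<in> Fsub n" "h \<in> Fsub n"
    show "(I +>\<^bsub>A\<^esub> \<pi> f) \<oplus>\<^bsub>?Q\<^esub> (I +>\<^bsub>A\<^esub> \<pi> h) = I +>\<^bsub>A\<^esub> \<pi> (f + h)"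
      using f by (simp add: quot_superalgebra_def FactRing_def a_rcos_sum \<pi>_add)
    show "(I +>\<^bsub>A\<^esub> \<pi> f) \<otimes>\<^bsub>?Q\<^esub> (I +>\<^bsub>A\<^esub> \<pi> h) = I +>\<^bsub>A\<^esub> \<pi> (f * h)"
      using f by (simp add: quot_superalgebra_def FactRing_def rcoset_mult_add \<pi>_mult)
  next
    show "\<one>\<^bsub>?Q\<^esub> = I +>\<^bsub>A\<^esub> \<pi> 1" by (simp add: quot_superalgebra_def FactRing_def \<pi>_one)
    show "\<zero>\<^bsub>?Q\<^esub> = I +>\<^bsub>A\<^esub> \<pi> 0" using a_coset_add_zero[OF a_subset] by (simp add: quot_superalgebra_def FactRing_def \<pi>_zero)
    show "grade ?Q p = (\<lambda>f. I +>\<^bsub>A\<^esub> \<pi> f) ` Gr n p" for p by (auto simp: quot_superalgebra_def \<pi>_grade)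
  next
    fix f :: "'r sergeev_free" and r assume f: "f \<in> Fsub n"
    \<comment> \<open>All members of the union coincide: scaling by r is multiplication by the image
      of the constant r, which maps the ideal into itself.\<close>
    have "I +>\<^bsub>A\<^esub> (r \<odot>\<^bsub>A\<^esub> y) = I +>\<^bsub>A\<^esub> \<pi> (cst r * f)" if y: "y \<in> I +>\<^bsub>A\<^esub> \<pi> f" for y
    proof -
      obtain i where i: "i \<in> I" "y = i \<oplus>\<^bsub>A\<^esub> \<pi> f" using y by (auto simp: a_r_coset_def')
      obtain k where k: "k \<in> Fsub n" "i = \<pi> k" using i a_Hcarr by (metis carrE)
      have "r \<odot>\<^bsub>A\<^esub> y = \<pi> (cst r) \<otimes>\<^bsub>A\<^esub> i \<oplus>\<^bsub>A\<^esub> \<pi> (cst r * f)"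
        using f k by (simp add: i(2) \<pi>_add \<pi>_smult \<pi>_mult distrib_left)
      moreover have "\<pi> (cst r) \<otimes>\<^bsub>A\<^esub> i \<in> I" using i by (intro I_l_closed) auto
      ultimately have "r \<odot>\<^bsub>A\<^esub> y \<in> I +>\<^bsub>A\<^esub> \<pi> (cst r * f)" by (auto simp: a_r_coset_def')
      then show ?thesis using f a_repr_independence'[of _ "\<pi> (cst r * f)"] by simp
    qed
    moreover have "\<pi> f \<in> I +>\<^bsub>A\<^esub> \<pi> f" using f by (intro a_rcos_self) auto
    ultimately have "(\<Union>y\<in>I +>\<^bsub>A\<^esub> \<pi> f. I +>\<^bsub>A\<^esub> (r \<odot>\<^bsub>A\<^esub> y)) = I +>\<^bsub>A\<^esub> \<pi> (cst r * f)" by blast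
    then show "r \<odot>\<^bsub>?Q\<^esub> (I +>\<^bsub>A\<^esub> \<pi> f) = I +>\<^bsub>A\<^esub> \<pi> (cst r * f)" by (simp add: quot_superalgebra_def)
  qed
qed

lemma quotient_eq_zero:
  assumes I: "ideal I A" and f: "f \<in> Fsub n"
  shows "I +>\<^bsub>A\<^esub> \<pi> f = I +>\<^bsub>A\<^esub> \<pi> 0 \<longleftrightarrow> \<pi> f \<in> I"
proof -
  interpret ring A by (rule ring_A)
  interpret ideal I A by (rule I)
  have "I +>\<^bsub>A\<^esub> \<pi> 0 = I" using a_coset_add_zero[OF a_subset] by (simp add: \<pi>_zero)
  then show ?thesis using a_rcos_self[of "\<pi> f"] a_rcos_const[of "\<pi> f"] f by auto
qed

text \<open>All axioms descend from the free algebra except that the two graded parts meet in 0,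
  which depends on the kernel and is the hypothesis.\<close>

lemma superalgebra_A:
  assumes graded: "\<And>f0 f1. f0 \<in> Gr n 0 \<Longrightarrow> f1 \<in> Gr n 1 \<Longrightarrow> \<pi> f0 = \<pi> f1 \<Longrightarrow> \<pi> f0 = \<pi> 0"
  shows "superalgebra A"
proof -
  interpret ring A by (rule ring_A)
  have module: "module (ring_of_type_algebra :: 'r ring) A"
  proof (rule moduleI)
    show "cring (ring_of_type_algebra :: 'r ring)" by (rule cring_from_type_algebra)
    show "abelian_group A" by (rule abelian_group_A)
  next
    fix r q :: 'r and x y assume "x \<in> carrier A" "y \<in> carrier A"
    then obtain f h where "f \<in> Fsub n" "x = \<pi> f" "h \<in> Fsub n" "y = \<pi> h" by (metis carrE)
    then show "r \<odot>\<^bsub>A\<^esub> x \<in> carrier A" "(r \<oplus>\<^bsub>ring_of_type_algebra\<^esub> q) \<odot>\<^bsub>A\<^esub> x = r \<odot>\<^bsub>A\<^esub> x \<oplus>\<^bsub>A\<^esub> q \<odot>\<^bsub>A\<^esub> x"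
      "r \<odot>\<^bsub>A\<^esub> (x \<oplus>\<^bsub>A\<^esub> y) = r \<odot>\<^bsub>A\<^esub> x \<oplus>\<^bsub>A\<^esub> r \<odot>\<^bsub>A\<^esub> y" "(r \<otimes>\<^bsub>ring_of_type_algebra\<^esub> q) \<odot>\<^bsub>A\<^esub> x = r \<odot>\<^bsub>A\<^esub> (q \<odot>\<^bsub>A\<^esub> x)"
      "\<one>\<^bsub>ring_of_type_algebra :: 'r ring\<^esub> \<odot>\<^bsub>A\<^esub> x = x"
      by (simp_all add: \<pi>_smult \<pi>_add distrib_right distrib_left mult.assoc)
  qed
  have GrF: "f \<in> Gr n p \<Longrightarrow> f \<in> Fsub n" for f p by (rule Gr_Fsub)
  show ?thesis
  proof (intro superalgebra.intro superalgebra_axioms.intro module ring_A)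
    fix r and x y assume "x \<in> carrier A" "y \<in> carrier A"
    then obtain f h where f: "f \<in> Fsub n" "x = \<pi> f" "h \<in> Fsub n" "y = \<pi> h" by (metis carrE)
    then show "(r \<odot>\<^bsub>A\<^esub> x) \<otimes>\<^bsub>A\<^esub> y = r \<odot>\<^bsub>A\<^esub> (x \<otimes>\<^bsub>A\<^esub> y)" by (simp add: \<pi>_smult \<pi>_mult mult.assoc)
    have "f * (cst r * h) = cst r * (f * h)" by (metis cst_comm mult.assoc)
    with f show "x \<otimes>\<^bsub>A\<^esub> (r \<odot>\<^bsub>A\<^esub> y) = r \<odot>\<^bsub>A\<^esub> (x \<otimes>\<^bsub>A\<^esub> y)" by (simp add: \<pi>_smult \<pi>_mult)
  next
    fix p
    show "submodule (grade A p) (ring_of_type_algebra :: 'r ring) A"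
    proof (rule module.submoduleI[OF module])
      show "grade A p \<subseteq> carrier A" unfolding \<pi>_grade using GrF \<pi>_in by (intro image_subsetI) blast
      show "\<zero>\<^bsub>A\<^esub> \<in> grade A p" by (auto simp: \<pi>_grade \<pi>_zero)
      fix a assume "a \<in> grade A p"
      then obtain f where f: "f \<in> Gr n p" "a = \<pi> f" by (auto simp: \<pi>_grade)
      show "\<ominus>\<^bsub>A\<^esub> a \<in> grade A p" using \<pi>_minus[OF GrF[OF f(1)]] Gr_minus[OF f(1)] by (simp add: \<pi>_grade f(2))
      show "r \<odot>\<^bsub>A\<^esub> a \<in> grade A p" for r using \<pi>_smult[OF GrF[OF f(1)]] Gr_scale[OF f(1)] by (simp add: \<pi>_grade f(2))
      fix b assume "b \<in> grade A p"
      then obtain h where h: "h \<in> Gr n p" "b = \<pi> h" by (auto simp: \<pi>_grade)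
      show "a \<oplus>\<^bsub>A\<^esub> b \<in> grade A p" using \<pi>_add[OF GrF[OF f(1)] GrF[OF h(1)]] Gr_add[OF f(1) h(1)] by (simp add: \<pi>_grade f(2) h(2))
    qed
  next
    show "grade A 0 <+>\<^bsub>A\<^esub> grade A 1 = carrier A"
    proof
      show "grade A 0 <+>\<^bsub>A\<^esub> grade A 1 \<subseteq> carrier A"
      proof
        fix a assume "a \<in> grade A 0 <+>\<^bsub>A\<^esub> grade A 1"
        then obtain f0 f1 where f: "f0 \<in> Gr n 0" "f1 \<in> Gr n 1" "a = \<pi> f0 \<oplus>\<^bsub>A\<^esub> \<pi> f1" by (auto simp: set_add_def' \<pi>_grade)
        then show "a \<in> carrier A" using \<pi>_in[OF Gr_Fsub[OF f(1)]] \<pi>_in[OF Gr_Fsub[OF f(2)]] by simp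
      qed
      show "carrier A \<subseteq> grade A 0 <+>\<^bsub>A\<^esub> grade A 1"
      proof
        fix a assume "a \<in> carrier A"
        then obtain f where f: "f \<in> Fsub n" "a = \<pi> f" by (metis carrE)
        then obtain f0 f1 where g: "f0 \<in> Gr n 0" "f1 \<in> Gr n 1" "f = f0 + f1" using Fsub_split by blast
        then have "a = \<pi> f0 \<oplus>\<^bsub>A\<^esub> \<pi> f1" using \<pi>_add[OF GrF[OF g(1)] GrF[OF g(2)]] f g(3) by simp
        then show "a \<in> grade A 0 <+>\<^bsub>A\<^esub> grade A 1" using g by (auto simp: set_add_def' \<pi>_grade)
      qed
    qed
    show "grade A 0 \<inter> grade A 1 = {\<zero>\<^bsub>A\<^esub>}" using graded by (auto simp: \<pi>_grade \<pi>_zero intro!: image_eqI[of _ _ 0])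
  next
    fix x y p q assume "x \<in> grade A p" "y \<in> grade A q"
    then obtain f h where f: "f \<in> Gr n p" "x = \<pi> f" and h: "h \<in> Gr n q" "y = \<pi> h" by (auto simp: \<pi>_grade)
    show "x \<otimes>\<^bsub>A\<^esub> y \<in> grade A (p + q)" using \<pi>_mult[OF GrF[OF f(1)] GrF[OF h(1)]] Gr_mult[OF f(1) h(1)] by (simp add: \<pi>_grade f(2) h(2))
  next
    show "\<one>\<^bsub>A\<^esub> \<in> grade A 0" using Gr_1 by (auto simp: \<pi>_grade \<pi>_one)
  qed
qed

end

lemma free_image_F: "free_image (sergeev_free_superalgebra n) n (\<lambda>f. f)"
  by unfold_locales (auto simp: F_simps)

lemma rel_Fsub: "sergeev_rel n u v \<Longrightarrow> u \<in> Fsub n \<and> v \<in> Fsub n"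
proof (induction rule: sergeev_rel.induct)
qed (auto simp: generator_mon sergeev_letters_def intro!: Fsub_cl(2-5) Fsub_mon)

section \<open>The kernel of the projection to the cyclotomic algebra\<close>

definition gpol :: "'r::comm_ring_1 poly \<Rightarrow> 'r sergeev_free" where
  "gpol g = (\<Sum>i\<le>degree g. cst (coeff g i) * mon (replicate i (X_letter 1)))"

definition piA :: "nat \<Rightarrow> 'r::comm_ring_1 sergeev_free \<Rightarrow> 'r sergeev_free set" where
  "piA n f = sergeev_relation_ideal n +>\<^bsub>sergeev_free_superalgebra n\<^esub> f"

definition piC :: "nat \<Rightarrow> 'r::comm_ring_1 poly \<Rightarrow> 'r sergeev_free \<Rightarrow> 'r sergeev_free set set" where
  "piC n g f = genideal (affine_sergeev n) {poly_eval (affine_sergeev n) g (affine_x1 n)} +>\<^bsub>affine_sergeev n\<^esub> piA n f"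

lemma rel_ideal: "ideal (sergeev_relation_ideal n) (sergeev_free_superalgebra n :: ('r::comm_ring_1, 'r sergeev_free) superalgebra)"
proof -
  interpret free_image "sergeev_free_superalgebra n :: ('r, 'r sergeev_free) superalgebra" n "\<lambda>f. f" by (rule free_image_F)
  show ?thesis unfolding sergeev_relation_ideal_def
    by (intro ring.genideal_ideal[OF ring_A]) (auto simp: F_simps dest!: rel_Fsub intro!: Fsub_cl(4))
qed

lemma free_image_A: "free_image (affine_sergeev n) n (piA n)"
  unfolding affine_sergeev_def piA_def[abs_def] by (rule free_image.quotient_image[OF free_image_F rel_ideal])

lemma gpol_Fsub: fixes g :: "'r::comm_ring_1 poly" assumes "n \<ge> 1" shows "gpol g \<in> Fsub n"
proof -
  have "cst (coeff g i) * mon (replicate i (X_letter 1)) \<in> Fsub n" for i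
    using assms by (intro Fsub_cl(5,6) Fsub_mon) (auto simp: sergeev_letters_def)
  then have "(\<Sum>i\<in>S. cst (coeff g i) * mon (replicate i (X_letter 1))) \<in> Fsub n" for S
    by (induction S rule: infinite_finite_induct) auto
  then show ?thesis by (simp add: gpol_def)
qed

lemma poly_eval_gpol: fixes g :: "'r::comm_ring_1 poly" assumes "n \<ge> 1" shows "poly_eval (affine_sergeev n) g (affine_x1 n) = piA n (gpol g)"
proof -
  interpret free_image "affine_sergeev n :: ('r, 'r sergeev_free set) superalgebra" n "piA n" by (rule free_image_A)
  have x: "(mon [X_letter 1] :: 'r sergeev_free) \<in> Fsub n" using assms by (intro Fsub_mon) (auto simp: sergeev_letters_def)
  have r: "(mon [X_letter 1] :: 'r sergeev_free) ^ i = mon (replicate i (X_letter 1))" for i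
    by (induction i) (simp_all flip: mon_append)
  have rF: "(mon (replicate i (X_letter 1)) :: 'r sergeev_free) \<in> Fsub n" for i using assms by (intro Fsub_mon) (auto simp: sergeev_letters_def)
  have ax: "(affine_x1 n :: 'r sergeev_free set) = piA n (mon [X_letter 1])" by (simp add: affine_x1_def piA_def generator_mon)
  have "coeff g i \<odot>\<^bsub>affine_sergeev n\<^esub> (affine_x1 n [^]\<^bsub>affine_sergeev n\<^esub> i) = piA n (cst (coeff g i) * mon (replicate i (X_letter 1)))" for i
    unfolding ax using rF by (simp only: \<pi>_pow[OF x] r \<pi>_smult)
  then show ?thesis unfolding poly_eval_def gpol_def
    using \<pi>_finsum[of "{..degree g}" "\<lambda>i. cst (coeff g i) * mon (replicate i (X_letter 1))"] rF by simp
qed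

lemma cyc_ideal: fixes g :: "'r::comm_ring_1 poly" assumes "n \<ge> 1"
  shows "ideal (genideal (affine_sergeev n) {poly_eval (affine_sergeev n) g (affine_x1 n)}) (affine_sergeev n)"
proof -
  interpret free_image "affine_sergeev n :: ('r, 'r sergeev_free set) superalgebra" n "piA n" by (rule free_image_A)
  show ?thesis unfolding poly_eval_gpol[OF assms] using gpol_Fsub[OF assms, of g] by (intro ring.genideal_ideal[OF ring_A]) auto
qed

lemma free_image_C: fixes g :: "'r::comm_ring_1 poly" assumes "n \<ge> 1" shows "free_image (cyclotomic_sergeev n g) n (piC n g)"
  unfolding cyclotomic_sergeev_def piC_def[abs_def] by (rule free_image.quotient_image[OF free_image_A cyc_ideal[OF assms]])

text \<open>The combined kernel of the two successive quotients, as an ideal of the free algebra of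
  rank n.\<close>

definition Jk :: "nat \<Rightarrow> 'r::comm_ring_1 poly \<Rightarrow> 'r sergeev_free set" where
  "Jk n g = {f \<in> Fsub n. piC n g f = piC n g 0}"

lemma piA_zero: assumes "f \<in> Fsub n" shows "piA n f = piA n 0 \<longleftrightarrow> f \<in> sergeev_relation_ideal n"
  using free_image.quotient_eq_zero[OF free_image_F rel_ideal assms] by (simp add: piA_def)

lemma Jk_iff: fixes g :: "'r::comm_ring_1 poly" assumes "n \<ge> 1" "f \<in> Fsub n"
  shows "f \<in> Jk n g \<longleftrightarrow> piA n f \<in> genideal (affine_sergeev n) {piA n (gpol g)}"
  using free_image.quotient_eq_zero[OF free_image_A cyc_ideal[OF assms(1)] assms(2)] assms
  by (simp add: Jk_def piC_def poly_eval_gpol[OF assms(1)])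

lemma Jk_rel: fixes g :: "'r::comm_ring_1 poly" assumes "n \<ge> 1" "sergeev_rel n u v" shows "u - v \<in> Jk n g"
proof -
  interpret I: ideal "genideal (affine_sergeev n) {piA n (gpol g)}" "affine_sergeev n :: ('r, 'r sergeev_free set) superalgebra"
    using cyc_ideal[OF assms(1)] unfolding poly_eval_gpol[OF assms(1)] .
  have uv: "u - v \<in> Fsub n" using rel_Fsub[OF assms(2)] by auto
  interpret free_image "sergeev_free_superalgebra n :: ('r, 'r sergeev_free) superalgebra" n "\<lambda>f. f" by (rule free_image_F)
  have "{u - v | u v. sergeev_rel n u v} \<subseteq> (sergeev_relation_ideal n :: 'r sergeev_free set)" unfolding sergeev_relation_ideal_def
    by (intro ring.genideal_self[OF ring_A]) (auto simp: F_simps dest!: rel_Fsub intro!: Fsub_cl(4))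
  then have "piA n (u - v) = piA n 0" using assms(2) piA_zero[OF uv] by blast
  also have "\<dots> = \<zero>\<^bsub>affine_sergeev n\<^esub>" by (rule free_image.\<pi>_zero[OF free_image_A, symmetric])
  finally show ?thesis using Jk_iff[OF assms(1) uv] by simp
qed

lemma Jk_gpol: fixes g :: "'r::comm_ring_1 poly" assumes "n \<ge> 1" shows "gpol g \<in> Jk n g"
proof -
  interpret free_image "affine_sergeev n :: ('r, 'r sergeev_free set) superalgebra" n "piA n" by (rule free_image_A)
  show ?thesis unfolding Jk_iff[OF assms gpol_Fsub[OF assms]]
    by (intro ring.genideal_self'[OF ring_A] \<pi>_in gpol_Fsub assms)
qed

lemma Jk_ideal: fixes g :: "'r::comm_ring_1 poly" assumes "n \<ge> 1"
  shows "0 \<in> Jk n g" "f \<in> Jk n g \<Longrightarrow> h \<in> Jk n g \<Longrightarrow> f + h \<in> Jk n g"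
    "a \<in> Fsub n \<Longrightarrow> f \<in> Jk n g \<Longrightarrow> a * f \<in> Jk n g" "a \<in> Fsub n \<Longrightarrow> f \<in> Jk n g \<Longrightarrow> f * a \<in> Jk n g"
proof -
  interpret free_image "cyclotomic_sergeev n g" n "piC n g" by (rule free_image_C[OF assms])
  interpret ring "cyclotomic_sergeev n g" by (rule ring_A)
  show "0 \<in> Jk n g" by (simp add: Jk_def)
  show "f \<in> Jk n g \<Longrightarrow> h \<in> Jk n g \<Longrightarrow> f + h \<in> Jk n g"
    using \<pi>_add[of f h] \<pi>_add[of 0 0] by (simp add: Jk_def)
  show "a \<in> Fsub n \<Longrightarrow> f \<in> Jk n g \<Longrightarrow> a * f \<in> Jk n g" using \<pi>_mult[of a f] \<pi>_mult[of a 0] by (simp add: Jk_def)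
  show "a \<in> Fsub n \<Longrightarrow> f \<in> Jk n g \<Longrightarrow> f * a \<in> Jk n g" using \<pi>_mult[of f a] \<pi>_mult[of 0 a] by (simp add: Jk_def)
qed

text \<open>An ideal \<open>K\<close> with these elements contains the relation ideal. Its image in
  the affine algebra is an ideal containing g(x_1), hence contains the cyclotomic ideal. An element
  of the kernel thus differs from one of \<open>K\<close> by a relation.\<close>

lemma Jk_minimal:
  fixes g :: "'r::comm_ring_1 poly"
  assumes n: "n \<ge> 1" and K: "K \<subseteq> Fsub n" and K0: "0 \<in> K" and Kadd: "\<And>f h. f \<in> K \<Longrightarrow> h \<in> K \<Longrightarrow> f + h \<in> K"
    and Kl: "\<And>a f. a \<in> Fsub n \<Longrightarrow> f \<in> K \<Longrightarrow> a * f \<in> K" and Kr: "\<And>a f. a \<in> Fsub n \<Longrightarrow> f \<in> K \<Longrightarrow> f * a \<in> K"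
    and Krel: "\<And>u v. sergeev_rel n u v \<Longrightarrow> u - v \<in> K" and Kg: "gpol g \<in> K"
  shows "Jk n g \<subseteq> K"
proof
  fix f assume fJ: "f \<in> Jk n g"
  then have f: "f \<in> Fsub n" by (simp add: Jk_def)
  have Km: "f \<in> K \<Longrightarrow> - f \<in> K" for f using Kl[of "- 1" f] by simp
  interpret F: free_image "sergeev_free_superalgebra n :: ('r, 'r sergeev_free) superalgebra" n "\<lambda>f. f" by (rule free_image_F)
  interpret A: free_image "affine_sergeev n :: ('r, 'r sergeev_free set) superalgebra" n "piA n" by (rule free_image_A)
  have "ideal K (sergeev_free_superalgebra n)"
  proof (rule idealI[OF F.ring_A])
    interpret ring "sergeev_free_superalgebra n :: ('r, 'r sergeev_free) superalgebra" by (rule F.ring_A)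
    show "subgroup K (add_monoid (sergeev_free_superalgebra n))"
    proof (rule add.subgroupI)
      fix a assume a: "a \<in> K"
      then show "\<ominus>\<^bsub>sergeev_free_superalgebra n\<^esub> a \<in> K" using Km[OF a] F.\<pi>_minus[of a] K by auto
    qed (use K K0 Kadd in \<open>auto simp: F_simps\<close>)
  qed (use Kl Kr in \<open>auto simp: F_simps\<close>)
  then have rK: "sergeev_relation_ideal n \<subseteq> K" unfolding sergeev_relation_ideal_def
    using Krel by (intro ring.genideal_minimal[OF F.ring_A]) auto
  have "ideal (piA n ` K) (affine_sergeev n)"
  proof (rule idealI[OF A.ring_A])
    interpret ring "affine_sergeev n :: ('r, 'r sergeev_free set) superalgebra" by (rule A.ring_A)
    show "subgroup (piA n ` K) (add_monoid (affine_sergeev n))"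
    proof (rule add.subgroupI)
      show "piA n ` K \<subseteq> carrier (affine_sergeev n)" using K by auto
      show "piA n ` K \<noteq> {}" using K0 by auto
      fix a assume "a \<in> piA n ` K"
      then obtain k where k: "k \<in> K" "a = piA n k" by auto
      show "\<ominus>\<^bsub>affine_sergeev n\<^esub> a \<in> piA n ` K"
        using A.\<pi>_minus[of k] k K Km by auto
      fix b assume "b \<in> piA n ` K"
      then obtain k' where k': "k' \<in> K" "b = piA n k'" by auto
      then have "a \<oplus>\<^bsub>affine_sergeev n\<^esub> b = piA n (k + k')" using k K A.\<pi>_add[of k k'] by auto
      then show "a \<oplus>\<^bsub>affine_sergeev n\<^esub> b \<in> piA n ` K" using k(1) k'(1) Kadd by blast
    qed
    fix a x :: "'r sergeev_free set" assume "a \<in> piA n ` K" "x \<in> carrier (affine_sergeev n)"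
    moreover from this obtain k where "k \<in> K" "a = piA n k" by auto
    moreover obtain h where "h \<in> Fsub n" "x = piA n h" by (rule A.carrE[OF \<open>x \<in> carrier (affine_sergeev n)\<close>])
    ultimately show "x \<otimes>\<^bsub>affine_sergeev n\<^esub> a \<in> piA n ` K" "a \<otimes>\<^bsub>affine_sergeev n\<^esub> x \<in> piA n ` K"
      using K A.\<pi>_mult[of k h] A.\<pi>_mult[of h k] Kl Kr by auto
  qed
  then have "genideal (affine_sergeev n) {piA n (gpol g)} \<subseteq> piA n ` K"
    using Kg by (intro ring.genideal_minimal[OF A.ring_A]) auto
  then obtain k where k: "k \<in> K" "piA n f = piA n k" using fJ Jk_iff[OF n f] by auto
  then have kF: "k \<in> Fsub n" using K by blast
  have "f - k \<in> sergeev_relation_ideal n" using A.\<pi>_eq_iff[OF f kF] piA_zero[of "f - k" n] f k kF by simp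
  then have "(f - k) + k \<in> K" using rK k by (intro Kadd) auto
  then show "f \<in> K" by simp
qed

text \<open>The number of letters c modulo 2 is the parity of the word, which is all that a sign can
  see.\<close>

lemma power_ccount:
  assumes "\<chi> = 1 \<or> \<chi> = (- 1 :: 'r::comm_ring_1)"
  shows "\<chi> ^ ccount w = (if sum_list (map sergeev_parity w) = 1 then \<chi> else 1)"
proof (induction w)
  case (Cons l w)
  then show ?case using assms
    by (cases l; cases "sum_list (map sergeev_parity w) = 1") auto
qed auto

section \<open>From a triangular Gram matrix to (super)symmetric superalgebras\<close>

text \<open>The linear algebra, detached from the Sergeev relations: a twisted trace form together
  with two families whose Gram matrix is triangular for the rank \<open>rk\<close>, with signs on
  the diagonal.\<close>

locale free_image_form = free_image A n \<pi>
  for A :: "('r::comm_ring_1, 'a, 'm) superalgebra_scheme" and n :: nat and \<pi> +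
  fixes T :: "'r sergeev_free \<Rightarrow> 'r" and \<chi> :: 'r and Ix :: "'i set"
    and bb bd :: "'i \<Rightarrow> sergeev_letter list" and rk :: "'i \<Rightarrow> nat"
  assumes T_add: "T (f + h) = T f + T h" and T_scale: "T (cst r * f) = r * T f"
    and T_ker: "f \<in> Fsub n \<Longrightarrow> \<pi> f = \<pi> 0 \<Longrightarrow> T f = 0"
    and T_odd: "f \<in> Gr n 1 \<Longrightarrow> T f = 0"
    and T_tr: "set w \<subseteq> sergeev_letters n \<Longrightarrow> f \<in> Fsub n \<Longrightarrow> T (mon w * f) = \<chi> ^ ccount w * T (f * mon w)"
    and \<chi>: "\<chi> = 1 \<or> \<chi> = - 1"
    and fin: "finite Ix" and bb_L: "i \<in> Ix \<Longrightarrow> set (bb i) \<subseteq> sergeev_letters n"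
    and bd_L: "i \<in> Ix \<Longrightarrow> set (bd i) \<subseteq> sergeev_letters n"
    and span: "f \<in> Fsub n \<Longrightarrow> \<exists>v. \<pi> f = \<pi> (\<Sum>i\<in>Ix. cst (v i) * mon (bb i))"
    and off: "i \<in> Ix \<Longrightarrow> j \<in> Ix \<Longrightarrow> rk j \<le> rk i \<Longrightarrow> (rk j = rk i \<Longrightarrow> i \<noteq> j) \<Longrightarrow> T (mon (bd i) * mon (bb j)) = 0"
    and diag: "i \<in> Ix \<Longrightarrow> T (mon (bd i) * mon (bb i)) = 1 \<or> T (mon (bd i) * mon (bb i)) = - 1"
    and graded: "f0 \<in> Gr n 0 \<Longrightarrow> f1 \<in> Gr n 1 \<Longrightarrow> \<pi> f0 = \<pi> f1 \<Longrightarrow> \<pi> f0 = \<pi> 0"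
begin

lemma T_0 [simp]: "T 0 = 0" using T_scale[of 0 0] by simp
lemma T_diff: "T (f - h) = T f - T h" using T_add[of "f - h" h] by (simp add: algebra_simps)
lemma T_sum: "finite I \<Longrightarrow> T (\<Sum>i\<in>I. f i) = (\<Sum>i\<in>I. T (f i))"
  by (induction I rule: finite_induct) (simp_all add: T_add)

lemma T_cong: "f \<in> Fsub n \<Longrightarrow> h \<in> Fsub n \<Longrightarrow> \<pi> f = \<pi> h \<Longrightarrow> T f = T h"
  using T_ker[of "f - h"] \<pi>_eq_iff[of f h] by (simp add: T_diff)

lemma T_cong_mult: "k \<in> Fsub n \<Longrightarrow> f \<in> Fsub n \<Longrightarrow> h \<in> Fsub n \<Longrightarrow> \<pi> f = \<pi> h \<Longrightarrow> T (k * f) = T (k * h)"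
  using \<pi>_mult[of k f] \<pi>_mult[of k h] by (intro T_cong) auto

lemma sum_Fsub: "finite I \<Longrightarrow> (\<And>i. i \<in> I \<Longrightarrow> f i \<in> Fsub n) \<Longrightarrow> (\<Sum>i\<in>I. f i) \<in> Fsub n"
  by (induction I rule: finite_induct) auto

lemma bbF: "i \<in> Ix \<Longrightarrow> cst r * mon (bb i) \<in> Fsub n" using bb_L by (intro Fsub_cl(5,6) Fsub_mon)
lemma bdF: "i \<in> Ix \<Longrightarrow> cst r * mon (bd i) \<in> Fsub n" using bd_L by (intro Fsub_cl(5,6) Fsub_mon)

definition vec :: "('i \<Rightarrow> 'r) \<Rightarrow> 'r sergeev_free" where "vec v = (\<Sum>i\<in>Ix. cst (v i) * mon (bb i))"
definition vecd :: "('i \<Rightarrow> 'r) \<Rightarrow> 'r sergeev_free" where "vecd v = (\<Sum>i\<in>Ix. cst (v i) * mon (bd i))"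

lemma vec_F [simp]: "vec v \<in> Fsub n" unfolding vec_def by (intro sum_Fsub fin bbF)
lemma vecd_F [simp]: "vecd v \<in> Fsub n" unfolding vecd_def by (intro sum_Fsub fin bdF)

lemma vec_add: "vec (\<lambda>i. v i + w i) = vec v + vec w" by (simp add: vec_def distrib_right sum.distrib)
lemma vec_scale: "vec (\<lambda>i. r * v i) = cst r * vec v" by (simp add: vec_def sum_distrib_left mult.assoc)
lemma vec_diff: "vec (\<lambda>i. v i - w i) = vec v - vec w"
  using vec_add[of "\<lambda>i. v i - w i" w] by (simp add: algebra_simps)
lemma vecd_add: "vecd (\<lambda>i. v i + w i) = vecd v + vecd w" by (simp add: vecd_def distrib_right sum.distrib)

lemma cst_left: "a * (cst r * b) = cst r * (a * b)" by (metis cst_comm mult.assoc)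

lemma T_mult_vec: "T (k * vec v) = (\<Sum>j\<in>Ix. v j * T (k * mon (bb j)))"
  by (simp add: vec_def sum_distrib_left cst_left T_sum[OF fin] T_scale)

lemma T_vecd_mult: "T (vecd v * k) = (\<Sum>j\<in>Ix. v j * T (mon (bd j) * k))"
  by (simp add: vecd_def sum_distrib_right mult.assoc T_sum[OF fin] T_scale)

text \<open>Among the indices with nonzero coefficient one of maximal rank is tested: all other
  contributions vanish by triangularity, and the diagonal entry is a sign.\<close>

lemma nondegenerate:
  assumes "\<And>i. i \<in> Ix \<Longrightarrow> T (mon (bd i) * vec v) = 0" "k \<in> Ix" shows "v k = 0"
proof (rule ccontr)
  assume "v k \<noteq> 0"
  let ?S = "{i \<in> Ix. v i \<noteq> 0}"
  have S: "finite ?S" "k \<in> ?S" using fin assms(2) \<open>v k \<noteq> 0\<close> by auto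
  then have "Max (rk ` ?S) \<in> rk ` ?S" by (intro Max_in) auto
  then obtain i where i: "i \<in> Ix" "v i \<noteq> 0" "rk i = Max (rk ` ?S)" by auto
  have eq: "v j * T (mon (bd i) * mon (bb j)) = (if j = i then v i * T (mon (bd i) * mon (bb i)) else 0)" if j: "j \<in> Ix" for j
  proof (cases "j = i \<or> v j = 0")
    case False
    then have "rk j \<le> rk i" unfolding i(3) using j S by (intro Max_ge) auto
    then show ?thesis using off[OF i(1) j] False by auto
  qed auto
  have "T (mon (bd i) * vec v) = (\<Sum>j\<in>Ix. if j = i then v i * T (mon (bd i) * mon (bb i)) else 0)"
    unfolding T_mult_vec by (intro sum.cong refl eq)
  then have "T (mon (bd i) * vec v) = v i * T (mon (bd i) * mon (bb i))" using fin i(1) by simp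
  then show False using assms(1)[OF i(1)] diag[OF i(1)] i(2) by auto
qed

text \<open>The equations are solved in order of increasing rank; coefficients of rank m leave the
  equations of smaller rank untouched.\<close>

lemma triangular_solve: "\<exists>v. \<forall>j\<in>Ix. T (vecd v * mon (bb j)) = c j"
proof -
  have "\<exists>v. \<forall>j\<in>Ix. rk j < m \<longrightarrow> T (vecd v * mon (bb j)) = c j" for m
  proof (induction m)
    case (Suc m)
    then obtain v where v: "\<And>j. j \<in> Ix \<Longrightarrow> rk j < m \<Longrightarrow> T (vecd v * mon (bb j)) = c j" by blast
    \<comment> \<open>The diagonal entry is 1 or -1, hence its own inverse, so multiplying by it
      divides the defect.\<close>
    define u where "u k = (if rk k = m then T (mon (bd k) * mon (bb k)) * (c k - T (vecd v * mon (bb k))) else 0)" for k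
    have "T (vecd (\<lambda>i. v i + u i) * mon (bb j)) = c j" if j: "j \<in> Ix" "rk j < Suc m" for j
    proof -
      have eq: "u k * T (mon (bd k) * mon (bb j)) = (if k = j then u j * T (mon (bd j) * mon (bb j)) else 0)" if k: "k \<in> Ix" for k
        using off[OF k j(1)] j(2) by (auto simp: u_def)
      have "T (vecd u * mon (bb j)) = (\<Sum>k\<in>Ix. if k = j then u j * T (mon (bd j) * mon (bb j)) else 0)"
        unfolding T_vecd_mult by (intro sum.cong refl eq)
      then have "T (vecd u * mon (bb j)) = u j * T (mon (bd j) * mon (bb j))" using fin j(1) by simp
      also have "\<dots> = (if rk j = m then c j - T (vecd v * mon (bb j)) else 0)"
        using diag[OF j(1)] by (auto simp: u_def)
      finally show ?thesis using v[OF j(1)] j(2) by (auto simp: vecd_add distrib_right T_add)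
    qed
    then show ?case by (intro exI[of _ "\<lambda>i. v i + u i"]) blast
  qed simp
  moreover obtain m where "\<forall>j\<in>Ix. rk j < m" using fin finite_nat_set_iff_bounded[of "rk ` Ix"] by auto
  ultimately show ?thesis by meson
qed

lemma vec_unique: assumes "\<pi> (vec v) = \<pi> (vec w)" "i \<in> Ix" shows "v i = w i"
proof -
  have "\<pi> (vec (\<lambda>i. v i - w i)) = \<pi> 0" unfolding vec_diff using \<pi>_eq_iff[of "vec v" "vec w"] assms(1) by simp
  then have "T (mon (bd i) * vec (\<lambda>i. v i - w i)) = 0" if "i \<in> Ix" for i
    using T_cong_mult[of "mon (bd i)" "vec (\<lambda>i. v i - w i)" 0] bd_L[OF that] by simp
  from nondegenerate[OF this assms(2)] show ?thesis by simp
qed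

definition co :: "'a \<Rightarrow> 'i \<Rightarrow> 'r" where "co a = (SOME v. a = \<pi> (vec v))"

lemma co: assumes "a \<in> carrier A" shows "a = \<pi> (vec (co a))"
proof -
  obtain f where f: "f \<in> Fsub n" "a = \<pi> f" using assms by (rule carrE)
  obtain v where "\<pi> f = \<pi> (vec v)" using span[OF f(1)] unfolding vec_def by blast
  with f(2) have "a = \<pi> (vec v)" by simp
  then show ?thesis unfolding co_def by (rule someI[of "\<lambda>v. a = \<pi> (vec v)"])
qed

lemma co_eq: "i \<in> Ix \<Longrightarrow> co (\<pi> (vec v)) i = v i"
  using vec_unique[of "co (\<pi> (vec v))" v i] co[of "\<pi> (vec v)"] by simp

lemma co_add: assumes "a \<in> carrier A" "b \<in> carrier A" "i \<in> Ix" shows "co (a \<oplus>\<^bsub>A\<^esub> b) i = co a i + co b i"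
proof -
  have "a \<oplus>\<^bsub>A\<^esub> b = \<pi> (vec (co a)) \<oplus>\<^bsub>A\<^esub> \<pi> (vec (co b))" using co[OF assms(1)] co[OF assms(2)] by simp
  also have "\<dots> = \<pi> (vec (\<lambda>i. co a i + co b i))" by (simp add: \<pi>_add vec_add)
  finally show ?thesis by (simp only: co_eq[OF assms(3)])
qed

lemma co_smult: assumes "a \<in> carrier A" "i \<in> Ix" shows "co (r \<odot>\<^bsub>A\<^esub> a) i = r * co a i"
proof -
  have "r \<odot>\<^bsub>A\<^esub> a = r \<odot>\<^bsub>A\<^esub> \<pi> (vec (co a))" using co[OF assms(1)] by simp
  also have "\<dots> = \<pi> (vec (\<lambda>i. r * co a i))" by (simp add: \<pi>_smult vec_scale)
  finally show ?thesis by (simp only: co_eq[OF assms(2)])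
qed

text \<open>Coordinates are unique by \<open>nondegenerate\<close>, so the spanning family is a
  basis and the algebra is free of finite rank.\<close>

lemma fg_projective_A: "fg_projective A"
proof -
  obtain e where e: "bij_betw e {0..<card Ix} Ix" using ex_bij_betw_nat_finite[OF fin] by blast
  let ?m = "card Ix"
  have eI: "k < ?m \<Longrightarrow> e k \<in> Ix" for k using e by (auto simp: bij_betw_def)
  define emb where "emb a = (\<lambda>k. if k < ?m then co a (e k) else 0)" for a
  define rec where "rec w = \<pi> (\<Sum>k\<in>{0..<?m}. cst (w k) * mon (bb (e k)))" for w :: "nat \<Rightarrow> 'r"
  have F: "(\<Sum>k\<in>{0..<?m}. cst (w k) * mon (bb (e k))) \<in> Fsub n" for w :: "nat \<Rightarrow> 'r" by (intro sum_Fsub bbF) (auto intro: eI)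
  have 1: "emb \<in> linear_maps A (free_module ?m)"
    by (auto simp: linear_maps_def free_module_def emb_def fun_eq_iff co_add co_smult eI)
  have 2: "rec \<in> linear_maps (free_module ?m) A"
    unfolding linear_maps_def
  proof (intro CollectI conjI Pi_I ballI allI)
    fix w :: "nat \<Rightarrow> 'r" show "rec w \<in> carrier A" unfolding rec_def by (intro \<pi>_in F)
    fix v show "rec (w \<oplus>\<^bsub>free_module ?m\<^esub> v) = rec w \<oplus>\<^bsub>A\<^esub> rec v"
      unfolding rec_def by (simp add: \<pi>_add[OF F F] free_module_def distrib_right sum.distrib)
    fix r show "rec (r \<odot>\<^bsub>free_module ?m\<^esub> w) = r \<odot>\<^bsub>A\<^esub> rec w"
      unfolding rec_def by (simp add: \<pi>_smult[OF F] free_module_def sum_distrib_left mult.assoc)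
  qed
  have 3: "rec (emb a) = a" if a: "a \<in> carrier A" for a
  proof -
    have "(\<Sum>k\<in>{0..<?m}. cst (emb a k) * mon (bb (e k))) = (\<Sum>k\<in>{0..<?m}. cst (co a (e k)) * mon (bb (e k)))"
      by (intro sum.cong) (auto simp: emb_def)
    also have "\<dots> = vec (co a)" unfolding vec_def by (rule sum.reindex_bij_betw[OF e])
    finally show ?thesis unfolding rec_def using co[OF a] by simp
  qed
  show ?thesis unfolding fg_projective_def by (intro exI[of _ ?m] bexI[OF _ 1] bexI[OF _ 2] ballI 3)
qed

text \<open>The form induced on the quotient; any preimage gives the same value because
  \<open>T\<close> vanishes on the kernel.\<close>

definition tf :: "'a \<Rightarrow> 'r" where "tf a = T (SOME f. f \<in> Fsub n \<and> \<pi> f = a)"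

lemma tf: assumes "f \<in> Fsub n" shows "tf (\<pi> f) = T f"
proof -
  have "(SOME h. h \<in> Fsub n \<and> \<pi> h = \<pi> f) \<in> Fsub n \<and> \<pi> (SOME h. h \<in> Fsub n \<and> \<pi> h = \<pi> f) = \<pi> f"
    by (rule someI[of _ f]) (simp add: assms)
  then show ?thesis unfolding tf_def by (intro T_cong assms) auto
qed

lemma hat: "f \<in> Fsub n \<Longrightarrow> h \<in> Fsub n \<Longrightarrow> form_hat A tf (\<pi> f) (\<pi> h) = T (h * f)"
  by (simp add: form_hat_def \<pi>_mult tf)

lemma linear_form_tf: "linear_form A tf"
  unfolding linear_form_def by (auto elim!: carrE simp: \<pi>_add \<pi>_smult tf T_add T_scale)

lemma linear_form_vec: assumes "linear_form A \<phi>" shows "\<phi> (\<pi> (vec v)) = (\<Sum>i\<in>Ix. v i * \<phi> (\<pi> (mon (bb i))))"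
proof -
  have add: "\<phi> (\<pi> (f + h)) = \<phi> (\<pi> f) + \<phi> (\<pi> h)" if "f \<in> Fsub n" "h \<in> Fsub n" for f h
    using assms that unfolding linear_form_def by (metis \<pi>_add \<pi>_in)
  have sc: "\<phi> (\<pi> (cst r * f)) = r * \<phi> (\<pi> f)" if "f \<in> Fsub n" for r f
    using assms that unfolding linear_form_def by (metis \<pi>_smult \<pi>_in)
  have \<phi>0: "\<phi> (\<pi> 0) = 0" using sc[of 0 0] by simp
  have "\<phi> (\<pi> (\<Sum>i\<in>I. cst (v i) * mon (bb i))) = (\<Sum>i\<in>I. v i * \<phi> (\<pi> (mon (bb i)))) \<and> (\<Sum>i\<in>I. cst (v i) * mon (bb i)) \<in> Fsub n"
    if "finite I" "I \<subseteq> Ix" for I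
    using that
  proof (induction I rule: finite_induct)
    case (insert i I)
    then have i: "cst (v i) * mon (bb i) \<in> Fsub n" "mon (bb i) \<in> Fsub n" using bbF bb_L by auto
    then show ?case using insert add[OF i(1)] sc[OF i(2)] by simp
  qed (simp add: \<phi>0)
  from this[OF fin] show ?thesis by (simp add: vec_def)
qed

lemma hat_linear: "a \<in> carrier A \<Longrightarrow> form_hat A tf a \<in> dual A"
  by (auto elim!: carrE simp: dual_def linear_form_def hat \<pi>_add \<pi>_smult distrib_right mult.assoc T_add T_scale) (simp add: form_hat_def)

text \<open>Injectivity is \<open>nondegenerate\<close>, and surjectivity is
  \<open>triangular_solve\<close>, since a form is determined by its values on the basis.\<close>

lemma hat_bij: "bij_betw (form_hat A tf) (carrier A) (dual A)"
proof (rule bij_betwI')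
  fix a b assume "a \<in> carrier A" "b \<in> carrier A"
  then obtain f h where f: "f \<in> Fsub n" "a = \<pi> f" "h \<in> Fsub n" "b = \<pi> h" by (metis carrE)
  show "form_hat A tf a = form_hat A tf b \<longleftrightarrow> a = b"
  proof
    assume eq: "form_hat A tf a = form_hat A tf b"
    obtain v where v: "\<pi> (f - h) = \<pi> (vec v)" using span[of "f - h"] f by (auto simp: vec_def)
    have "T (mon (bd i) * vec v) = 0" if i: "i \<in> Ix" for i
    proof -
      have k: "mon (bd i) \<in> Fsub n" using bd_L[OF i] by simp
      have "T (mon (bd i) * vec v) = T (mon (bd i) * (f - h))" using f k v by (intro T_cong_mult) auto
      also have "\<dots> = form_hat A tf a (\<pi> (mon (bd i))) - form_hat A tf b (\<pi> (mon (bd i)))"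
        unfolding f(2,4) hat[OF f(1) k] hat[OF f(3) k] by (simp add: right_diff_distrib T_diff)
      finally show ?thesis by (simp add: eq)
    qed
    from nondegenerate[OF this] have "vec v = 0" by (simp add: vec_def)
    then show "a = b" using v f \<pi>_eq_iff[of f h] by simp
  qed simp
next
  fix a assume "a \<in> carrier A" then show "form_hat A tf a \<in> dual A" by (rule hat_linear)
next
  fix \<phi> assume \<phi>: "\<phi> \<in> dual A"
  \<comment> \<open>The solver prescribes values of products with the basis element on the right,
    while the form places it on the left; the power of \<chi> compensates for the exchange and
    squares to 1.\<close>
  obtain v where v: "\<forall>j\<in>Ix. T (vecd v * mon (bb j)) = \<chi> ^ ccount (bb j) * \<phi> (\<pi> (mon (bb j)))" using triangular_solve[of "\<lambda>j. \<chi> ^ ccount (bb j) * \<phi> (\<pi> (mon (bb j)))"] by blast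
  have "\<chi> ^ k * \<chi> ^ k = 1" for k using \<chi> by (auto simp flip: power_mult_distrib)
  then have b: "form_hat A tf (\<pi> (vecd v)) (\<pi> (mon (bb j))) = \<phi> (\<pi> (mon (bb j)))" if j: "j \<in> Ix" for j
    using v j bb_L[OF j] by (simp add: hat T_tr flip: mult.assoc)
  have h: "form_hat A tf (\<pi> (vecd v)) \<in> dual A" by (intro hat_linear) simp
  have "\<phi> x = form_hat A tf (\<pi> (vecd v)) x" for x
  proof (cases "x \<in> carrier A")
    case True
    then have x: "x = \<pi> (vec (co x))" by (rule co)
    have "\<phi> (\<pi> (vec (co x))) = form_hat A tf (\<pi> (vecd v)) (\<pi> (vec (co x)))"
      using \<phi> h b by (simp add: dual_def linear_form_vec)
    then show ?thesis using x by simp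
  next
    case False
    then show ?thesis using \<phi> h by (simp add: dual_def extensional_def)
  qed
  then show "\<exists>a\<in>carrier A. \<phi> = form_hat A tf a" by (intro bexI[of _ "\<pi> (vecd v)"]) auto
qed

lemma T_grade: assumes "f \<in> Gr n p" "h \<in> Gr n q" "p \<noteq> q" shows "T (f * h) = 0"
proof -
  have "p + q = 1" using assms(3) by (cases p; cases q) auto
  then show ?thesis using T_odd[of "f * h"] Gr_mult[OF assms(1,2)] by simp
qed

lemma gradeE: assumes "a \<in> grade A p" obtains f where "f \<in> Gr n p" "f \<in> Fsub n" "a = \<pi> f"
  using assms Gr_Fsub by (auto simp: \<pi>_grade)

lemma hat_iso: "even_iso_dual A (form_hat A tf)"
  unfolding even_iso_dual_def
proof (intro conjI hat_bij ballI allI image_subsetI)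
  fix a b x assume "a \<in> carrier A" "b \<in> carrier A" "x \<in> carrier A"
  then show "form_hat A tf (a \<oplus>\<^bsub>A\<^esub> b) x = form_hat A tf a x + form_hat A tf b x"
    by (elim carrE) (simp add: \<pi>_add hat distrib_left T_add)
next
  fix r a x assume "a \<in> carrier A" "x \<in> carrier A"
  then show "form_hat A tf (r \<odot>\<^bsub>A\<^esub> a) x = r * form_hat A tf a x"
    by (elim carrE) (simp add: \<pi>_smult hat cst_left T_scale)
next
  fix p a assume "a \<in> grade A p"
  then obtain f where f: "f \<in> Gr n p" "f \<in> Fsub n" "a = \<pi> f" by (rule gradeE)
  have "form_hat A tf a x = 0" if "q \<noteq> p" "x \<in> grade A q" for q x
  proof -
    obtain h where h: "h \<in> Gr n q" "h \<in> Fsub n" "x = \<pi> h" using \<open>x \<in> grade A q\<close> by (rule gradeE)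
    then show ?thesis using f T_grade[OF h(1) f(1) that(1)] by (simp add: hat)
  qed
  then show "form_hat A tf a \<in> dual_grade A p" using f by (auto simp: dual_grade_def intro: hat_linear)
qed

text \<open>All words occurring in a homogeneous element have the same parity, so the twist of
  \<open>T_tr\<close> is the same for each of them.\<close>

lemma T_swap: assumes f: "f \<in> Gr n p" and h: "h \<in> Fsub n" shows "T (f * h) = (if p = 1 then \<chi> else 1) * T (h * f)"
proof -
  have w: "T (mon (letters w) * h) = (if p = 1 then \<chi> else 1) * T (h * mon (letters w))" if "w \<in> Poly_Mapping.keys f" for w
  proof -
    have "set (letters w) \<subseteq> sergeev_letters n" "sum_list (map sergeev_parity (letters w)) = p" using f that by (auto simp: Gr_def)
    then show ?thesis using T_tr[of "letters w" h] h power_ccount[OF \<chi>, of "letters w"] by simp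
  qed
  let ?a = "Poly_Mapping.lookup f"
  have "T (f * h) = T ((\<Sum>w\<in>Poly_Mapping.keys f. cst (?a w) * mon (letters w)) * h)"
    by (rule arg_cong[OF poly_mapping_expand, of "\<lambda>k. T (k * h)"])
  also have "\<dots> = (\<Sum>w\<in>Poly_Mapping.keys f. ?a w * T (mon (letters w) * h))"
    by (simp add: sum_distrib_right T_sum T_scale mult.assoc)
  also have "\<dots> = (if p = 1 then \<chi> else 1) * (\<Sum>w\<in>Poly_Mapping.keys f. ?a w * T (h * mon (letters w)))"
    unfolding sum_distrib_left by (intro sum.cong refl) (simp add: w mult.left_commute)
  also have "(\<Sum>w\<in>Poly_Mapping.keys f. ?a w * T (h * mon (letters w))) = T (h * (\<Sum>w\<in>Poly_Mapping.keys f. cst (?a w) * mon (letters w)))"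
    by (simp add: sum_distrib_left cst_left T_sum T_scale)
  also have "\<dots> = T (h * f)" by (rule arg_cong[OF poly_mapping_expand[symmetric], of "\<lambda>k. T (h * k)"])
  finally show ?thesis .
qed

lemma tf_odd: "x \<in> grade A 1 \<Longrightarrow> tf x = 0"
  by (elim gradeE) (simp add: tf T_odd)

lemma superalgebra_A': "superalgebra A" by (rule superalgebra_A[OF graded])

theorem symmetric_A: assumes "\<chi> = 1" shows "symmetric_superalgebra A"
proof -
  have T: "T (f * h) = T (h * f)" if f: "f \<in> Fsub n" "h \<in> Fsub n" for f h
  proof -
    obtain f0 f1 where s: "f0 \<in> Gr n 0" "f1 \<in> Gr n 1" "f = f0 + f1" using Fsub_split[OF f(1)] by blast
    show ?thesis using T_swap[OF s(1) f(2)] T_swap[OF s(2) f(2)] assms by (simp add: s(3) distrib_left distrib_right T_add)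
  qed
  have sym: "tf (x \<otimes>\<^bsub>A\<^esub> y) = tf (y \<otimes>\<^bsub>A\<^esub> x)" if "x \<in> carrier A" "y \<in> carrier A" for x y
    using that by (elim carrE) (simp add: \<pi>_mult tf T)
  have compat: "form_hat A tf (b \<otimes>\<^bsub>A\<^esub> a \<otimes>\<^bsub>A\<^esub> c) x = form_hat A tf a (c \<otimes>\<^bsub>A\<^esub> x \<otimes>\<^bsub>A\<^esub> b)"
    if bacx: "b \<in> carrier A" "a \<in> carrier A" "c \<in> carrier A" "x \<in> carrier A" for a b c x
  proof -
    obtain fb where fb: "fb \<in> Fsub n" "b = \<pi> fb" using bacx(1) by (rule carrE)
    obtain fa where fa: "fa \<in> Fsub n" "a = \<pi> fa" using bacx(2) by (rule carrE)
    obtain fc where fc: "fc \<in> Fsub n" "c = \<pi> fc" using bacx(3) by (rule carrE)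
    obtain fx where fx: "fx \<in> Fsub n" "x = \<pi> fx" using bacx(4) by (rule carrE)
    note f = fa fb fc fx
    have "T ((fx * fb * fa) * fc) = T (fc * (fx * fb * fa))" using f by (intro T) auto
    then show ?thesis using f by (simp add: \<pi>_mult hat mult.assoc)
  qed
  show ?thesis
    unfolding symmetric_superalgebra_def superbimodule_iso_dual_def
    by (intro conjI exI[of _ tf] superalgebra_A' fg_projective_A linear_form_tf hat_iso ballI allI tf_odd sym compat; assumption)
qed

text \<open>With twist -1 the sign appears exactly for two odd factors; if the parities differ, both
  values vanish and any sign is correct.\<close>

theorem supersymmetric_A: assumes "\<chi> = - 1" shows "supersymmetric_superalgebra A"
proof -
  have T: "T (f * h) = koszul (p * q) * T (h * f)" if f: "f \<in> Gr n p" "h \<in> Gr n q" for f h p q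
  proof (cases "p = q")
    case True
    then show ?thesis using T_swap[OF f(1) Gr_Fsub[OF f(2)]] assms by (cases q) (auto simp: koszul_def)
  next
    case False
    then show ?thesis using T_grade[OF f False] T_grade[OF f(2,1)] by simp
  qed
  have sym: "tf (x \<otimes>\<^bsub>A\<^esub> y) = koszul (p * q) * tf (y \<otimes>\<^bsub>A\<^esub> x)" if xy: "x \<in> grade A p" "y \<in> grade A q" for x y p q
  proof -
    obtain f where f: "f \<in> Gr n p" "f \<in> Fsub n" "x = \<pi> f" using xy(1) by (rule gradeE)
    obtain h where h: "h \<in> Gr n q" "h \<in> Fsub n" "y = \<pi> h" using xy(2) by (rule gradeE)
    show ?thesis using T[OF f(1) h(1)] f h by (simp add: \<pi>_mult tf)
  qed
  have compat: "form_hat A tf (b \<otimes>\<^bsub>A\<^esub> a \<otimes>\<^bsub>A\<^esub> c) x = koszul (pc * (pa + px + pb)) * form_hat A tf a (c \<otimes>\<^bsub>A\<^esub> x \<otimes>\<^bsub>A\<^esub> b)"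
    if abc: "b \<in> grade A pb" "a \<in> grade A pa" "c \<in> grade A pc" "x \<in> grade A px" for a b c x pa pb pc px
  proof -
    obtain fa where fa: "fa \<in> Gr n pa" "fa \<in> Fsub n" "a = \<pi> fa" using abc(2) by (rule gradeE)
    obtain fb where fb: "fb \<in> Gr n pb" "fb \<in> Fsub n" "b = \<pi> fb" using abc(1) by (rule gradeE)
    obtain fc where fc: "fc \<in> Gr n pc" "fc \<in> Fsub n" "c = \<pi> fc" using abc(3) by (rule gradeE)
    obtain fx where fx: "fx \<in> Gr n px" "fx \<in> Fsub n" "x = \<pi> fx" using abc(4) by (rule gradeE)
    have "T ((fx * fb * fa) * fc) = koszul ((px + pb + pa) * pc) * T (fc * (fx * fb * fa))"
      by (intro T Gr_mult fa fb fc fx)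
    moreover have "(px + pb + pa) * pc = pc * (pa + px + pb)" by (simp only: mult.commute[of _ pc] add.commute add.left_commute)
    moreover have "form_hat A tf (b \<otimes>\<^bsub>A\<^esub> a \<otimes>\<^bsub>A\<^esub> c) x = T ((fx * fb * fa) * fc)" "form_hat A tf a (c \<otimes>\<^bsub>A\<^esub> x \<otimes>\<^bsub>A\<^esub> b) = T (fc * (fx * fb * fa))"
      using fa fb fc fx by (simp_all add: \<pi>_mult hat mult.assoc)
    ultimately show ?thesis by simp
  qed
  show ?thesis
    unfolding supersymmetric_superalgebra_def signed_superbimodule_iso_dual_def
    by (intro conjI exI[of _ tf] superalgebra_A' fg_projective_A linear_form_tf hat_iso ballI allI tf_odd sym compat; assumption)
qed

end

section \<open>The kernel is homogeneous\<close>

lemma Gr_diff: "f \<in> Gr n p \<Longrightarrow> h \<in> Gr n p \<Longrightarrow> f - h \<in> Gr n p"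
  using Gr_add[of f n p "- h"] Gr_minus[of h n p] by simp

lemma Gr_monI: "set w \<subseteq> sergeev_letters n \<Longrightarrow> sum_list (map sergeev_parity w) = p \<Longrightarrow> mon w \<in> Gr n p"
  using Gr_mon by blast

lemma Gr_disjoint: "f \<in> Gr n 0 \<Longrightarrow> f \<in> Gr n 1 \<Longrightarrow> f = 0"
  by (rule ccontr) (auto simp: Gr_def simp flip: keys_eq_empty)

lemma rel_homogeneous: "sergeev_rel n u v \<Longrightarrow> u - v \<in> Gr n 0 \<or> u - v \<in> Gr n 1"
proof (induction rule: sergeev_rel.induct)
qed ((intro disjI1; simp only: generator_mon append.simps flip: mon_append; intro Gr_diff Gr_add Gr_minus Gr_1 Gr_monI; auto simp: sergeev_letters_def; fail) |
     (intro disjI2; simp only: generator_mon append.simps flip: mon_append; intro Gr_diff Gr_add Gr_minus Gr_1 Gr_monI; auto simp: sergeev_letters_def; fail))+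

lemma gpol_Gr: assumes "n \<ge> 1" shows "gpol g \<in> Gr n 0"
proof -
  have p: "sum_list (map sergeev_parity (replicate i (X_letter 1))) = 0" for i by (induction i) auto
  have "cst (coeff g i) * mon (replicate i (X_letter 1)) \<in> Gr n 0" for i
    using assms by (intro Gr_scale Gr_monI p) (auto simp: sergeev_letters_def)
  then have "(\<Sum>i\<in>S. cst (coeff g i) * mon (replicate i (X_letter 1))) \<in> Gr n 0" for S
    by (induction S rule: infinite_finite_induct) (auto intro: Gr_add)
  then show ?thesis by (simp add: gpol_def)
qed

text \<open>The sums of homogeneous kernel elements form an ideal that contains the generators, all
  of which are homogeneous; \<open>Jk_minimal\<close> finishes.\<close>

lemma Jk_homogeneous:
  fixes g :: "'r::comm_ring_1 poly"
  assumes n: "n \<ge> 1" and f: "f \<in> Jk n g"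
  obtains f0 f1 where "f0 \<in> Jk n g" "f0 \<in> Gr n 0" "f1 \<in> Jk n g" "f1 \<in> Gr n 1" "f = f0 + f1"
proof -
  note J = Jk_ideal[OF n, where g = g]
  let ?K = "{f0 + f1 | f0 f1. f0 \<in> Jk n g \<and> f0 \<in> Gr n 0 \<and> f1 \<in> Jk n g \<and> f1 \<in> Gr n 1}"
  have KI: "f0 + f1 \<in> ?K" if "f0 \<in> Jk n g" "f0 \<in> Gr n 0" "f1 \<in> Jk n g" "f1 \<in> Gr n 1" for f0 f1 using that by blast
  have "Jk n g \<subseteq> ?K"
  proof (rule Jk_minimal[OF n])
    show "?K \<subseteq> Fsub n" by (auto intro!: Fsub_cl(2) simp: Jk_def)
    show "0 \<in> ?K" using KI[of 0 0] J(1) by simp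
  next
    fix f h assume "f \<in> ?K" "h \<in> ?K"
    then obtain f0 f1 h0 h1 where a: "f = f0 + f1" "h = h0 + h1" "f0 \<in> Jk n g" "f0 \<in> Gr n 0" "f1 \<in> Jk n g" "f1 \<in> Gr n 1"
      "h0 \<in> Jk n g" "h0 \<in> Gr n 0" "h1 \<in> Jk n g" "h1 \<in> Gr n 1" by blast
    have "(f0 + h0) + (f1 + h1) \<in> ?K" by (intro KI J(2) Gr_add a)
    then show "f + h \<in> ?K" by (simp add: a(1,2) ac_simps)
  next
    fix a f :: "'r sergeev_free" assume "a \<in> Fsub n" "f \<in> ?K"
    then obtain f0 f1 where b: "f = f0 + f1" "f0 \<in> Jk n g" "f0 \<in> Gr n 0" "f1 \<in> Jk n g" "f1 \<in> Gr n 1" by blast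
    obtain a0 a1 where a: "a0 \<in> Gr n 0" "a1 \<in> Gr n 1" "a = a0 + a1" using Fsub_split[OF \<open>a \<in> Fsub n\<close>] by blast
    have m: "x \<in> Gr n p \<Longrightarrow> y \<in> Gr n q \<Longrightarrow> p + q = r \<Longrightarrow> x * y \<in> Gr n r" for x y :: "'r sergeev_free" and p q r
      using Gr_mult by blast
    have aF: "a0 \<in> Fsub n" "a1 \<in> Fsub n" using Gr_Fsub a(1) a(2) by blast+
    have "(a0 * f0 + a1 * f1) + (a0 * f1 + a1 * f0) \<in> ?K"
      by (intro KI J(2) J(3) aF b Gr_add m[OF a(1) b(3)] m[OF a(2) b(5)] m[OF a(1) b(5)] m[OF a(2) b(3)]) auto
    then show "a * f \<in> ?K" by (simp add: a(3) b(1) algebra_simps)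
    have "(f0 * a0 + f1 * a1) + (f1 * a0 + f0 * a1) \<in> ?K"
      by (intro KI J(2) J(4) aF b Gr_add m[OF b(3) a(1)] m[OF b(5) a(2)] m[OF b(5) a(1)] m[OF b(3) a(2)]) auto
    then show "f * a \<in> ?K" by (simp add: a(3) b(1) algebra_simps)
  next
    fix u v :: "'r sergeev_free" assume r: "sergeev_rel n u v"
    then show "u - v \<in> ?K"
      using rel_homogeneous[OF r] KI[of "u - v" 0] KI[of 0 "u - v"] Jk_rel[OF n r] J(1) by auto
  next
    show "gpol g \<in> ?K" using KI[of "gpol g" 0] gpol_Gr[OF n, of g] Jk_gpol[OF n, of g] J(1) by simp
  qed
  then have "f \<in> ?K" using f by (rule subsetD)
  then show ?thesis using that by blast
qed

text \<open>If f0 and f1 agree in the quotient, then f0 - f1 = h0 + h1 with h0 even, h1 odd and both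
  in the kernel. Comparing even parts gives f0 = h0.\<close>

lemma piC_graded:
  fixes g :: "'r::comm_ring_1 poly"
  assumes n: "n \<ge> 1" and f: "f0 \<in> Gr n 0" "f1 \<in> Gr n 1" and eq: "piC n g f0 = piC n g f1"
  shows "piC n g f0 = piC n g 0"
proof -
  have "piC n g (f0 - f1) = piC n g 0"
    using free_image.\<pi>_eq_iff[OF free_image_C[OF n] Gr_Fsub[OF f(1)] Gr_Fsub[OF f(2)], of g] eq by simp
  then have "f0 - f1 \<in> Jk n g" using Gr_Fsub[OF f(1)] Gr_Fsub[OF f(2)] by (simp add: Jk_def)
  then obtain h0 h1 where h: "h0 \<in> Jk n g" "h0 \<in> Gr n 0" "h1 \<in> Jk n g" "h1 \<in> Gr n 1" "f0 - f1 = h0 + h1" by (rule Jk_homogeneous[OF n])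
  have "f0 - h0 = f1 + h1" using h(5) by (simp add: algebra_simps)
  then have "f0 - h0 = 0" using Gr_diff[OF f(1) h(2)] Gr_add[OF f(2) h(4)] Gr_disjoint by metis
  then show ?thesis using h(1) by (simp add: Jk_def)
qed

lemma cst_left: "a * (cst r * b) = cst r * (a * b)" by (metis cst_comm mult.assoc)

section \<open>The action of the free algebra and its annihilator\<close>

context sergeev_rep
begin

definition actF :: "'r sergeev_free \<Rightarrow> 'v \<Rightarrow> 'v" where
  "actF f v = (\<Sum>w\<in>Poly_Mapping.keys f. Poly_Mapping.lookup f w \<cdot> actw (letters w) v)"

lemma actF_superset:
  assumes "finite S" "Poly_Mapping.keys f \<subseteq> S"
  shows "actF f v = (\<Sum>w\<in>S. Poly_Mapping.lookup f w \<cdot> actw (letters w) v)"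
  unfolding actF_def using assms by (intro sum.mono_neutral_left) (auto simp: in_keys_iff)

lemma actF_add: "actF (f + h) v = actF f v + actF h v"
proof -
  let ?S = "Poly_Mapping.keys f \<union> Poly_Mapping.keys h"
  have "Poly_Mapping.keys (f + h) \<subseteq> ?S" using keys_add[of f h] by simp
  then show ?thesis by (simp add: actF_superset[of ?S] lookup_add scale_add_left sum.distrib)
qed

lemma actF_0 [simp]: "actF 0 v = 0" by (simp add: actF_def)
lemma actF_minus: "actF (- f) v = - actF f v"
  using actF_add[of "- f" f v] by (simp add: eq_neg_iff_add_eq_0)
lemma actF_diff: "actF (f - h) v = actF f v - actF h v"
  using actF_add[of f "- h" v] actF_minus[of h v] by simp
lemma actF_sum: "finite I \<Longrightarrow> actF (\<Sum>i\<in>I. f i) v = (\<Sum>i\<in>I. actF (f i) v)"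
  by (induction I rule: finite_induct) (simp_all add: actF_add)

lemma actF_term: "actF (cst r * mon w) v = r \<cdot> actw w v"
  by (cases "r = 0") (simp_all add: single_Word[symmetric] actF_def)

lemma actF_mon [simp]: "actF (mon w) v = actw w v"
  using actF_term[of 1 w v] by simp
lemma actF_1 [simp]: "actF 1 v = v"
  using actF_mon[of "[]" v] by simp

lemma lin_scalar: "lin (\<lambda>v. r \<cdot> v)"
  unfolding lin_def by (metis scale_add_right scale_scale mult.commute)

lemma actF_scale: "actF (cst r * f) v = r \<cdot> actF f v"
proof -
  have "actF (cst r * f) v = actF (cst r * (\<Sum>w\<in>Poly_Mapping.keys f. cst (Poly_Mapping.lookup f w) * mon (letters w))) v"
    by (rule arg_cong[OF poly_mapping_expand, of "\<lambda>f. actF (cst r * f) v"])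
  also have "\<dots> = (\<Sum>w\<in>Poly_Mapping.keys f. actF (cst (r * Poly_Mapping.lookup f w) * mon (letters w)) v)"
    by (simp add: sum_distrib_left actF_sum mult.assoc)
  also have "\<dots> = r \<cdot> actF f v" unfolding actF_term by (simp only: actF_def lin_sum[OF lin_scalar] scale_scale)
  finally show ?thesis .
qed

lemma lin_actF: "lin (actF f)"
  unfolding lin_def actF_def
  by (simp add: lin_rules[OF lin_actw] scale_add_right sum.distrib lin_sum[OF lin_scalar] lin_scale[OF lin_scalar])

lemma actF_mon_mult: "actF (mon u * f) v = actw u (actF f v)"
proof -
  have "actF (mon u * f) v = actF (mon u * (\<Sum>w\<in>Poly_Mapping.keys f. cst (Poly_Mapping.lookup f w) * mon (letters w))) v"
    by (rule arg_cong[OF poly_mapping_expand, of "\<lambda>f. actF (mon u * f) v"])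
  also have "\<dots> = (\<Sum>w\<in>Poly_Mapping.keys f. actF (cst (Poly_Mapping.lookup f w) * mon (u @ letters w)) v)"
    by (simp only: sum_distrib_left actF_sum finite_keys mon_append cst_left)
  also have "\<dots> = actw u (actF f v)"
    unfolding actF_term by (simp only: actF_def lin_rules[OF lin_actw] actw_simps)
  finally show ?thesis .
qed

lemma actF_mult: "actF (f * h) v = actF f (actF h v)"
proof -
  have "actF (f * h) v = actF ((\<Sum>w\<in>Poly_Mapping.keys f. cst (Poly_Mapping.lookup f w) * mon (letters w)) * h) v"
    by (rule arg_cong[OF poly_mapping_expand, of "\<lambda>f. actF (f * h) v"])
  also have "\<dots> = (\<Sum>w\<in>Poly_Mapping.keys f. Poly_Mapping.lookup f w \<cdot> actw (letters w) (actF h v))"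
    by (simp add: sum_distrib_right actF_sum mult.assoc actF_scale actF_mon_mult)
  finally show ?thesis by (simp add: actF_def)
qed

lemma actF_W: "f \<in> Fsub n \<Longrightarrow> v \<in> W \<Longrightarrow> actF f v \<in> W"
  by (induction rule: Fsub_induct) (auto simp: actF_add actF_scale actw_W)

lemma actF_rel: "sergeev_rel n p q \<Longrightarrow> v \<in> W \<Longrightarrow> actF p v = actF q v"
proof (induction rule: sergeev_rel.induct)
  case (2 i j)
  then have "i + 1 < j \<or> j + 1 < i" by linarith
  with 2 show ?case using s_far[of i j v] by (auto simp: generator_mon simp flip: mon_append)
next
  case (3 i) then show ?case using braid[of i v] by (auto simp: generator_mon simp flip: mon_append)
next
  case (4 i j) then show ?case using xs_xs[of i j v] by (auto simp: generator_mon simp flip: mon_append)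
next
  case (6 i j) then show ?case using cs_anti[of i j v] by (auto simp: generator_mon actF_minus simp flip: mon_append)
next
  case (7 i) then show ?case using s_xs[of i v] by (auto simp: generator_mon actF_diff actF_add simp flip: mon_append)
next
  case (8 i j)
  then have "j < i \<or> i + 1 < j" by linarith
  with 8 show ?case using s_xs_far[of j i v] by (auto simp: generator_mon simp flip: mon_append)
next
  case (9 i) then show ?case using s_cs[of i v] by (auto simp: generator_mon simp flip: mon_append)
next
  case (10 i) then show ?case using s_cs'[of i v] by (auto simp: generator_mon simp flip: mon_append)
next
  case (11 i j)
  then have "j < i \<or> i + 1 < j" by linarith
  with 11 show ?case using s_cs_far[of j i v] by (auto simp: generator_mon simp flip: mon_append)
next
  case (12 i) then show ?case using xs_cs[of i v] by (auto simp: generator_mon actF_minus simp flip: mon_append)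
next
  case (13 i j) then show ?case using xs_cs_ne[of i j v] by (auto simp: generator_mon simp flip: mon_append)
qed (auto simp: generator_mon ss cs_cs simp flip: mon_append)

lemma actF_gpol: assumes "n \<ge> 1" "v \<in> W" shows "actF (gpol g) v = 0"
proof -
  have "act1 (X_letter 1) = x" by (simp add: fun_eq_iff xs_1)
  then have "actF (gpol g) v = (\<Sum>i\<le>degree g. coeff g i \<cdot> (x ^^ i) v)"
    by (simp only: gpol_def actF_sum finite_atMost actF_term actw_replicate)
  then show ?thesis using gx[OF assms] by simp
qed

text \<open>The annihilator of \<open>W\<close> is a two-sided ideal containing the relations and
  g(x_1), so it contains the kernel by minimality.\<close>

lemma actF_Jk: assumes n: "n \<ge> 1" and f: "f \<in> Jk n g" and v: "v \<in> W" shows "actF f v = 0"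
proof -
  have "Jk n g \<subseteq> {f \<in> Fsub n. \<forall>v\<in>W. actF f v = 0}"
  proof (rule Jk_minimal[OF n])
    show "gpol g \<in> {f \<in> Fsub n. \<forall>v\<in>W. actF f v = 0}" using gpol_Fsub[OF n, of g] actF_gpol[OF n] by simp
    fix p q :: "'r sergeev_free" assume "sergeev_rel n p q"
    then show "p - q \<in> {f \<in> Fsub n. \<forall>v\<in>W. actF f v = 0}" using rel_Fsub[of n p q] actF_rel[of p q] by (simp add: actF_diff)
  qed (auto simp: actF_add actF_mult actF_W lin_rules[OF lin_actF])
  then show ?thesis using f v by blast
qed

lemma par_actw: "par (actw w v) = (if sum_list (map sergeev_parity w) = 1 then - actw w (par v) else actw w (par v))"
proof (induction w)
  case (Cons l w)
  then show ?case
    by (cases l; cases "sum_list (map sergeev_parity w) = 1") (auto simp: par_s par_xs par_cs)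
qed simp

text \<open>The parity operator fixes \<open>om\<close> and \<open>ev\<close> but changes the sign
  of an odd word, so the value equals its own negative; 2 is invertible.\<close>

lemma ev_odd: assumes two: "(2::'r) dvd 1" and f: "f \<in> Gr n 1" shows "ev (actF f om) = 0"
proof -
  obtain k :: 'r where k: "1 = 2 * k" using two by (rule dvdE)
  have "ev (actw (letters w) om) = 0" if "w \<in> Poly_Mapping.keys f" for w
  proof -
    have "ev (actw (letters w) om) = - ev (actw (letters w) om)"
      using ev_par[of "actw (letters w) om"] that f by (simp add: par_actw par_om Gr_def)
    then have "2 * ev (actw (letters w) om) = 0" unfolding mult_2 by (metis add.right_inverse)
    moreover have "ev (actw (letters w) om) = k * (2 * ev (actw (letters w) om))" using k by (metis mult.assoc mult.commute mult_1)
    ultimately show ?thesis by simp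
  qed
  moreover have "ev (\<Sum>w\<in>I. h w) = (\<Sum>w\<in>I. ev (h w))" if "finite I" for I and h :: "sergeev_letter free_monoid \<Rightarrow> 'v"
    using that by (induction I rule: finite_induct) (simp_all add: ev_add)
  ultimately show ?thesis by (simp add: actF_def ev_scale)
qed

end

section \<open>Assembling the trace form and the theorem\<close>

text \<open>The matrix coefficient f -> ev(f om) descends to the quotient, vanishes below the top
  degree by the filtration, and vanishes on odd elements by parity.\<close>

lemma sergeev_trace_exists:
  fixes g :: "'r::idom poly"
  assumes n: "n \<ge> 1" and d: "degree g \<ge> 1" and lead: "lead_coeff g = 1"
    and par: "\<And>m. coeff g m \<noteq> 0 \<Longrightarrow> even m = even (degree g)" and two: "(2::'r) dvd 1"
  shows "\<exists>T. sergeev_trace n (degree g) g (Jk n g) T \<and> (\<forall>f\<in>Gr n 1. T f = 0)"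
proof -
  obtain W :: "'r stream_space set" and x c s par' G om ev where "sergeev_rep pointwise_scale g n W x c s par' G om ev"
    using sergeev_rep_exists[OF d lead par, of n] by blast
  then interpret R: sergeev_rep pointwise_scale g n W x c s par' G om ev .
  have om: "om \<in> W" by (rule R.G_W[OF R.om_G])
  have "sergeev_ideal n (degree g) g (Jk n g)"
  proof (rule sergeev_ideal.intro)
    show "n \<ge> 1" "degree g \<ge> 1" "degree g = degree g" "lead_coeff g = 1" by (rule n d refl lead)+
    show "even m = even (degree g)" if "coeff g m \<noteq> 0" for m by (rule par[OF that])
    show "(\<Sum>i\<le>degree g. cst (coeff g i) * mon (replicate i (X_letter 1))) \<in> Jk n g"
      using Jk_gpol[OF n, of g] by (simp only: gpol_def)
    show "u - v \<in> Jk n g" if "sergeev_rel n u v" for u v by (rule Jk_rel[OF n that])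
  qed (rule Jk_ideal[OF n]; assumption)+
  moreover have "sergeev_trace_axioms n (degree g) (Jk n g) (\<lambda>f. ev (R.actF f om))"
  proof (rule sergeev_trace_axioms.intro)
    show "ev (R.actF (f + h) om) = ev (R.actF f om) + ev (R.actF h om)" for f h by (simp only: R.actF_add R.ev_add)
    show "ev (R.actF (cst r * f) om) = r * ev (R.actF f om)" for r f by (simp only: R.actF_scale R.ev_scale)
    show "ev (R.actF f om) = 0" if "f \<in> Jk n g" for f by (simp only: R.actF_Jk[OF n that om] R.ev_zero)
    show "ev (R.actF (mon (xtop (degree g - 1) n @ y)) om) = (if y = [] then 1 else 0)" if "y \<in> NF n" for y
      unfolding R.actF_mon by (rule R.ev_NF[OF that])
    fix w assume w: "set w \<subseteq> sergeev_letters n" "xcount w < n * (degree g - 1)"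
    then have "R.actw w om \<in> G (n * (degree g - 1) - xcount w)" by (intro R.G_actw R.om_G)
    moreover obtain k where "n * (degree g - 1) - xcount w = Suc k" using w(2) by (metis Suc_diff_Suc)
    ultimately show "ev (R.actF (mon w) om) = 0" unfolding R.actF_mon by (intro R.ev_G[of _ k]) simp
  qed
  ultimately have T: "sergeev_trace n (degree g) g (Jk n g) (\<lambda>f. ev (R.actF f om))" by (rule sergeev_trace.intro)
  show ?thesis by (intro exI[of _ "\<lambda>f. ev (R.actF f om)"] conjI T ballI R.ev_odd two)
qed

lemma Jk_D: "f \<in> Jk n g \<Longrightarrow> piC n g f = piC n g 0" by (simp add: Jk_def)

lemma cyclotomic_symmetric:
  fixes g :: "'r::idom poly"
  assumes n: "n \<ge> 1" and d: "degree g \<ge> 1" and lead: "lead_coeff g = 1"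
    and par: "\<And>m. coeff g m \<noteq> 0 \<Longrightarrow> even m = even (degree g)" and two: "(2::'r) dvd 1"
  shows "(odd (degree g) \<longrightarrow> symmetric_superalgebra (cyclotomic_sergeev n g)) \<and>
    (even (degree g) \<longrightarrow> supersymmetric_superalgebra (cyclotomic_sergeev n g))"
proof -
  obtain T where T: "sergeev_trace n (degree g) g (Jk n g) T" "\<forall>f\<in>Gr n 1. T f = 0"
    using sergeev_trace_exists[OF n d lead par two] by blast
  interpret T: sergeev_trace n "degree g" g "Jk n g" T by (rule T(1))
  interpret A: free_image "cyclotomic_sergeev n g" n "piC n g" by (rule free_image_C[OF n])
  \<comment> \<open>The twist is (-1)^(d-1), and the rank of an index is the degree of its x
    part.\<close>
  interpret free_image_form "cyclotomic_sergeev n g" n "piC n g" T "(- 1) ^ (degree g - 1)" T.Ix T.bb T.bd "\<lambda>i. size (fst i)"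
  proof
    fix f :: "'r sergeev_free" assume f: "f \<in> Fsub n"
    show "piC n g f = piC n g 0 \<Longrightarrow> T f = 0" using f by (intro T.T_J) (simp add: Jk_def)
    obtain v where v: "T.eqv f (\<Sum>i\<in>T.Ix. cst (v i) * mon (T.bb i))" using T.spanning[OF f] by blast
    have F: "cst (v i) * mon (T.bb i) \<in> Fsub n" if "i \<in> T.Ix" for i using T.bb_L[OF that] by (intro Fsub_cl(5,6) Fsub_mon)
    have s: "(\<Sum>i\<in>T.Ix. cst (v i) * mon (T.bb i)) \<in> Fsub n"
      by (rule conjunct2[OF A.\<pi>_finsum[OF T.finite_Ix, of "\<lambda>i. cst (v i) * mon (T.bb i)"]]) (rule F)
    have "piC n g f = piC n g (\<Sum>i\<in>T.Ix. cst (v i) * mon (T.bb i))"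
      using Jk_D[OF v[unfolded T.eqv_def]] A.\<pi>_eq_iff[OF f s] by blast
    then show "\<exists>v. piC n g f = piC n g (\<Sum>i\<in>T.Ix. cst (v i) * mon (T.bb i))" by (rule exI[of _ v])
  next
    fix w and f :: "'r sergeev_free" assume "set w \<subseteq> sergeev_letters n" "f \<in> Fsub n"
    then show "T (mon w * f) = ((- 1) ^ (degree g - 1)) ^ ccount w * T (f * mon w)"
      using T.trace_word[of w] by (simp add: T.tr_def)
  next
    fix i j assume "i \<in> T.Ix" "j \<in> T.Ix" "size (fst j) \<le> size (fst i)" "size (fst j) = size (fst i) \<Longrightarrow> i \<noteq> j"
    then show "T (mon (T.bd i) * mon (T.bb j)) = 0" by (rule T.gram_off)
  next
    fix f0 f1 :: "'r sergeev_free" assume "f0 \<in> Gr n 0" "f1 \<in> Gr n 1" "piC n g f0 = piC n g f1"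
    then show "piC n g f0 = piC n g 0" by (rule piC_graded[OF n])
  qed (use T.T_add T.T_scale T(2) T.finite_Ix T.bb_L T.bd_L T.gram_diag in \<open>auto simp: uminus_power_if\<close>)
  show ?thesis using symmetric_A supersymmetric_A d by (auto simp: uminus_power_if)
qed

text \<open>For g = 1 the ideal is everything and the quotient is zero; the zero form with an empty
  basis satisfies all requirements with twist -1.\<close>

lemma cyclotomic_supersymmetric_0:
  assumes n: "n \<ge> 1" shows "supersymmetric_superalgebra (cyclotomic_sergeev n (1 :: 'r::idom poly))"
proof -
  have "gpol (1 :: 'r poly) = 1" by (simp add: gpol_def)
  then have "(1 :: 'r sergeev_free) \<in> Jk n 1" using Jk_gpol[OF n, of "1 :: 'r poly"] by simp
  then have J: "f \<in> Jk n 1" if "f \<in> Fsub n" for f :: "'r sergeev_free" using Jk_ideal(3)[OF n that, of 1 1] by simp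
  have "free_image_form_axioms n (piC n (1 :: 'r poly)) (\<lambda>_. 0) (- 1) ({} :: nat set) (\<lambda>_. []) (\<lambda>_. []) (\<lambda>_. 0)"
    by (rule free_image_form_axioms.intro) (simp_all only: empty_iff add_0_left mult_zero_right finite.emptyI simp_thms Gr_Fsub[of _ n 1] Jk_D[OF J] sum.empty)
  from free_image_form.supersymmetric_A[OF free_image_form.intro[OF free_image_C[OF n] this]]
  show ?thesis by simp
qed

theorem theorem1p2:
  fixes a :: "nat \<Rightarrow> 'r::idom" and n d :: nat and g :: "'r poly"
  assumes "(2::'r) dvd 1"
    and "n \<ge> 1"
    and "a d = 1"
    and "g = (\<Sum>t = 0..d div 2. Polynomial.monom (a (d - 2 * t)) (d - 2 * t))"
  shows "(odd d \<longrightarrow> symmetric_superalgebra (cyclotomic_sergeev n g)) \<and>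
         (even d \<longrightarrow> supersymmetric_superalgebra (cyclotomic_sergeev n g))"
proof -
  have co: "coeff g m = (\<Sum>t = 0..d div 2. if d - 2 * t = m then a (d - 2 * t) else 0)" for m
    by (simp add: assms(4) coeff_sum)
  \<comment> \<open>Every exponent of g is d - 2t with 2t <= d, which yields both the degree bound
    and the common parity.\<close>
  have nz: "m \<le> d \<and> even m = even d" if m: "coeff g m \<noteq> 0" for m
  proof -
    have "\<exists>t\<in>{0..d div 2}. d - 2 * t = m"
    proof (rule ccontr)
      assume "\<not> ?thesis"
      then have "(\<Sum>t = 0..d div 2. if d - 2 * t = m then a (d - 2 * t) else 0) = 0" by (intro sum.neutral) auto
      with m show False by (simp add: co)
    qed
    then obtain t where "t \<in> {0..d div 2}" "d - 2 * t = m" by blast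
    then have "m + 2 * t = d" by auto
    then show ?thesis by auto
  qed
  \<comment> \<open>Only t = 0 reaches the exponent d, so the coefficient is a(d) = 1 and the degree
    is exactly d.\<close>
  have "coeff g d = (\<Sum>t = 0..d div 2. if t = 0 then a d else 0)"
    unfolding co by (intro sum.cong) auto
  then have lead: "coeff g d = 1" using assms(3) by simp
  have "degree g \<le> d" by (intro degree_le allI impI) (metis nz leD)
  then have deg: "degree g = d" using le_degree[of g d] lead by simp
  show ?thesis
  proof (cases "d = 0")
    \<comment> \<open>In degree 0 the polynomial is the constant 1, which is the case of the zero
      algebra.\<close>
    case True
    then obtain c where "g = [:c:]" using deg degree_eq_zeroE by blast
    then have "g = 1" using lead True by (simp add: one_pCons)
    then show ?thesis using cyclotomic_supersymmetric_0[OF assms(2)] True by simp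
  next
    case False
    have d1: "degree g \<ge> 1" using deg False by simp
    have lc: "lead_coeff g = 1" using deg lead by simp
    have par: "even m = even (degree g)" if "coeff g m \<noteq> 0" for m using nz[OF that] deg by simp
    show ?thesis by (rule cyclotomic_symmetric[OF assms(2) d1 lc par assms(1), unfolded deg])
  qed
qed

end
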